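(* Let $p\in(2,\infty)$ and let $\mathbb{D}$ be the open unit disk. There exist a Jordan domain $\mathbb{Y}\subset\mathbb{C}$ with rectifiable boundary and a homeomorphism $\varphi\colon\partial\mathbb{D}\to\partial\mathbb{Y}$ (onto) such that \[ \int_{\partial\mathbb{D}}\int_{\partial\mathbb{D}}\frac{|\varphi(x)-\varphi(y)|^p}{|x-y|^p}\,dx\,dy<\infty, \] but there is no homeomorphism $h\colon\overline{\mathbb{D}}\to\overline{\mathbb{Y}}$ with $h=\varphi$ on $\partial\mathbb{D}$ and $h\in\mathscr{W}^{1,p}(\mathbb{D},\mathbb{R}^2)$.
   Context: Integrals over $\partial\mathbb{D}$ are with respect to arc length measure. *)

theory Defs
  imports "HOL-Analysis.Analysis"
begin

definition rectifiable_path :: "(real \<Rightarrow> complex) \<Rightarrow> bool" where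
  "rectifiable_path g \<longleftrightarrow> path g \<and>
     (\<exists>B. \<forall>(n::nat) (t::nat \<Rightarrow> real). t 0 = 0 \<and> t n = 1 \<and> (\<forall>i<n. t i \<le> t (Suc i))
        \<longrightarrow> (\<Sum>i<n. cmod (g (t (Suc i)) - g (t i))) \<le> B)"

definition jordan_domain :: "complex set \<Rightarrow> bool" where
  "jordan_domain Y \<longleftrightarrow>
     (\<exists>g. simple_path g \<and> pathfinish g = pathstart g \<and> Y = inside (path_image g))"

definition jordan_domain_rectifiable_boundary :: "complex set \<Rightarrow> bool" where
  "jordan_domain_rectifiable_boundary Y \<longleftrightarrow>
     (\<exists>g. simple_path g \<and> pathfinish g = pathstart g \<and> Y = inside (path_image g)
          \<and> rectifiable_path g)"

definition pdir :: "bool \<Rightarrow> complex" where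
  "pdir b = (if b then \<i> else 1)"

definition partial :: "bool \<Rightarrow> (complex \<Rightarrow> real) \<Rightarrow> complex \<Rightarrow> real" where
  "partial b f z = deriv (\<lambda>t. f (z + of_real t * pdir b)) 0"

fun iter_partial :: "bool list \<Rightarrow> (complex \<Rightarrow> real) \<Rightarrow> complex \<Rightarrow> real" where
  "iter_partial [] f = f"
| "iter_partial (b # bs) f = partial b (iter_partial bs f)"

definition smooth_plane :: "(complex \<Rightarrow> real) \<Rightarrow> bool" where
  "smooth_plane f \<longleftrightarrow> (\<forall>bs. continuous_on UNIV (iter_partial bs f) \<and>
      (\<forall>b z. (\<lambda>t. iter_partial bs f (z + of_real t * pdir b)) differentiable (at 0)))"

definition test_function :: "complex set \<Rightarrow> (complex \<Rightarrow> real) \<Rightarrow> bool" where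
  "test_function U \<psi> \<longleftrightarrow> smooth_plane \<psi> \<and> compact (closure {z. \<psi> z \<noteq> 0})
      \<and> closure {z. \<psi> z \<noteq> 0} \<subseteq> U"

definition Lp_on :: "real \<Rightarrow> complex set \<Rightarrow> (complex \<Rightarrow> complex) \<Rightarrow> bool" where
  "Lp_on p U f \<longleftrightarrow> set_borel_measurable lebesgue U f \<and>
      set_integrable lebesgue U (\<lambda>z. cmod (f z) powr p)"

definition sobolev_W1p :: "real \<Rightarrow> complex set \<Rightarrow> (complex \<Rightarrow> complex) \<Rightarrow> bool" where
  "sobolev_W1p p U f \<longleftrightarrow> Lp_on p U f \<and>
     (\<forall>b. \<exists>g. Lp_on p U g \<and>
        (\<forall>\<psi>. test_function U \<psi> \<longrightarrow>
           set_integrable lebesgue U (\<lambda>z. of_real (partial b \<psi> z) * f z) \<and>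
           set_integrable lebesgue U (\<lambda>z. of_real (\<psi> z) * g z) \<and>
           (LINT z:U|lebesgue. of_real (partial b \<psi> z) * f z)
             = - (LINT z:U|lebesgue. of_real (\<psi> z) * g z)))"

end

theory Submission
  imports Defs
begin

text \<open>
  Let \<open>T(z) = |z|\<^sup>\<beta> sgn(z) exp(i |z|\<^sup>-\<^sup>\<gamma>)\<close> be a spiral homeomorphism of the plane, and take
  \<open>Y = T(ball 1 1)\<close> and \<open>\<phi>(\<zeta>) = T(1 - \<zeta>)\<close>. Near its cusp at \<open>0\<close> the domain is a thin spiral channel:
  at distance \<open>r = |1 - \<zeta>|\<close> from the preimage of the tip the channel sits at distance
  \<open>r\<^sup>\<beta>\<close> from the tip, but a path inside the channel still has to travel a length of order
  \<open>r\<close> to the power \<open>\<beta> - \<gamma>\<close>. With \<open>\<gamma> = p\<close> and \<open>\<beta> - \<gamma> = (1 - 2/p)/2\<close>, the map \<open>\<phi>\<close> is Hoelder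
  continuous with an exponent above \<open>1 - 1/p\<close>, so the double integral converges, and \<open>\<beta> > \<gamma>\<close> makes
  the boundary rectifiable. An extension \<open>h\<close> into the closure of \<open>Y\<close> carries a continuous winding
  angle; if \<open>h\<close> were in \<open>W\<^sup>1\<^sup>,\<^sup>p\<close>, then averaging along three-sided paths (horizontal,
  vertical, horizontal) in a square of side \<open>r\<close> at \<open>1\<close>, as in Morrey's inequality, would bound the
  internal length by a multiple of \<open>r\<close> to the power \<open>1 - 2/p\<close>, which is too small as \<open>r\<close> tends to 0.
\<close>

section \<open>Smooth step functions and tensor product test functions\<close>

text \<open>Two demands meet in \<delta> = \<beta> - \<gamma>: the length bound wants \<delta> > 0,
  the nonexistence argument wants \<delta> < 1 - 2/p, and the midpoint is taken; the interval is
  nonempty because p > 2. With \<delta> fixed, faster winding only helps the double integral: the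
  Hoelder exponent is (\<gamma> + \<delta>) / (\<gamma> + 1), and it exceeds 1 - 1/p as soon as
  \<gamma> > p (1 - \<delta>) - 1, which \<gamma> = p satisfies. The obstacle is that
  \<open>h\<close> has derivatives only in the sense of distributions and only inside the open disk,
  while the information about \<open>h\<close> sits on the circle and the quantity to estimate is an
  angle. Absolute continuity on lines, a chain rule and traces are all avoided. Product test
  functions bound the increment of \<open>h\<close> across a rectangle by the integral of the weak
  derivative; cutting into thin pieces then moves the absolute value under the integral, replaces
  \<open>h\<close> by a function that it controls locally, and carries the estimate up to the
  circle.\<close>

definition flat_exp :: "nat \<Rightarrow> real \<Rightarrow> real" where
  "flat_exp k x = (if x > 0 then (1 / x) ^ k * exp (- (1 / x)) else 0)"

lemma flat_exp_tendsto_0: "(flat_exp k \<longlongrightarrow> 0) (at 0)"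
proof -
  have "(((\<lambda>x. x ^ k / exp x) \<circ> inverse) \<longlongrightarrow> (0::real)) (at_right 0)"
    unfolding o_def
    by (rule filterlim_compose[OF tendsto_power_div_exp_0 filterlim_inverse_at_top_right])
  then have r: "(flat_exp k \<longlongrightarrow> 0) (at_right 0)"
    by (rule Lim_transform_eventually)
       (auto simp: eventually_at_right_field flat_exp_def exp_minus field_simps power_inverse
             intro!: exI[of _ 1])
  have l: "(flat_exp k \<longlongrightarrow> 0) (at_left 0)"
    by (rule Lim_transform_eventually[of "\<lambda>_. 0"])
       (auto simp: eventually_at_left_field flat_exp_def intro!: exI[of _ "-1"])
  show ?thesis
    using l r by (simp add: filterlim_at_split)
qed

text \<open>Carrying the power of 1/x as an index makes the family closed under differentiation up
  to linear combinations. At 0 the difference quotient of \<open>flat_exp k\<close> is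
  \<open>flat_exp (Suc k)\<close>, so the limit at the next index settles that point.\<close>

lemma DERIV_flat_exp:
  "(flat_exp k has_real_derivative flat_exp (k + 2) x - real k * flat_exp (Suc k) x) (at x)"
proof -
  consider "x < 0" | "x = 0" | "x > 0" by linarith
  then show ?thesis
  proof cases
    case 1
    have "((\<lambda>_. 0) has_real_derivative 0) (at x)" by simp
    then have "(flat_exp k has_real_derivative 0) (at x)"
      by (rule has_field_derivative_transform_within_open[of _ _ _ "{..<0}"])
         (use 1 in \<open>auto simp: flat_exp_def\<close>)
    then show ?thesis using 1 by (simp add: flat_exp_def)
  next
    case 2
    have "((\<lambda>h. flat_exp (Suc k) h) \<longlongrightarrow> 0) (at 0)" by (rule flat_exp_tendsto_0)
    then have "((\<lambda>h. (flat_exp k (0 + h) - flat_exp k 0) / h) \<longlongrightarrow> 0) (at 0)"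
      by (rule Lim_transform_eventually)
         (auto simp: eventually_at flat_exp_def intro!: exI[of _ 1])
    then have "(flat_exp k has_real_derivative 0) (at 0)" by (simp add: DERIV_def)
    then show ?thesis using 2 by (simp add: flat_exp_def)
  next
    case 3
    have inv: "((\<lambda>x. 1 / x) has_real_derivative - ((1 / x) ^ 2)) (at x)"
      using 3 by (auto intro!: derivative_eq_intros simp: power2_eq_square)
    have "((\<lambda>x. (1 / x) ^ k * exp (- (1 / x))) has_real_derivative
        real k * ((1 / x) ^ (k - 1) * - ((1 / x) ^ 2)) * exp (- (1 / x))
        + exp (- (1 / x)) * (1 / x) ^ 2 * (1 / x) ^ k) (at x)"
      by (rule DERIV_cong[OF DERIV_mult[OF DERIV_power[OF inv] DERIV_fun_exp[OF DERIV_minus[OF inv]]]])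
         (simp add: mult_ac)
    also have "real k * ((1 / x) ^ (k - 1) * - ((1 / x) ^ 2)) * exp (- (1 / x))
        + exp (- (1 / x)) * (1 / x) ^ 2 * (1 / x) ^ k = flat_exp (k + 2) x - real k * flat_exp (Suc k) x"
    proof (cases k)
      case (Suc n)
      define y where "y = 1 / x"
      show ?thesis
        using 3 unfolding flat_exp_def Suc y_def[symmetric]
        by (simp add: power_add power2_eq_square algebra_simps)
    qed (use 3 in \<open>simp add: flat_exp_def power2_eq_square\<close>)
    finally have "((\<lambda>x. (1 / x) ^ k * exp (- (1 / x))) has_real_derivative
        flat_exp (k + 2) x - real k * flat_exp (Suc k) x) (at x)" .
    then show ?thesis
      by (rule has_field_derivative_transform_within_open[of _ _ _ "{0<..}"])
         (use 3 in \<open>auto simp: flat_exp_def\<close>)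
  qed
qed

text \<open>
  A class of functions closed under differentiation by construction, so that all of its members are
  smooth and no Leibniz or chain rule for higher derivatives is needed.
\<close>
inductive_set smooth_fns :: "(real \<Rightarrow> real) set" where
  const: "(\<lambda>_. c) \<in> smooth_fns"
| flat_exp: "(\<lambda>x. flat_exp k (c * x + d)) \<in> smooth_fns"
| add: "f \<in> smooth_fns \<Longrightarrow> g \<in> smooth_fns \<Longrightarrow> (\<lambda>x. f x + g x) \<in> smooth_fns"
| mult: "f \<in> smooth_fns \<Longrightarrow> g \<in> smooth_fns \<Longrightarrow> (\<lambda>x. f x * g x) \<in> smooth_fns"
| inverse: "f \<in> smooth_fns \<Longrightarrow> (\<And>x. f x > 0) \<Longrightarrow> (\<lambda>x. inverse (f x)) \<in> smooth_fns"

lemma smooth_fns_diff: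
  assumes "f \<in> smooth_fns" "g \<in> smooth_fns"
  shows "(\<lambda>x. f x - g x) \<in> smooth_fns"
  using smooth_fns.add[OF assms(1) smooth_fns.mult[OF smooth_fns.const[of "-1"] assms(2)]]
  by simp

lemma smooth_fns_derivative:
  "f \<in> smooth_fns \<Longrightarrow> \<exists>f'\<in>smooth_fns. \<forall>x. (f has_real_derivative f' x) (at x)"
proof (induction rule: smooth_fns.induct)
  case (const c)
  then show ?case by (intro bexI[OF _ smooth_fns.const[of 0]]) simp
next
  case (flat_exp k c d)
  show ?case
  proof (rule bexI[where x="\<lambda>x. (flat_exp (k + 2) (c * x + d) + (- real k) * flat_exp (Suc k) (c * x + d)) * c"])
    show "\<forall>x. ((\<lambda>x. flat_exp k (c * x + d)) has_real_derivative
        (flat_exp (k + 2) (c * x + d) + - real k * flat_exp (Suc k) (c * x + d)) * c) (at x)"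
      by (auto intro!: DERIV_chain2[OF DERIV_flat_exp[THEN DERIV_cong]] derivative_eq_intros)
  qed (intro smooth_fns.intros)
next
  case (add f g)
  then obtain f' g' where d: "f' \<in> smooth_fns" "\<forall>x. (f has_real_derivative f' x) (at x)"
    "g' \<in> smooth_fns" "\<forall>x. (g has_real_derivative g' x) (at x)" by blast
  show ?case
    by (rule bexI[where x="\<lambda>x. f' x + g' x"]) (use d in \<open>auto intro!: derivative_eq_intros smooth_fns.add\<close>)
next
  case (mult f g)
  then obtain f' g' where d: "f' \<in> smooth_fns" "\<forall>x. (f has_real_derivative f' x) (at x)"
    "g' \<in> smooth_fns" "\<forall>x. (g has_real_derivative g' x) (at x)" by blast
  show ?case
    by (rule bexI[where x="\<lambda>x. f' x * g x + f x * g' x"])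
       (use d mult in \<open>auto intro!: derivative_eq_intros smooth_fns.add smooth_fns.mult\<close>)
next
  case (inverse f)
  then obtain f' where d: "f' \<in> smooth_fns" "\<forall>x. (f has_real_derivative f' x) (at x)" by blast
  show ?case
  proof (rule bexI[where x="\<lambda>x. (-1) * (f' x * (inverse (f x) * inverse (f x)))"])
    show "\<forall>x. ((\<lambda>x. inverse (f x)) has_real_derivative
        - 1 * (f' x * (inverse (f x) * inverse (f x)))) (at x)"
    proof
      fix x
      have "f x \<noteq> 0" using inverse(2)[of x] by simp
      then show "((\<lambda>x. inverse (f x)) has_real_derivative
        - 1 * (f' x * (inverse (f x) * inverse (f x)))) (at x)"
        using d by (auto intro!: derivative_eq_intros)
    qed
    show "(\<lambda>x. (-1) * (f' x * (inverse (f x) * inverse (f x)))) \<in> smooth_fns"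
      by (intro smooth_fns.const smooth_fns.mult smooth_fns.inverse d inverse)
  qed
qed

lemma smooth_fns_deriv:
  assumes "f \<in> smooth_fns"
  shows "deriv f \<in> smooth_fns" "(f has_real_derivative deriv f x) (at x)" "continuous_on A f"
proof -
  obtain f' where d: "f' \<in> smooth_fns" "\<And>x. (f has_real_derivative f' x) (at x)"
    using smooth_fns_derivative[OF assms] by blast
  have "deriv f = f'" by (rule ext) (rule DERIV_imp_deriv[OF d(2)])
  then show "deriv f \<in> smooth_fns" "(f has_real_derivative deriv f x) (at x)"
    using d by simp_all
  show "continuous_on A f"
    using d(2) by (meson DERIV_isCont continuous_at_imp_continuous_on)
qed

text \<open>The denominator is positive because \<open>x\<close> and \<open>1 - x\<close> are never
  both nonpositive. Writing \<open>inverse\<close> instead of a division matches the introduction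
  rule of \<open>smooth_fns\<close>.\<close>

definition smooth_step :: "real \<Rightarrow> real" where
  "smooth_step x = flat_exp 0 x * inverse (flat_exp 0 x + flat_exp 0 (1 - x))"

lemma flat_exp_sum_pos: "flat_exp 0 x + flat_exp 0 (1 - x) > 0"
  by (auto simp: flat_exp_def add_pos_pos)

text \<open>\<open>smooth_fns\<close> has no composition rule, so affine arguments are part of its
  base case, and \<open>1 - (c * x + d)\<close> has to be presented as another affine
  function.\<close>

lemma smooth_step_affine: "(\<lambda>x. smooth_step (c * x + d)) \<in> smooth_fns"
proof -
  have "(\<lambda>x. flat_exp 0 (c * x + d) * inverse (flat_exp 0 (c * x + d) + flat_exp 0 ((- c) * x + (1 - d))))
    \<in> smooth_fns"
  proof (intro smooth_fns.intros)
    fix x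
    show "flat_exp 0 (c * x + d) + flat_exp 0 ((- c) * x + (1 - d)) > 0"
      using flat_exp_sum_pos[of "c * x + d"] by (simp add: algebra_simps)
  qed
  then show ?thesis by (simp add: smooth_step_def algebra_simps)
qed

lemma smooth_step_0: "x \<le> 0 \<Longrightarrow> smooth_step x = 0"
  and smooth_step_1: "1 \<le> x \<Longrightarrow> smooth_step x = 1"
  by (auto simp: smooth_step_def flat_exp_def)

lemma flat_exp_mono: "x \<le> y \<Longrightarrow> flat_exp 0 x \<le> flat_exp 0 y"
  by (auto simp: flat_exp_def frac_le)

lemma smooth_step_bounds: "0 \<le> smooth_step x" "smooth_step x \<le> 1"
  using flat_exp_sum_pos[of x] by (auto simp: smooth_step_def flat_exp_def field_simps)

lemma smooth_step_mono:
  assumes "x \<le> y"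
  shows "smooth_step x \<le> smooth_step y"
proof -
  have nn: "flat_exp 0 u \<ge> 0" for u by (simp add: flat_exp_def)
  have "flat_exp 0 x * flat_exp 0 (1 - y) \<le> flat_exp 0 y * flat_exp 0 (1 - x)"
    using assms by (intro mult_mono flat_exp_mono nn) auto
  then show ?thesis
    using flat_exp_sum_pos[of x] flat_exp_sum_pos[of y]
    by (simp add: smooth_step_def flip: divide_inverse) (simp add: frac_le_eq field_simps)
qed

lemma pdir_Re_Im:
  "Re (z + of_real t * pdir b) = (if b then Re z else Re z + t)"
  "Im (z + of_real t * pdir b) = (if b then Im z + t else Im z)"
  by (auto simp: pdir_def)

lemma tensor_has_partial:
  assumes "a \<in> smooth_fns" "b \<in> smooth_fns"
  shows "((\<lambda>t. a (Re (z + of_real t * pdir c)) * b (Im (z + of_real t * pdir c)))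
    has_real_derivative
    (if c then a (Re z) * deriv b (Im z) else deriv a (Re z) * b (Im z))) (at 0)"
proof -
  have "((\<lambda>t. a (Re z + t)) has_real_derivative deriv a (Re z)) (at 0)"
       "((\<lambda>t. b (Im z + t)) has_real_derivative deriv b (Im z)) (at 0)"
    using DERIV_shift[of a "deriv a (Re z)" 0 "Re z"] DERIV_shift[of b "deriv b (Im z)" 0 "Im z"]
      smooth_fns_deriv(2)[OF assms(1), of "Re z"] smooth_fns_deriv(2)[OF assms(2), of "Im z"]
    by (simp_all add: add.commute)
  then show ?thesis
    unfolding pdir_Re_Im by (cases c) (auto intro: DERIV_cmult DERIV_cmult_right)
qed

lemma partial_tensor:
  assumes "a \<in> smooth_fns" "b \<in> smooth_fns"
  shows "partial c (\<lambda>z. a (Re z) * b (Im z)) =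
    (\<lambda>z. (if c then a else deriv a) (Re z) * (if c then deriv b else b) (Im z))"
  unfolding partial_def
  by (rule ext, rule DERIV_imp_deriv, rule DERIV_cong[OF tensor_has_partial[OF assms]]) simp

text \<open>Each partial derivative acts on one factor and leaves a product of members of the class.
  The derivatives of all orders in \<open>smooth_plane\<close> thus reduce to functions of one
  variable.\<close>

lemma iter_partial_tensor:
  assumes "a \<in> smooth_fns" "b \<in> smooth_fns"
  shows "\<exists>a'\<in>smooth_fns. \<exists>b'\<in>smooth_fns.
    iter_partial cs (\<lambda>z. a (Re z) * b (Im z)) = (\<lambda>z. a' (Re z) * b' (Im z))"
proof (induction cs)
  case Nil
  then show ?case using assms by auto
next
  case (Cons c cs)
  then obtain a' b' where ab: "a' \<in> smooth_fns" "b' \<in> smooth_fns"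
    "iter_partial cs (\<lambda>z. a (Re z) * b (Im z)) = (\<lambda>z. a' (Re z) * b' (Im z))" by blast
  show ?case
    by (rule bexI[where x="if c then a' else deriv a'"], rule bexI[where x="if c then deriv b' else b'"])
       (use ab smooth_fns_deriv(1) in \<open>auto simp: partial_tensor\<close>)
qed

lemma smooth_plane_tensor:
  assumes "a \<in> smooth_fns" "b \<in> smooth_fns"
  shows "smooth_plane (\<lambda>z. a (Re z) * b (Im z))"
  unfolding smooth_plane_def
proof (intro allI conjI)
  fix cs
  obtain a' b' where ab: "a' \<in> smooth_fns" "b' \<in> smooth_fns"
    "iter_partial cs (\<lambda>z. a (Re z) * b (Im z)) = (\<lambda>z. a' (Re z) * b' (Im z))"
    using iter_partial_tensor[OF assms] by blast
  show "continuous_on UNIV (iter_partial cs (\<lambda>z. a (Re z) * b (Im z)))"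
    unfolding ab(3)
    by (intro continuous_intros continuous_on_compose2[OF smooth_fns_deriv(3)[OF ab(1)]]
        continuous_on_compose2[OF smooth_fns_deriv(3)[OF ab(2)]]) auto
  show "(\<lambda>t. iter_partial cs (\<lambda>z. a (Re z) * b (Im z)) (z + of_real t * pdir c)) differentiable at 0"
    for c z
    unfolding ab(3)
    using tensor_has_partial[OF ab(1,2), of z c] real_differentiable_def by blast
qed

section \<open>Weak derivatives on rectangles\<close>

text \<open>
  Coordinates with the axis in direction \<open>b\<close> listed first (as in \<^const>\<open>pdir\<close>), so that both partial
  derivatives are treated at once.
\<close>
definition of_coords :: "bool \<Rightarrow> real \<Rightarrow> real \<Rightarrow> complex" where
  "of_coords b x y = (if b then Complex y x else Complex x y)"

definition coord :: "bool \<Rightarrow> complex \<Rightarrow> real" where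
  "coord b z = (if b then Im z else Re z)"

definition coord_rect :: "bool \<Rightarrow> real \<Rightarrow> real \<Rightarrow> real \<Rightarrow> real \<Rightarrow> complex set" where
  "coord_rect b x1 x2 y1 y2 = {z. coord b z \<in> {x1..x2} \<and> coord (\<not> b) z \<in> {y1..y2}}"

text \<open>Half-open in both directions, so that adjacent cells are disjoint and the masses of a
  subdivision add up exactly.\<close>

definition coord_hrect :: "bool \<Rightarrow> real \<Rightarrow> real \<Rightarrow> real \<Rightarrow> real \<Rightarrow> complex set" where
  "coord_hrect b x1 x2 y1 y2 = {z. coord b z \<in> {x1<..x2} \<and> coord (\<not> b) z \<in> {y1<..y2}}"

lemma coord_of_coords [simp]: "coord b (of_coords b x y) = x" "coord (\<not> b) (of_coords b x y) = y"
  by (auto simp: coord_def of_coords_def)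

lemma of_coords_coord [simp]: "of_coords b (coord b z) (coord (\<not> b) z) = z"
  by (auto simp: coord_def of_coords_def)

lemma continuous_on_coord [continuous_intros]:
  "continuous_on A f \<Longrightarrow> continuous_on A (\<lambda>x. coord b (f x))"
  by (cases b) (auto simp: coord_def intro!: continuous_intros)

lemma continuous_on_of_coords [continuous_intros]:
  "continuous_on A f \<Longrightarrow> continuous_on A g \<Longrightarrow> continuous_on A (\<lambda>x. of_coords b (f x) (g x))"
  by (cases b) (auto simp: of_coords_def intro!: continuous_intros)

lemma borel_measurable_coord [measurable]: "coord b \<in> borel_measurable borel"
  by (intro borel_measurable_continuous_onI continuous_intros)

lemma dist_of_coords: "dist (of_coords b x y) (of_coords b x' y) = \<bar>x - x'\<bar>" "dist (of_coords b x y) (of_coords b x y') = \<bar>y - y'\<bar>"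
  by (auto simp: of_coords_def dist_norm cmod_def)

lemma coord_hrect_measurable [measurable]: "coord_hrect b x1 x2 y1 y2 \<in> sets borel"
  unfolding coord_hrect_def by measurable

lemma coord_rect_image: "coord_rect b x1 x2 y1 y2 = (\<lambda>(y, x). of_coords b x y) ` cbox (y1, x1) (y2, x2)"
  by (force simp: coord_rect_def image_iff cbox_Pair_eq intro!: exI[of _ "coord b _"])

lemma compact_coord_rect: "compact (coord_rect b x1 x2 y1 y2)"
  unfolding coord_rect_image case_prod_unfold
  by (intro compact_continuous_image compact_cbox continuous_intros)

lemma coord_hrect_subset: "coord_hrect b x1 x2 y1 y2 \<subseteq> coord_rect b x1 x2 y1 y2"
  by (auto simp: coord_rect_def coord_hrect_def)

text \<open>Lebesgue measure is determined by its values on boxes, and the preimage of a box is a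
  box, with sides exchanged for one value of \<open>b\<close>. The pair lists the transversal
  coordinate first, so that the inner integral of a Fubini argument runs in direction
  \<open>b\<close>.\<close>

lemma lborel_of_coords: "distr lborel lborel (\<lambda>(y, x). of_coords b x y) = (lborel :: complex measure)"
proof (rule lborel_eqI[symmetric])
  fix l u :: complex
  assume lu: "\<And>b. b \<in> Basis \<Longrightarrow> l \<bullet> b \<le> u \<bullet> b"
  have m: "(\<lambda>(y, x). of_coords b x y) \<in> borel_measurable borel"
    unfolding case_prod_unfold by (intro borel_measurable_continuous_onI continuous_intros)
  have "(\<lambda>(y, x). of_coords b x y) -` box l u =
      box (coord (\<not> b) l, coord b l) (coord (\<not> b) u, coord b u)"
    by (cases b) (auto simp: box_def of_coords_def coord_def Basis_complex_def Basis_prod_def)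
  then have "emeasure (distr lborel lborel (\<lambda>(y, x). of_coords b x y)) (box l u) =
      emeasure lborel (box (coord (\<not> b) l, coord b l) (coord (\<not> b) u, coord b u))"
    using m by (subst emeasure_distr) auto
  also have "\<dots> = ennreal (prod ((\<bullet>) (u - l)) Basis)"
    using lu[of 1] lu[of \<i>]
    by (cases b) (auto simp: emeasure_lborel_box_eq coord_def Basis_complex_def Basis_prod_def
        inner_diff_left algebra_simps prod.union_disjoint)
  finally show "emeasure (distr lborel lborel (\<lambda>(y, x). of_coords b x y)) (box l u) =
    ennreal (prod ((\<bullet>) (u - l)) Basis)" .
qed simp

text \<open>\<open>F\<close> may jump across the edge of the rectangle; continuity on the compact
  rectangle gives Borel measurability as well as Fubini for continuous functions.\<close>

lemma integral_iterated:
  fixes F :: "complex \<Rightarrow> complex"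
  assumes cont: "continuous_on (coord_rect b x1 x2 y1 y2) F"
    and supp: "\<And>z. z \<notin> coord_rect b x1 x2 y1 y2 \<Longrightarrow> F z = 0"
  shows "(LINT z|lebesgue. F z) =
    integral {y1..y2} (\<lambda>y. integral {x1..x2} (\<lambda>x. F (of_coords b x y)))"
proof -
  let ?P = "\<lambda>(y, x). of_coords b x y"
  have ind: "F = (\<lambda>z. indicator (coord_rect b x1 x2 y1 y2) z *\<^sub>R F z)"
    using supp by (auto simp: indicator_def)
  have F [measurable]: "F \<in> borel_measurable borel"
    by (subst ind, rule borel_measurable_continuous_on_indicator[OF _ cont])
       (simp add: borel_compact compact_coord_rect)
  have P: "?P \<in> borel_measurable borel"
    unfolding case_prod_unfold by (intro borel_measurable_continuous_onI continuous_intros)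
  have c: "continuous_on (cbox (y1, x1) (y2, x2)) (\<lambda>q. F (?P q))"
    by (rule continuous_on_compose2[OF cont])
       (auto simp: coord_rect_image case_prod_unfold intro!: continuous_intros)
  have "(LINT z|lebesgue. F z) = (LINT z|lborel. F z)"
    by (rule integral_completion) simp
  also have "\<dots> = (LINT q|lborel. F (?P q))"
    by (subst lborel_of_coords[of b, symmetric], rule integral_distr) (use P in simp_all)
  also have "\<dots> = (LINT q:cbox (y1, x1) (y2, x2)|lborel. F (?P q))"
    unfolding set_lebesgue_integral_def
    by (rule Bochner_Integration.integral_cong)
       (auto simp: indicator_def coord_rect_def cbox_Pair_eq intro!: supp)
  also have "\<dots> = integral (cbox (y1, x1) (y2, x2)) (\<lambda>q. F (?P q))"
    by (intro set_borel_integral_eq_integral(2))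
       (auto simp: set_integrable_def intro!: borel_integrable_compact c)
  also have "\<dots> = integral {y1..y2} (\<lambda>y. integral {x1..x2} (\<lambda>x. F (of_coords b x y)))"
    by (subst integral_prod_continuous[OF c]) (simp add: cbox_interval)
  finally show ?thesis .
qed

lemma deriv_smooth_step_affine_nonneg:
  assumes "0 \<le> c"
  shows "0 \<le> deriv (\<lambda>x. smooth_step (c * x + d)) x"
proof -
  have "mono_on UNIV (\<lambda>x. smooth_step (c * x + d))"
    using assms by (intro mono_onI smooth_step_mono) (simp add: mult_left_mono)
  then show ?thesis
    by (rule mono_on_imp_deriv_nonneg[OF _ smooth_fns_deriv(2)[OF smooth_step_affine]]) simp
qed

lemma deriv_smooth_step_affine_0:
  assumes "c * x + d < 0 \<or> 1 < c * x + d"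
  shows "deriv (\<lambda>x. smooth_step (c * x + d)) x = 0"
proof -
  have *: "((\<lambda>_. smooth_step (c * x + d)) has_real_derivative 0) (at x)" by simp
  have "((\<lambda>x. smooth_step (c * x + d)) has_real_derivative 0) (at x)"
  proof (cases "c * x + d < 0")
    case True
    show ?thesis
      by (rule has_field_derivative_transform_within_open[OF *, of "{x. c * x + d < 0}"])
         (use True in \<open>auto simp: smooth_step_0 intro!: open_Collect_less continuous_intros\<close>)
  next
    case False
    show ?thesis
      by (rule has_field_derivative_transform_within_open[OF *, of "{x. 1 < c * x + d}"])
         (use assms False in \<open>auto simp: smooth_step_1 intro!: open_Collect_less continuous_intros\<close>)
  qed
  then show ?thesis by (rule DERIV_imp_deriv)
qed

text \<open>The derivative of the step is a nonnegative density of total mass 1 living where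
  \<open>0 \<le> c * x + d \<le> 1\<close>, so the integral is an average of values of \<phi> that
  are all within \<open>e\<close> of \<xi>.\<close>

lemma integral_deriv_step:
  fixes \<phi> :: "real \<Rightarrow> complex"
  assumes cd: "0 \<le> c" "c * x1 + d \<le> 0" "1 \<le> c * x2 + d" and le: "x1 \<le> x2"
    and cont: "continuous_on {x1..x2} \<phi>"
    and close: "\<And>x. x \<in> {x1..x2} \<Longrightarrow> 0 \<le> c * x + d \<Longrightarrow> c * x + d \<le> 1 \<Longrightarrow> cmod (\<phi> x - \<xi>) \<le> e"
  defines "\<sigma> \<equiv> \<lambda>x. smooth_step (c * x + d)"
  shows "cmod (integral {x1..x2} (\<lambda>x. of_real (deriv \<sigma> x) * \<phi> x) - \<xi>) \<le> e"
proof -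
  have \<sigma>: "\<sigma> \<in> smooth_fns" unfolding \<sigma>_def by (rule smooth_step_affine)
  note d = smooth_fns_deriv[OF \<sigma>]
  have c\<sigma>: "continuous_on {x1..x2} (deriv \<sigma>)" by (rule smooth_fns_deriv(3)[OF d(1)])
  have "(deriv \<sigma> has_integral (\<sigma> x2 - \<sigma> x1)) {x1..x2}"
    using le d(2) by (intro fundamental_theorem_of_calculus)
      (auto simp flip: has_real_derivative_iff_has_vector_derivative intro: has_field_derivative_at_within)
  moreover have "\<sigma> x2 - \<sigma> x1 = 1"
    using cd by (simp add: \<sigma>_def smooth_step_0 smooth_step_1)
  ultimately have mass: "(deriv \<sigma> has_integral 1) {x1..x2}" by simp
  have mass': "((\<lambda>x. of_real (deriv \<sigma> x) * \<xi>) has_integral \<xi>) {x1..x2}"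
    using has_integral_mult_left[OF has_integral_of_real[OF mass], of \<xi>] by simp
  have i1: "(\<lambda>x. of_real (deriv \<sigma> x) * \<phi> x) integrable_on {x1..x2}"
    by (intro integrable_continuous_real continuous_intros cont c\<sigma>)
  have i2: "(\<lambda>x. of_real (deriv \<sigma> x) * (\<phi> x - \<xi>)) integrable_on {x1..x2}"
    by (intro integrable_continuous_real continuous_intros cont c\<sigma>)
  have "integral {x1..x2} (\<lambda>x. of_real (deriv \<sigma> x) * \<phi> x) - \<xi>
      = integral {x1..x2} (\<lambda>x. of_real (deriv \<sigma> x) * (\<phi> x - \<xi>))"
    using integral_diff[OF i1 has_integral_integrable[OF mass']] integral_unique[OF mass']
    by (simp add: right_diff_distrib)
  also have "cmod \<dots> \<le> integral {x1..x2} (\<lambda>x. deriv \<sigma> x * e)"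
  proof (rule integral_norm_bound_integral[OF i2])
    show "(\<lambda>x. deriv \<sigma> x * e) integrable_on {x1..x2}"
      using mass by (intro integrable_on_mult_left) auto
    show "cmod (of_real (deriv \<sigma> x) * (\<phi> x - \<xi>)) \<le> deriv \<sigma> x * e" if "x \<in> {x1..x2}" for x
    proof (cases "c * x + d < 0 \<or> 1 < c * x + d")
      case True
      then show ?thesis unfolding \<sigma>_def by (subst (1 2) deriv_smooth_step_affine_0) auto
    next
      case False
      then show ?thesis
        using close[OF that] deriv_smooth_step_affine_nonneg[OF cd(1), of d x]
        by (auto simp: norm_mult \<sigma>_def intro!: mult_left_mono)
    qed
  qed
  also have "\<dots> = e"
    using integral_unique[OF has_integral_mult_left[OF mass, of e]] by simp
  finally show ?thesis .
qed

text \<open>The integration by parts identity of \<open>sobolev_W1p\<close> alone; integrability of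
  \<open>g\<close> on the whole domain travels as a separate hypothesis, obtained from
  \<open>Lp_on\<close> on a set of finite measure.\<close>

definition weak_partial :: "bool \<Rightarrow> complex set \<Rightarrow> (complex \<Rightarrow> complex) \<Rightarrow> (complex \<Rightarrow> complex) \<Rightarrow> bool" where
  "weak_partial b U f g \<longleftrightarrow> (\<forall>\<psi>. test_function U \<psi> \<longrightarrow>
      (LINT z:U|lebesgue. of_real (partial b \<psi> z) * f z) = - (LINT z:U|lebesgue. of_real (\<psi> z) * g z))"

lemma test_function_tensor:
  assumes "A \<in> smooth_fns" "B \<in> smooth_fns" "coord_rect b x1 x2 y1 y2 \<subseteq> U"
    and "\<And>x. x \<notin> {x1..x2} \<Longrightarrow> A x = 0" "\<And>y. y \<notin> {y1..y2} \<Longrightarrow> B y = 0"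
  shows "test_function U (\<lambda>z. A (coord b z) * B (coord (\<not> b) z))"
    and "partial b (\<lambda>z. A (coord b z) * B (coord (\<not> b) z)) = (\<lambda>z. deriv A (coord b z) * B (coord (\<not> b) z))"
proof -
  have "smooth_plane (\<lambda>z. A (coord b z) * B (coord (\<not> b) z))"
    using smooth_plane_tensor[OF assms(1,2)] smooth_plane_tensor[OF assms(2,1)]
    by (cases b) (auto simp: coord_def mult.commute)
  moreover have "closure {z. A (coord b z) * B (coord (\<not> b) z) \<noteq> 0} \<subseteq> coord_rect b x1 x2 y1 y2"
    using assms(4,5) compact_imp_closed[OF compact_coord_rect]
    by (intro closure_minimal) (auto simp: coord_rect_def)
  ultimately show "test_function U (\<lambda>z. A (coord b z) * B (coord (\<not> b) z))"
    unfolding test_function_def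
    using assms(3) compact_coord_rect[of b x1 x2 y1 y2]
    by (meson bounded_subset closed_closure compact_eq_bounded_closed order_trans)
  show "partial b (\<lambda>z. A (coord b z) * B (coord (\<not> b) z)) = (\<lambda>z. deriv A (coord b z) * B (coord (\<not> b) z))"
    using partial_tensor[OF assms(1,2), of b] partial_tensor[OF assms(2,1), of b]
    by (cases b) (auto simp: coord_def mult.commute)
qed


text \<open>
  Test against \<open>A\<^sub>n(x) B\<^sub>n(y)\<close>, where \<open>A\<^sub>n\<close> and \<open>B\<^sub>n\<close> are smooth plateaus rising and falling within
  \<open>1/n\<close> of the ends of their intervals.
\<close>
lemma weak_partial_cell:
  assumes f: "continuous_on U f" and g: "set_integrable lebesgue U g" and U: "open U"
    and wp: "weak_partial b U f g"
    and sub: "coord_rect b x1 x2 y1 y2 \<subseteq> U" and x: "x1 < x2" and y: "y1 < y2"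
  shows "cmod (integral {y1..y2} (\<lambda>y. f (of_coords b x2 y) - f (of_coords b x1 y)))
    \<le> (LINT z:coord_hrect b x1 x2 y1 y2|lebesgue. cmod (g z))"
proof -
  let ?R = "coord_rect b x1 x2 y1 y2" and ?H = "coord_hrect b x1 x2 y1 y2"
  define G where "G = (LINT z:?H|lebesgue. cmod (g z))"
  define L where "L n x = smooth_step (real n * x + (- real n * x1))" for n x
  define R where "R n x = smooth_step (real n * x + (1 - real n * x2))" for n x
  define L' where "L' n y = smooth_step (real n * y + (- real n * y1))" for n y
  define R' where "R' n y = smooth_step (real n * y + (1 - real n * y2))" for n y
  define A where "A n x = L n x - R n x" for n x
  define B where "B n y = L' n y - R' n y" for n y
  \<comment> \<open>The sign is opposite to the one in the claim: the derivative of the plateau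
    \<open>A n\<close> has mass 1 near \<open>x1\<close> and mass -1 near \<open>x2\<close>.\<close>
  define W where "W y = f (of_coords b x1 y) - f (of_coords b x2 y)" for y
  have LR: "L n \<in> smooth_fns" "R n \<in> smooth_fns" "L' n \<in> smooth_fns" "R' n \<in> smooth_fns" for n
    unfolding L_def R_def L'_def R'_def by (rule smooth_step_affine)+
  have AB: "A n \<in> smooth_fns" "B n \<in> smooth_fns" for n
    unfolding A_def B_def by (intro smooth_fns_diff LR)+
  have dA: "deriv (A n) x = deriv (L n) x - deriv (R n) x" for n x
    unfolding A_def
    by (intro DERIV_imp_deriv DERIV_diff smooth_fns_deriv(2) LR)
  have fR: "continuous_on ?R f" using f sub continuous_on_subset by blast
  have ptR: "of_coords b x y \<in> ?R" if "x \<in> {x1..x2}" "y \<in> {y1..y2}" for x y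
    using that by (auto simp: coord_rect_def)
  have fx: "continuous_on {x1..x2} (\<lambda>x. f (of_coords b x y))" if "y \<in> {y1..y2}" for y
    by (rule continuous_on_compose2[OF fR]) (auto intro!: continuous_intros ptR that)
  have fy: "continuous_on {y1..y2} (\<lambda>y. f (of_coords b x y))" if "x \<in> {x1..x2}" for x
    by (rule continuous_on_compose2[OF fR]) (auto intro!: continuous_intros ptR that)
  have Wc: "continuous_on {y1..y2} W"
    unfolding W_def using x by (intro continuous_intros fy) auto
  \<comment> \<open>\<open>R n\<close> is \<open>L n\<close> translated to the right by
    \<open>x2 - x1 - 1/n\<close>; it lies below \<open>L n\<close> once this shift is
    nonnegative.\<close>
  have A01: "0 \<le> A n x \<and> A n x \<le> 1" if "1 \<le> real n * (x2 - x1)" for n x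
  proof -
    have "R n x \<le> L n x"
      unfolding R_def L_def using that by (intro smooth_step_mono) (simp add: algebra_simps)
    moreover have "0 \<le> R n x" "L n x \<le> 1"
      by (simp_all add: R_def L_def smooth_step_bounds)
    ultimately show ?thesis by (auto simp: A_def)
  qed
  have B01: "0 \<le> B n x \<and> B n x \<le> 1" if "1 \<le> real n * (y2 - y1)" for n x
  proof -
    have "R' n x \<le> L' n x"
      unfolding R'_def L'_def using that by (intro smooth_step_mono) (simp add: algebra_simps)
    moreover have "0 \<le> R' n x" "L' n x \<le> 1"
      by (simp_all add: R'_def L'_def smooth_step_bounds)
    ultimately show ?thesis by (auto simp: B_def)
  qed
  have A0: "A n x = 0" if "1 \<le> real n * (x2 - x1)" "x \<notin> {x1<..<x2}" for n x
  proof (cases "x \<le> x1")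
    case True
    have "real n * x \<le> real n * x1" using True by (simp add: mult_left_mono)
    then show ?thesis using that by (simp add: A_def L_def R_def smooth_step_0 algebra_simps)
  next
    case False
    then have "x2 \<le> x" using that by auto
    then have "real n * x2 \<le> real n * x" by (simp add: mult_left_mono)
    then show ?thesis using that by (simp add: A_def L_def R_def smooth_step_1 algebra_simps)
  qed
  have B0: "B n x = 0" if "1 \<le> real n * (y2 - y1)" "x \<notin> {y1<..<y2}" for n x
  proof (cases "x \<le> y1")
    case True
    have "real n * x \<le> real n * y1" using True by (simp add: mult_left_mono)
    then show ?thesis using that by (simp add: B_def L'_def R'_def smooth_step_0 algebra_simps)
  next
    case False
    then have "y2 \<le> x" using that by auto
    then have "real n * y2 \<le> real n * x" by (simp add: mult_left_mono)
    then show ?thesis using that by (simp add: B_def L'_def R'_def smooth_step_1 algebra_simps)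
  qed
  define inner where "inner n y = integral {x1..x2} (\<lambda>x. of_real (deriv (A n) x) * f (of_coords b x y))" for n y
  have ev: "eventually (\<lambda>n. 1 \<le> real n * d) sequentially" if "0 < d" for d
  proof -
    obtain N :: nat where N: "1 / d \<le> real N" using real_arch_simple by blast
    show ?thesis
    proof (rule eventually_sequentiallyI)
      fix n assume "N \<le> n"
      then have "1 / d \<le> real n" using N by simp
      then show "1 \<le> real n * d" using that by (simp add: field_simps)
    qed
  qed
  have big: "eventually (\<lambda>n. 1 \<le> real n * (x2 - x1) \<and> 1 \<le> real n * (y2 - y1)) sequentially"
    using ev[of "x2 - x1"] ev[of "y2 - y1"] x y by (auto intro: eventually_conj)
  \<comment> \<open>The rising and the falling ramp of \<open>A n\<close> each cost an error
    \<open>e\<close> in comparing \<open>inner n y\<close> with \<open>W y\<close>; hence the factor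
    2.\<close>
  have est: "eventually (\<lambda>n. cmod (integral {y1..y2} (\<lambda>y. of_real (B n y) * W y)) \<le> G + 2 * e * (y2 - y1))
    sequentially" if e: "0 < e" for e
  proof -
    have "uniformly_continuous_on ?R f"
      by (rule compact_uniformly_continuous[OF fR compact_coord_rect])
    then obtain d where d: "0 < d" "\<And>z z'. z \<in> ?R \<Longrightarrow> z' \<in> ?R \<Longrightarrow> dist z' z < d \<Longrightarrow> dist (f z') (f z) < e"
      using e unfolding uniformly_continuous_on_def by metis
    \<comment> \<open>The ramps have width 1/n; asking for \<open>1/n \<le> d / 2\<close> gives the
      strict inequality that uniform continuity expects.\<close>
    have "eventually (\<lambda>n. 1 \<le> real n * (d / 2)) sequentially" using ev[of "d / 2"] d(1) by (simp only: half_gt_zero)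
    with big show ?thesis
    proof eventually_elim
      case (elim n)
      then have n: "1 \<le> real n * (x2 - x1)" "1 \<le> real n * (y2 - y1)" "1 \<le> real n * (d / 2)" by auto
      have n0: "0 < real n" using n(3) d(1) by (cases n) auto
      have near: "cmod (inner n y - W y) \<le> 2 * e" if yy: "y \<in> {y1..y2}" for y
      proof -
        have 1: "cmod (integral {x1..x2} (\<lambda>x. of_real (deriv (L n) x) * f (of_coords b x y)) - f (of_coords b x1 y)) \<le> e"
          unfolding L_def
        proof (rule integral_deriv_step)
          show "1 \<le> real n * x2 + - real n * x1" using n(1) by (simp add: algebra_simps)
          fix x assume xx: "x \<in> {x1..x2}" "real n * x + - real n * x1 \<le> 1"
          then have "real n * (x - x1) < real n * d" using n(3) n0 d(1) by (simp add: algebra_simps)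
          then have "x - x1 < d" using n0 by simp
          then show "cmod (f (of_coords b x y) - f (of_coords b x1 y)) \<le> e"
            using d(2)[of "of_coords b x1 y" "of_coords b x y"] ptR xx yy x
            by (force simp: dist_of_coords simp flip: dist_norm)
        qed (use x fx yy in auto)
        have 2: "cmod (integral {x1..x2} (\<lambda>x. of_real (deriv (R n) x) * f (of_coords b x y)) - f (of_coords b x2 y)) \<le> e"
          unfolding R_def
        proof (rule integral_deriv_step)
          show "real n * x1 + (1 - real n * x2) \<le> 0" using n(1) by (simp add: algebra_simps)
          fix x assume xx: "x \<in> {x1..x2}" "0 \<le> real n * x + (1 - real n * x2)"
          then have "real n * (x2 - x) < real n * d" using n(3) n0 d(1) by (simp add: algebra_simps)
          then have "x2 - x < d" using n0 by simp
          then show "cmod (f (of_coords b x y) - f (of_coords b x2 y)) \<le> e"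
            using d(2)[of "of_coords b x2 y" "of_coords b x y"] ptR xx yy x
            by (force simp: dist_of_coords simp flip: dist_norm)
        qed (use x fx yy in auto)
        have "inner n y = integral {x1..x2} (\<lambda>x. of_real (deriv (L n) x) * f (of_coords b x y))
           - integral {x1..x2} (\<lambda>x. of_real (deriv (R n) x) * f (of_coords b x y))"
          unfolding inner_def dA of_real_diff left_diff_distrib
          by (intro integral_diff integrable_continuous_real continuous_intros fx yy
              smooth_fns_deriv(3) smooth_fns_deriv(1) LR)
        then have "inner n y - W y = (integral {x1..x2} (\<lambda>x. of_real (deriv (L n) x) * f (of_coords b x y)) - f (of_coords b x1 y))
          - (integral {x1..x2} (\<lambda>x. of_real (deriv (R n) x) * f (of_coords b x y)) - f (of_coords b x2 y))"
          by (simp add: W_def)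
        then show ?thesis using norm_triangle_ineq4 1 2 by (smt (verit))
      qed
      define \<psi> where "\<psi> = (\<lambda>z. A n (coord b z) * B n (coord (\<not> b) z))"
      have t: "test_function U \<psi>" "partial b \<psi> = (\<lambda>z. deriv (A n) (coord b z) * B n (coord (\<not> b) z))"
        unfolding \<psi>_def using A0[OF n(1)] B0[OF n(2)]
        by (auto intro!: test_function_tensor[OF AB sub])
      have dA0: "deriv (A n) x = 0" if "x \<notin> {x1..x2}" for x
      proof -
        have o: "open ({..<x1} \<union> {x2<..})" "x \<in> {..<x1} \<union> {x2<..}" using that by auto
        have "(A n has_real_derivative 0) (at x)"
          by (rule has_field_derivative_transform_within_open[OF DERIV_const o, of 0])
             (use A0[OF n(1)] in auto)
        then show ?thesis by (rule DERIV_imp_deriv)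
      qed
      have inner_cont: "continuous_on {y1..y2} (inner n)"
      proof -
        have "continuous_on (cbox y1 y2) (\<lambda>y. integral (cbox x1 x2) (\<lambda>x. of_real (deriv (A n) x) * f (of_coords b x y)))"
          by (rule integral_continuous_on_param)
             (auto simp: case_prod_unfold intro!: continuous_intros continuous_on_compose2[OF fR] ptR
                continuous_on_compose2[OF smooth_fns_deriv(3)[OF smooth_fns_deriv(1)[OF AB(1)], where A=UNIV]])
        then show ?thesis by (simp add: inner_def[abs_def])
      qed
      have "(LINT z:U|lebesgue. of_real (partial b \<psi> z) * f z)
        = (LINT z|lebesgue. indicator U z *\<^sub>R (of_real (deriv (A n) (coord b z) * B n (coord (\<not> b) z)) * f z))"
        by (simp add: t(2) set_lebesgue_integral_def)
      also have "\<dots> = integral {y1..y2} (\<lambda>y. integral {x1..x2} (\<lambda>x. of_real (B n y) * (of_real (deriv (A n) x) * f (of_coords b x y))))"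
        (is "?lhs = _")
      proof -
        have "?lhs = integral {y1..y2} (\<lambda>y. integral {x1..x2} (\<lambda>x. 
          indicator U (of_coords b x y) *\<^sub>R (of_real (deriv (A n) (coord b (of_coords b x y)) * B n (coord (\<not> b) (of_coords b x y))) * f (of_coords b x y))))"
        proof (rule integral_iterated)
          have "continuous_on ?R (\<lambda>z. of_real (deriv (A n) (coord b z) * B n (coord (\<not> b) z)) * f z)"
            by (intro continuous_intros fR continuous_on_compose2[OF smooth_fns_deriv(3)[OF AB(2), where A=UNIV]]
                continuous_on_compose2[OF smooth_fns_deriv(3)[OF smooth_fns_deriv(1)[OF AB(1)], where A=UNIV]]) auto
          then show "continuous_on ?R (\<lambda>z. indicator U z *\<^sub>R (of_real (deriv (A n) (coord b z) * B n (coord (\<not> b) z)) * f z))"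
            by (rule continuous_on_eq) (use sub in auto)
          fix z assume "z \<notin> ?R"
          then have "deriv (A n) (coord b z) * B n (coord (\<not> b) z) = 0"
            using dA0 B0[OF n(2)] by (auto simp: coord_rect_def)
          then show "indicator U z *\<^sub>R (of_real (deriv (A n) (coord b z) * B n (coord (\<not> b) z)) * f z) = 0" by simp
        qed
        also have "\<dots> = integral {y1..y2} (\<lambda>y. integral {x1..x2} (\<lambda>x. of_real (B n y) * (of_real (deriv (A n) x) * f (of_coords b x y))))"
          by (intro integral_cong) (auto simp: mult_ac subsetD[OF sub ptR])
        finally show ?thesis .
      qed
      also have "\<dots> = integral {y1..y2} (\<lambda>y. of_real (B n y) * inner n y)"
        by (simp add: inner_def)
      finally have lhs: "(LINT z:U|lebesgue. of_real (partial b \<psi> z) * f z)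
        = integral {y1..y2} (\<lambda>y. of_real (B n y) * inner n y)" .
      have "cmod (LINT z:U|lebesgue. of_real (\<psi> z) * g z) \<le> G"
      proof -
        have HU: "?H \<subseteq> U" using coord_hrect_subset sub by blast
        have "set_integrable lebesgue ?H g"
          by (rule set_integrable_subset[OF g _ HU]) simp
        then have int: "integrable lebesgue (\<lambda>z. indicator ?H z *\<^sub>R cmod (g z))"
          unfolding set_integrable_def using integrable_norm by fastforce
        have "cmod (LINT z:U|lebesgue. of_real (\<psi> z) * g z) \<le> (LINT z|lebesgue. indicator ?H z *\<^sub>R cmod (g z))"
          unfolding set_lebesgue_integral_def
        proof (rule order_trans[OF integral_norm_bound integral_mono'[OF int]])
          fix z
          \<comment> \<open>The points where \<psi> is nonzero lie in the open rectangle, hence in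
            the half-open cell, and there \<open>\<bar>\<psi>\<bar> \<le> 1\<close>.\<close>
          show "cmod (indicator U z *\<^sub>R (of_real (\<psi> z) * g z)) \<le> indicator ?H z *\<^sub>R cmod (g z)"
          proof (cases "z \<in> ?H")
            case True
            have "\<bar>\<psi> z\<bar> \<le> 1"
              using A01[OF n(1), of "coord b z"] B01[OF n(2), of "coord (\<not> b) z"]
              by (auto simp: \<psi>_def abs_mult intro!: mult_le_one)
            then show ?thesis using True HU
              by (auto simp: norm_mult indicator_def intro!: mult_left_le_one_le)
          next
            case False
            then have "\<psi> z = 0" using A0[OF n(1)] B0[OF n(2)] by (auto simp: \<psi>_def coord_hrect_def)
            then show ?thesis by simp
          qed
        qed simp
        then show ?thesis by (simp add: G_def set_lebesgue_integral_def)
      qed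
      with wp t(1) lhs have I: "cmod (integral {y1..y2} (\<lambda>y. of_real (B n y) * inner n y)) \<le> G"
        unfolding weak_partial_def by (metis norm_minus_cancel)
      have Bc: "continuous_on {y1..y2} (\<lambda>y. complex_of_real (B n y))"
        by (intro continuous_intros smooth_fns_deriv(3) AB)
      have "integral {y1..y2} (\<lambda>y. of_real (B n y) * inner n y) - integral {y1..y2} (\<lambda>y. of_real (B n y) * W y)
        = integral {y1..y2} (\<lambda>y. of_real (B n y) * inner n y - of_real (B n y) * W y)"
        by (intro integral_diff[symmetric] integrable_continuous_real continuous_intros Bc Wc inner_cont)
      also have "cmod \<dots> \<le> 2 * e * (y2 - y1)"
      proof (rule integral_bound)
        show "continuous_on {y1..y2} (\<lambda>y. of_real (B n y) * inner n y - of_real (B n y) * W y)"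
          by (intro continuous_intros Bc Wc inner_cont)
        fix y assume "y \<in> {y1..y2}"
        then have "cmod (of_real (B n y) * (inner n y - W y)) \<le> 1 * (2 * e)"
          unfolding norm_mult using B01[OF n(2), of y] near by (intro mult_mono) auto
        then show "cmod (of_real (B n y) * inner n y - of_real (B n y) * W y) \<le> 2 * e"
          by (simp add: right_diff_distrib)
      qed (use y in simp)
      finally show ?case using I by (smt (verit) norm_triangle_ineq3)
    qed
  qed
  have lim: "(\<lambda>n. integral {y1..y2} (\<lambda>y. of_real (B n y) * W y)) \<longlonglongrightarrow> integral {y1..y2} W"
  proof -
    obtain N where N: "\<And>n. N \<le> n \<Longrightarrow> 1 \<le> real n * (x2 - x1) \<and> 1 \<le> real n * (y2 - y1)"
      using big by (auto simp: eventually_sequentially)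
    \<comment> \<open>\<open>B n\<close> tends to 1 only between the endpoints, so the limit is
      taken on the open interval; the shift by \<open>N\<close> makes the domination by
      \<open>W\<close> hold for every index.\<close>
    have "(\<lambda>n. integral {y1<..<y2} (\<lambda>y. of_real (B (n + N) y) * W y)) \<longlonglongrightarrow> integral {y1<..<y2} W"
    proof (rule dominated_convergence(2))
      show "(\<lambda>y. complex_of_real (B (n + N) y) * W y) integrable_on {y1<..<y2}" for n
        by (intro integrable_continuous_real[THEN integrable_on_open_interval_real[THEN iffD2]]
            continuous_intros smooth_fns_deriv(3) AB Wc)
      show "(\<lambda>y. cmod (W y)) integrable_on {y1<..<y2}"
        by (intro integrable_continuous_real[THEN integrable_on_open_interval_real[THEN iffD2]]
            continuous_intros Wc)
      show "cmod (of_real (B (n + N) y) * W y) \<le> cmod (W y)" for n y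
        using B01[of "n + N" y] N[of "n + N"] by (auto simp: norm_mult intro!: mult_left_le_one_le)
      fix y assume yy: "y \<in> {y1<..<y2}"
      have "eventually (\<lambda>n. 1 \<le> real n * (y - y1) \<and> 1 \<le> real n * (y2 - y)) sequentially"
        using ev[of "y - y1"] ev[of "y2 - y"] yy by (auto intro: eventually_conj)
      then have "eventually (\<lambda>n. complex_of_real (B n y) * W y = W y) sequentially"
        by eventually_elim (simp add: B_def L'_def R'_def smooth_step_0 smooth_step_1 algebra_simps)
      then have "(\<lambda>n. complex_of_real (B n y) * W y) \<longlonglongrightarrow> W y"
        by (rule tendsto_eventually)
      then show "(\<lambda>n. complex_of_real (B (n + N) y) * W y) \<longlonglongrightarrow> W y"
        by (rule LIMSEQ_ignore_initial_segment)
    qed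
    then show ?thesis
      by - (rule LIMSEQ_offset[where k=N], simp add: integral_open_interval_real)
  qed
  have "cmod (integral {y1..y2} W) \<le> G"
  proof (rule field_le_epsilon)
    fix e :: real assume "0 < e"
    then have "0 < e / (2 * (y2 - y1))" using y by simp
    from est[OF this] have "cmod (integral {y1..y2} W) \<le> G + 2 * (e / (2 * (y2 - y1))) * (y2 - y1)"
      by (intro tendsto_upperbound[OF tendsto_norm[OF lim]]) auto
    moreover have "2 * (e / (2 * (y2 - y1))) * (y2 - y1) = e" using y by (simp add: field_simps)
    ultimately show "cmod (integral {y1..y2} W) \<le> G + e" by simp
  qed
  moreover have "integral {y1..y2} (\<lambda>y. f (of_coords b x2 y) - f (of_coords b x1 y)) = - integral {y1..y2} W"
    by (simp add: W_def flip: integral_neg)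
  ultimately show ?thesis by (simp add: G_def)
qed

text \<open>Cut the interval into equal steps shorter than \<open>d\<close> and telescope: the
  errors add up to \<open>e * (b - a)\<close>. Below, \<Phi> is always an integral minus a mass,
  zero at the left end, so an inequality for large sets follows from estimates on thin
  pieces.\<close>

lemma local_increment_bound:
  fixes \<Phi> :: "real \<Rightarrow> real"
  assumes ab: "a \<le> b"
    and loc: "\<And>e. 0 < e \<Longrightarrow> \<exists>d>0. \<forall>s t. a \<le> s \<longrightarrow> s \<le> t \<longrightarrow> t \<le> b \<longrightarrow> t - s < d
      \<longrightarrow> \<Phi> t - \<Phi> s \<le> e * (t - s)"
  shows "\<Phi> b \<le> \<Phi> a"
proof (cases "a = b")
  case False
  then have ab': "0 < b - a" using ab by simp
  show ?thesis
  proof (rule field_le_epsilon)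
    fix e :: real assume "0 < e"
    then have e': "0 < e / (b - a)" using ab' by simp
    from loc[OF this] obtain d where d: "0 < d"
      "\<And>s t. a \<le> s \<Longrightarrow> s \<le> t \<Longrightarrow> t \<le> b \<Longrightarrow> t - s < d \<Longrightarrow> \<Phi> t - \<Phi> s \<le> e / (b - a) * (t - s)"
      by blast
    obtain n :: nat where n: "(b - a) / d < real n" using reals_Archimedean2 by blast
    then have n0: "0 < real n" using ab' d(1) by (smt (verit) divide_pos_pos)
    define h where "h = (b - a) / real n"
    have h: "0 < h" "h < d" "real n * h = b - a"
      using n n0 ab' d(1) by (auto simp: h_def field_simps)
    have "i \<le> n \<Longrightarrow> \<Phi> (a + real i * h) - \<Phi> a \<le> e / (b - a) * (real i * h)" for i
    proof (induction i)
      case (Suc i)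
      have "real (Suc i) * h \<le> real n * h" using Suc h(1) by (intro mult_right_mono) auto
      then have "\<Phi> (a + real (Suc i) * h) - \<Phi> (a + real i * h) \<le> e / (b - a) * h"
        using h d(2)[of "a + real i * h" "a + real (Suc i) * h"] by (simp add: algebra_simps)
      with Suc show ?case by (simp add: algebra_simps)
    qed simp
    from this[of n] h(3) ab' show "\<Phi> b \<le> \<Phi> a + e" by simp
  qed
qed simp

section \<open>Increments of continuous functions against the mass of a weak derivative\<close>

definition mass :: "(complex \<Rightarrow> complex) \<Rightarrow> complex set \<Rightarrow> real" where
  "mass g S = (LINT z:S|lebesgue. cmod (g z))"

lemma mass_mono:
  assumes "set_integrable lebesgue T g" "S \<subseteq> T" "S \<in> sets lebesgue"
  shows "mass g S \<le> mass g T"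
proof -
  have T: "set_integrable lebesgue T (\<lambda>z. cmod (g z))"
    using assms(1) by (rule set_integrable_norm)
  have S: "set_integrable lebesgue S (\<lambda>z. cmod (g z))"
    by (rule set_integrable_subset[OF T assms(3,2)])
  show ?thesis
    unfolding mass_def using T S assms(2)
    by (auto simp: set_integrable_def set_lebesgue_integral_def indicator_def intro!: integral_mono)
qed

lemma mass_Un:
  assumes "set_integrable lebesgue U g" "S \<subseteq> U" "T \<subseteq> U" "S \<in> sets lebesgue" "T \<in> sets lebesgue"
    "S \<inter> T = {}"
  shows "mass g (S \<union> T) = mass g S + mass g T"
proof -
  have U: "set_integrable lebesgue U (\<lambda>z. cmod (g z))"
    using assms(1) by (rule set_integrable_norm)
  show ?thesis
    unfolding mass_def
    by (intro set_integral_Un assms(6) set_integrable_subset[OF U]) (use assms in auto)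
qed

lemma mass_coord_hrect_split:
  assumes g: "set_integrable lebesgue U g" and sub: "coord_rect b x1 x2 y1 y2 \<subseteq> U"
  shows "y1 \<le> s \<Longrightarrow> s \<le> y2 \<Longrightarrow>
      mass g (coord_hrect b x1 x2 y1 y2) = mass g (coord_hrect b x1 x2 y1 s) + mass g (coord_hrect b x1 x2 s y2)"
    and "x1 \<le> s \<Longrightarrow> s \<le> x2 \<Longrightarrow>
      mass g (coord_hrect b x1 x2 y1 y2) = mass g (coord_hrect b x1 s y1 y2) + mass g (coord_hrect b s x2 y1 y2)"
proof -
  have sub': "coord_hrect b x1 x2 y1 y2 \<subseteq> U" using sub coord_hrect_subset by blast
  show "mass g (coord_hrect b x1 x2 y1 y2) = mass g (coord_hrect b x1 x2 y1 s) + mass g (coord_hrect b x1 x2 s y2)"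
    if s: "y1 \<le> s" "s \<le> y2"
  proof -
    have "coord_hrect b x1 x2 y1 y2 = coord_hrect b x1 x2 y1 s \<union> coord_hrect b x1 x2 s y2"
      using s by (auto simp: coord_hrect_def)
    then show ?thesis using sub'
      by (simp add: mass_Un[OF g]) (subst mass_Un[OF g], auto simp: coord_hrect_def)
  qed
  show "mass g (coord_hrect b x1 x2 y1 y2) = mass g (coord_hrect b x1 s y1 y2) + mass g (coord_hrect b s x2 y1 y2)"
    if s: "x1 \<le> s" "s \<le> x2"
  proof -
    have "coord_hrect b x1 x2 y1 y2 = coord_hrect b x1 s y1 y2 \<union> coord_hrect b s x2 y1 y2"
      using s by (auto simp: coord_hrect_def)
    then show ?thesis using sub'
      by (simp add: mass_Un[OF g]) (subst mass_Un[OF g], auto simp: coord_hrect_def)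
  qed
qed

lemma coord_rect_mono:
  "x1 \<le> x1' \<Longrightarrow> x2' \<le> x2 \<Longrightarrow> y1 \<le> y1' \<Longrightarrow> y2' \<le> y2 \<Longrightarrow> coord_rect b x1' x2' y1' y2' \<subseteq> coord_rect b x1 x2 y1 y2"
  by (auto simp: coord_rect_def)

lemma of_coords_in_coord_rect: "x \<in> {x1..x2} \<Longrightarrow> y \<in> {y1..y2} \<Longrightarrow> of_coords b x y \<in> coord_rect b x1 x2 y1 y2"
  by (auto simp: coord_rect_def)

lemma continuous_on_slice:
  assumes "continuous_on (coord_rect b x1 x2 y1 y2) f" "x \<in> {x1..x2}"
  shows "continuous_on {y1..y2} (\<lambda>y. f (of_coords b x y))"
  by (rule continuous_on_compose2[OF assms(1)]) (use assms(2) in \<open>auto intro!: continuous_intros of_coords_in_coord_rect\<close>)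

text \<open>\<open>weak_partial_cell\<close> has the modulus outside the integral. On a short
  interval the increment \<open>D\<close> is almost constant, so there the modulus can be moved
  inside at a cost of \<open>e * (t - s)\<close>; additivity of the mass and
  \<open>local_increment_bound\<close> do the rest.\<close>

lemma weak_partial_integral_bound:
  assumes f: "continuous_on U f" and g: "set_integrable lebesgue U g" and U: "open U"
    and wp: "weak_partial b U f g"
    and sub: "coord_rect b x1 x2 y1 y2 \<subseteq> U" and x: "x1 \<le> x2" and y: "y1 \<le> y2"
  shows "integral {y1..y2} (\<lambda>y. cmod (f (of_coords b x2 y) - f (of_coords b x1 y))) \<le> mass g (coord_hrect b x1 x2 y1 y2)"
proof (cases "x1 = x2")
  case True
  then show ?thesis by (simp add: coord_hrect_def mass_def set_lebesgue_integral_def)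
next
  case False
  then have x': "x1 < x2" using x by simp
  define D where "D y = f (of_coords b x2 y) - f (of_coords b x1 y)" for y
  have fR: "continuous_on (coord_rect b x1 x2 y1 y2) f" using f sub continuous_on_subset by blast
  have Dc: "continuous_on {y1..y2} D"
    unfolding D_def using x by (intro continuous_intros continuous_on_slice[OF fR]) auto
  define \<Phi> where "\<Phi> t = integral {y1..t} (\<lambda>y. cmod (D y)) - mass g (coord_hrect b x1 x2 y1 t)" for t
  have "\<Phi> y2 \<le> \<Phi> y1"
  proof (rule local_increment_bound[OF y])
    fix e :: real assume e: "0 < e"
    have "uniformly_continuous_on {y1..y2} D"
      by (intro compact_uniformly_continuous Dc) simp
    then obtain d where d: "0 < d"
      "\<And>s t. s \<in> {y1..y2} \<Longrightarrow> t \<in> {y1..y2} \<Longrightarrow> dist t s < d \<Longrightarrow> dist (D t) (D s) < e / 2"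
      using e unfolding uniformly_continuous_on_def by (metis half_gt_zero)
    show "\<exists>d>0. \<forall>s t. y1 \<le> s \<longrightarrow> s \<le> t \<longrightarrow> t \<le> y2 \<longrightarrow> t - s < d \<longrightarrow> \<Phi> t - \<Phi> s \<le> e * (t - s)"
    proof (intro exI conjI allI impI)
      fix s t assume st: "y1 \<le> s" "s \<le> t" "t \<le> y2" "t - s < d"
      show "\<Phi> t - \<Phi> s \<le> e * (t - s)"
      proof (cases "s = t")
        case False
        then have st': "s < t" using st by simp
        have Dst: "continuous_on {s..t} D" using Dc by (rule continuous_on_subset) (use st in auto)
        \<comment> \<open>One half of \<open>e\<close> pays for replacing the integral of
          \<open>cmod (D y)\<close> by \<open>cmod (D s) * (t - s)\<close>, the other half for
          returning to the norm of the integral of \<open>D\<close>.\<close>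
        have near: "cmod (D y - D s) \<le> e / 2" if "y \<in> {s..t}" for y
          using d(2)[of s y] that st by (force simp: dist_norm)
        have 1: "integral {y1..t} (\<lambda>y. cmod (D y)) - integral {y1..s} (\<lambda>y. cmod (D y)) = integral {s..t} (\<lambda>y. cmod (D y))"
        proof -
          have "continuous_on {y1..t} D" using Dc by (rule continuous_on_subset) (use st in auto)
          then have "(\<lambda>y. cmod (D y)) integrable_on {y1..t}"
            by (intro integrable_continuous_real continuous_intros)
          from Henstock_Kurzweil_Integration.integral_combine[OF st(1,2) this] show ?thesis by simp
        qed
        have 2: "mass g (coord_hrect b x1 x2 y1 t) = mass g (coord_hrect b x1 x2 y1 s) + mass g (coord_hrect b x1 x2 s t)"
          by (rule mass_coord_hrect_split(1)[OF g]) (use st sub coord_rect_mono[of x1 x1 x2 x2 y1 y1 t y2 b] in auto)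
        have 3: "cmod (integral {s..t} D) \<le> mass g (coord_hrect b x1 x2 s t)"
          unfolding mass_def D_def
          by (rule weak_partial_cell[OF f g U wp _ x' st'])
             (use sub coord_rect_mono[of x1 x1 x2 x2 y1 s t y2 b] st in auto)
        have "integral {s..t} (\<lambda>y. cmod (D y)) \<le> integral {s..t} (\<lambda>y. cmod (D s) + e / 2)"
        proof (rule integral_le)
          fix y assume "y \<in> {s..t}"
          then show "cmod (D y) \<le> cmod (D s) + e / 2"
            using near[of y] norm_triangle_ineq2[of "D y" "D s"] by linarith
        qed (auto intro!: integrable_continuous_real continuous_intros Dst)
        then have 4: "integral {s..t} (\<lambda>y. cmod (D y)) \<le> cmod (D s) * (t - s) + e / 2 * (t - s)"
          using st by (simp add: algebra_simps)
        have "integral {s..t} D - integral {s..t} (\<lambda>y. D s) = integral {s..t} (\<lambda>y. D y - D s)"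
          by (intro integral_diff[symmetric] integrable_continuous_real Dst) auto
        also have "cmod \<dots> \<le> e / 2 * (t - s)"
          using near st by (intro integral_bound continuous_intros Dst) auto
        finally have "cmod (integral {s..t} D - of_real (t - s) * D s) \<le> e / 2 * (t - s)"
          using st by (simp add: scaleR_conv_of_real)
        then have "cmod (of_real (t - s) * D s) \<le> cmod (integral {s..t} D) + e / 2 * (t - s)"
          by (smt (verit) norm_triangle_ineq3)
        then have "cmod (D s) * (t - s) \<le> cmod (integral {s..t} D) + e / 2 * (t - s)"
          using st by (simp add: norm_mult mult.commute flip: of_real_diff)
        moreover have "e * (t - s) = e / 2 * (t - s) + e / 2 * (t - s)" by simp
        ultimately show ?thesis using 1 2 3 4 unfolding \<Phi>_def by linarith
      qed simp
    qed (rule d(1))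
  qed
  then show ?thesis by (simp add: \<Phi>_def D_def coord_hrect_def mass_def set_lebesgue_integral_def)
qed

text \<open>
  Local control of \<open>v\<close> by \<open>f\<close>; it replaces a chain rule for the weak derivative of a function of \<open>f\<close>.
\<close>
definition rel_lip :: "real \<Rightarrow> complex set \<Rightarrow> (complex \<Rightarrow> complex) \<Rightarrow> (complex \<Rightarrow> real) \<Rightarrow> bool" where
  "rel_lip K U f v \<longleftrightarrow> (\<forall>C. compact C \<longrightarrow> C \<subseteq> U \<longrightarrow>
     (\<exists>d>0. \<forall>z\<in>C. \<forall>z'\<in>C. dist z z' < d \<longrightarrow> \<bar>v z - v z'\<bar> \<le> K * cmod (f z - f z')))"

text \<open>The constant \<open>K\<close> is valid only between points closer than some
  \<open>d\<close>, so the interval in direction \<open>b\<close> is cut into steps shorter than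
  \<open>d\<close>. The triangle inequality on one side and additivity of mass on the other make
  each step of \<Phi> nonpositive, without any error term.\<close>

lemma rel_lip_integral_bound:
  assumes f: "continuous_on U f" and g: "set_integrable lebesgue U g" and U: "open U"
    and wp: "weak_partial b U f g"
    and K: "0 \<le> K" and lip: "rel_lip K U f v" and v: "continuous_on U v"
    and sub: "coord_rect b x1 x2 y1 y2 \<subseteq> U" and x: "x1 \<le> x2" and y: "y1 \<le> y2"
  shows "integral {y1..y2} (\<lambda>y. \<bar>v (of_coords b x2 y) - v (of_coords b x1 y)\<bar>) \<le> K * mass g (coord_hrect b x1 x2 y1 y2)"
proof -
  have fR: "continuous_on (coord_rect b x1 x2 y1 y2) f" using f sub continuous_on_subset by blast
  have vR: "continuous_on (coord_rect b x1 x2 y1 y2) v" using v sub continuous_on_subset by blast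
  obtain d where d: "0 < d" "\<And>z z'. z \<in> coord_rect b x1 x2 y1 y2 \<Longrightarrow> z' \<in> coord_rect b x1 x2 y1 y2 \<Longrightarrow> dist z z' < d
      \<Longrightarrow> \<bar>v z - v z'\<bar> \<le> K * cmod (f z - f z')"
    using lip compact_coord_rect sub unfolding rel_lip_def by meson
  have ci: "(\<lambda>y. \<bar>v (of_coords b s y) - v (of_coords b t y)\<bar>) integrable_on {y1..y2}"
    if "s \<in> {x1..x2}" "t \<in> {x1..x2}" for s t
    by (intro integrable_continuous_real continuous_intros continuous_on_slice[OF vR] that)
  define \<Phi> where "\<Phi> t = integral {y1..y2} (\<lambda>y. \<bar>v (of_coords b t y) - v (of_coords b x1 y)\<bar>) - K * mass g (coord_hrect b x1 t y1 y2)" for t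
  have "\<Phi> x2 \<le> \<Phi> x1"
  proof (rule local_increment_bound[OF x])
    fix e :: real assume e: "0 < e"
    show "\<exists>d>0. \<forall>s t. x1 \<le> s \<longrightarrow> s \<le> t \<longrightarrow> t \<le> x2 \<longrightarrow> t - s < d \<longrightarrow> \<Phi> t - \<Phi> s \<le> e * (t - s)"
    proof (intro exI conjI allI impI)
      fix s t assume st: "x1 \<le> s" "s \<le> t" "t \<le> x2" "t - s < d"
      have 2: "mass g (coord_hrect b x1 t y1 y2) = mass g (coord_hrect b x1 s y1 y2) + mass g (coord_hrect b s t y1 y2)"
        by (rule mass_coord_hrect_split(2)[OF g]) (use st sub coord_rect_mono[of x1 x1 t x2 y1 y1 y2 y2 b] in auto)
      have 3: "integral {y1..y2} (\<lambda>y. cmod (f (of_coords b t y) - f (of_coords b s y))) \<le> mass g (coord_hrect b s t y1 y2)"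
        by (rule weak_partial_integral_bound[OF f g U wp _ _ y])
           (use sub coord_rect_mono[of x1 s t x2 y1 y1 y2 y2 b] st in auto)
      have "integral {y1..y2} (\<lambda>y. \<bar>v (of_coords b t y) - v (of_coords b x1 y)\<bar>) \<le>
          integral {y1..y2} (\<lambda>y. \<bar>v (of_coords b t y) - v (of_coords b s y)\<bar> + \<bar>v (of_coords b s y) - v (of_coords b x1 y)\<bar>)"
        by (intro integral_le integrable_add ci) (use st in auto)
      also have "\<dots> = integral {y1..y2} (\<lambda>y. \<bar>v (of_coords b t y) - v (of_coords b s y)\<bar>)
          + integral {y1..y2} (\<lambda>y. \<bar>v (of_coords b s y) - v (of_coords b x1 y)\<bar>)"
        by (intro integral_add ci) (use st in auto)
      also have "integral {y1..y2} (\<lambda>y. \<bar>v (of_coords b t y) - v (of_coords b s y)\<bar>)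
          \<le> integral {y1..y2} (\<lambda>y. K * cmod (f (of_coords b t y) - f (of_coords b s y)))"
      proof (rule integral_le)
        show "(\<lambda>y. K * cmod (f (of_coords b t y) - f (of_coords b s y))) integrable_on {y1..y2}"
          by (intro integrable_continuous_real continuous_intros continuous_on_slice[OF fR])
             (use st in auto)
        show "\<bar>v (of_coords b t y) - v (of_coords b s y)\<bar> \<le> K * cmod (f (of_coords b t y) - f (of_coords b s y))" if "y \<in> {y1..y2}" for y
          using that st by (intro d(2) of_coords_in_coord_rect) (auto simp: dist_of_coords)
      qed (use st in \<open>auto intro!: ci\<close>)
      also have "\<dots> \<le> K * mass g (coord_hrect b s t y1 y2)"
        using 3 K by (simp add: mult_left_mono)
      finally have "\<Phi> t - \<Phi> s \<le> 0" unfolding \<Phi>_def 2 by (simp add: algebra_simps)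
      also have "0 \<le> e * (t - s)" using e st by simp
      finally show "\<Phi> t - \<Phi> s \<le> e * (t - s)" .
    qed (rule d(1))
  qed
  then show ?thesis by (simp add: \<Phi>_def coord_hrect_def mass_def set_lebesgue_integral_def)
qed

section \<open>Approaching the boundary circle\<close>

lemma cmod_Complex_less_1: "cmod (Complex x y) < 1 \<longleftrightarrow> x\<^sup>2 + y\<^sup>2 < 1"
  by (simp add: cmod_def)

lemma cmod_Complex_le_1: "cmod (Complex x y) \<le> 1 \<longleftrightarrow> x\<^sup>2 + y\<^sup>2 \<le> 1"
  by (simp add: cmod_def)

lemma lebesgue_borelI: "S \<in> sets borel \<Longrightarrow> S \<in> sets lebesgue"
  by simp

text \<open>A rectangle inside the disk cannot end on the circle. The heights are therefore cut into
  thin slabs, and for each slab a rectangle from \<open>x0\<close> to just short of the circle is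
  used; uniform continuity of \<open>v\<close> bridges the remaining gap at a cost of
  \<open>e\<close>. Continuity up to the circle is asked only at heights at least
  \<open>s1 > 0\<close>, which leaves out the point 1, where the angle blows up.\<close>

lemma boundary_integral_bound:
  fixes v :: "complex \<Rightarrow> real"
  assumes f: "continuous_on (ball 0 1) f" and g: "set_integrable lebesgue (ball 0 1) g"
    and wp: "weak_partial False (ball 0 1) f g"
    and K: "0 \<le> K" and lip: "rel_lip K (ball 0 1) f v" and v: "continuous_on (ball 0 1) v"
    and s: "0 < s1" "s1 \<le> s2" and x0: "0 \<le> x0" "x0\<^sup>2 + s2\<^sup>2 < 1"
    and vb: "continuous_on (cball 0 1 \<inter> {z. s1 \<le> Im z}) v"
    and c: "\<And>y. y \<in> {s1..s2} \<Longrightarrow> v (Complex (sqrt (1 - y\<^sup>2)) y) = c"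
  shows "integral {s1..s2} (\<lambda>y. \<bar>c - v (Complex x0 y)\<bar>)
    \<le> K * mass g ({z. x0 < Re z \<and> s1 < Im z \<and> Im z \<le> s2} \<inter> ball 0 1)"
proof -
  define Q where "Q t = {z. x0 < Re z \<and> s1 < Im z \<and> Im z \<le> t} \<inter> ball 0 1" for t
  define a where "a y = sqrt (1 - y\<^sup>2)" for y :: real
  have Qm: "Q t \<in> sets lebesgue" for t unfolding Q_def by (rule lebesgue_borelI) measurable
  have sq: "y\<^sup>2 \<le> s2\<^sup>2" if "y \<in> {s1..s2}" for y using that s by (auto intro: power_mono)
  have inb: "Complex x y \<in> ball 0 1" if "0 \<le> x" "x < a t" "s1 \<le> y" "y \<le> t" "t \<le> s2" for x y t
  proof -
    have "x\<^sup>2 < 1 - t\<^sup>2"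
      using that(1,2) real_le_lsqrt[of x "1 - t\<^sup>2"] unfolding a_def by (meson not_le)
    moreover have "y\<^sup>2 \<le> t\<^sup>2" using that s by (intro power_mono) auto
    ultimately show ?thesis by (simp add: cmod_Complex_less_1)
  qed
  have a0: "x0 < a t" if "t \<in> {s1..s2}" for t
    unfolding a_def using x0 sq[OF that] by (intro real_less_rsqrt) simp
  have ac: "continuous_on {s1..s2} a" unfolding a_def by (intro continuous_intros)
  have adec: "a t \<le> a y" if "s1 \<le> y" "y \<le> t" for y t
    unfolding a_def using that s by (auto intro: power_mono)
  have vx: "continuous_on S (\<lambda>y. v (Complex x y))" if "\<And>y. y \<in> S \<Longrightarrow> Complex x y \<in> ball 0 1" for x S
    by (rule continuous_on_compose2[OF v]) (auto intro!: continuous_intros that)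
  have x0b: "Complex x0 y \<in> ball 0 1" if "y \<in> {s1..s2}" for y
    using inb[of x0 y y] a0[OF that] x0 that by auto
  define \<Phi> where "\<Phi> t = integral {s1..t} (\<lambda>y. \<bar>c - v (Complex x0 y)\<bar>) - K * mass g (Q t)" for t
  have "\<Phi> s2 \<le> \<Phi> s1"
  proof (rule local_increment_bound[OF s(2)])
    fix e :: real assume e: "0 < e"
    have "compact (cball 0 1 \<inter> {z. s1 \<le> Im z})"
      by (intro compact_Int_closed closed_halfspace_Im_ge) simp
    then have "uniformly_continuous_on (cball 0 1 \<inter> {z. s1 \<le> Im z}) v"
      by (intro compact_uniformly_continuous vb)
    then obtain d where d: "0 < d"
      "\<And>z z'. z \<in> cball 0 1 \<inter> {z. s1 \<le> Im z} \<Longrightarrow> z' \<in> cball 0 1 \<inter> {z. s1 \<le> Im z} \<Longrightarrow>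
        dist z' z < d \<Longrightarrow> dist (v z') (v z) < e"
      using e unfolding uniformly_continuous_on_def by metis
    have "uniformly_continuous_on {s1..s2} a"
      by (intro compact_uniformly_continuous ac) simp
    then obtain d' where d': "0 < d'"
      "\<And>s t. s \<in> {s1..s2} \<Longrightarrow> t \<in> {s1..s2} \<Longrightarrow> dist t s < d' \<Longrightarrow> dist (a t) (a s) < d / 2"
      using d(1) unfolding uniformly_continuous_on_def by (metis half_gt_zero)
    show "\<exists>d>0. \<forall>s t. s1 \<le> s \<longrightarrow> s \<le> t \<longrightarrow> t \<le> s2 \<longrightarrow> t - s < d \<longrightarrow> \<Phi> t - \<Phi> s \<le> e * (t - s)"
    proof (intro exI conjI allI impI)
      fix s' t assume st: "s1 \<le> s'" "s' \<le> t" "t \<le> s2" "t - s' < d'"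
      \<comment> \<open>The first bound, together with the variation of \<open>a\<close> over the
        slab, keeps the right edge within \<open>d\<close> of the circle; the second keeps it
        strictly between \<open>x0\<close> and the shortest chord end \<open>a t\<close>, so the
        rectangle stays in the open disk.\<close>
      define \<tau> where "\<tau> = min (d / 2) ((a t - x0) / 2)"
      define \<alpha> where "\<alpha> = a t - \<tau>"
      have at: "x0 < a t" using a0 st by simp
      then have \<tau>: "0 < \<tau>" "\<tau> \<le> d / 2" "\<tau> \<le> (a t - x0) / 2" using d(1) by (auto simp: \<tau>_def min_def)
      then have \<alpha>: "x0 < \<alpha>" "\<alpha> < a t" using at by (auto simp: \<alpha>_def)
      have inb': "Complex x y \<in> ball 0 1" if "x0 \<le> x" "x \<le> \<alpha>" "s' \<le> y" "y \<le> t" for x y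
        using inb[of x t y] that \<alpha> st x0 by auto
      have sub: "coord_rect False x0 \<alpha> s' t \<subseteq> ball 0 1"
      proof
        fix z assume "z \<in> coord_rect False x0 \<alpha> s' t"
        then show "z \<in> ball 0 1" using inb'[of "Re z" "Im z"] by (auto simp: coord_rect_def coord_def)
      qed
      have near: "\<bar>c - v (Complex \<alpha> y)\<bar> \<le> e" if y: "y \<in> {s'..t}" for y
      proof -
        have y': "y \<in> {s1..s2}" using y st by auto
        have "y\<^sup>2 \<le> 1" using sq[OF y'] x0 by (smt (verit) zero_le_power2)
        then have "Complex (a y) y \<in> cball 0 1 \<inter> {z. s1 \<le> Im z}"
          using y' by (simp add: cmod_Complex_le_1 a_def)
        moreover have "Complex \<alpha> y \<in> cball 0 1 \<inter> {z. s1 \<le> Im z}"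
          using inb'[of \<alpha> y] \<alpha> y y' by auto
        moreover have "dist (Complex (a y) y) (Complex \<alpha> y) < d"
        proof -
          have "dist (a y) (a t) < d / 2" using y' y st by (intro d'(2)) (auto simp: dist_real_def)
          moreover have "dist (Complex (a y) y) (Complex \<alpha> y) = \<bar>a y - \<alpha>\<bar>"
            by (simp add: dist_norm cmod_def)
          ultimately show ?thesis using \<tau> unfolding \<alpha>_def dist_real_def by linarith
        qed
        ultimately have "dist (v (Complex (a y) y)) (v (Complex \<alpha> y)) < e" using d(2) by blast
        then show ?thesis using c[OF y'] by (simp add: a_def dist_real_def)
      qed
      have c0: "continuous_on {s'..t} (\<lambda>y. v (Complex x0 y))" "continuous_on {s'..t} (\<lambda>y. v (Complex \<alpha> y))"
        using inb' \<alpha> by (auto intro!: vx)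
      have 1: "integral {s1..t} (\<lambda>y. \<bar>c - v (Complex x0 y)\<bar>)
          = integral {s1..s'} (\<lambda>y. \<bar>c - v (Complex x0 y)\<bar>) + integral {s'..t} (\<lambda>y. \<bar>c - v (Complex x0 y)\<bar>)"
      proof -
        have "(\<lambda>y. \<bar>c - v (Complex x0 y)\<bar>) integrable_on {s1..t}"
          by (intro integrable_continuous_real continuous_intros vx x0b) (use st in auto)
        from Henstock_Kurzweil_Integration.integral_combine[OF st(1,2) this] show ?thesis by simp
      qed
      have "integral {s'..t} (\<lambda>y. \<bar>c - v (Complex x0 y)\<bar>) \<le> 
          integral {s'..t} (\<lambda>y. e + \<bar>v (Complex \<alpha> y) - v (Complex x0 y)\<bar>)"
      proof (rule integral_le)
        show "\<bar>c - v (Complex x0 y)\<bar> \<le> e + \<bar>v (Complex \<alpha> y) - v (Complex x0 y)\<bar>" if "y \<in> {s'..t}" for y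
          using near[OF that] by linarith
      qed (intro integrable_continuous_real continuous_intros c0)+
      also have "\<dots> = e * (t - s') + integral {s'..t} (\<lambda>y. \<bar>v (of_coords False \<alpha> y) - v (of_coords False x0 y)\<bar>)"
        using st by (subst integral_add) (auto simp: of_coords_def intro!: integrable_continuous_real continuous_intros c0)
      also have "integral {s'..t} (\<lambda>y. \<bar>v (of_coords False \<alpha> y) - v (of_coords False x0 y)\<bar>) \<le> K * mass g (coord_hrect False x0 \<alpha> s' t)"
        by (rule rel_lip_integral_bound[OF f g open_ball wp K lip v sub]) (use \<alpha> st in auto)
      finally have 2: "integral {s'..t} (\<lambda>y. \<bar>c - v (Complex x0 y)\<bar>) \<le> e * (t - s') + K * mass g (coord_hrect False x0 \<alpha> s' t)"
        by simp
      have hb: "coord_hrect False x0 \<alpha> s' t \<subseteq> ball 0 1"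
        using sub coord_hrect_subset by blast
      have "mass g (Q s') + mass g (coord_hrect False x0 \<alpha> s' t) = mass g (Q s' \<union> coord_hrect False x0 \<alpha> s' t)"
      proof (rule mass_Un[OF g _ hb, symmetric])
        show "Q s' \<inter> coord_hrect False x0 \<alpha> s' t = {}" by (auto simp: Q_def coord_hrect_def coord_def)
        show "Q s' \<subseteq> ball 0 1" by (auto simp: Q_def)
        show "Q s' \<in> sets lebesgue" by (rule Qm)
      qed simp
      also have "\<dots> \<le> mass g (Q t)"
      proof (rule mass_mono)
        show "set_integrable lebesgue (Q t) g"
          by (rule set_integrable_subset[OF g Qm]) (auto simp: Q_def)
        show "Q s' \<union> coord_hrect False x0 \<alpha> s' t \<subseteq> Q t"
          using hb st by (auto simp: Q_def coord_hrect_def coord_def)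
        show "Q s' \<union> coord_hrect False x0 \<alpha> s' t \<in> sets lebesgue" by (intro sets.Un Qm) simp
      qed
      finally have "K * mass g (Q s') + K * mass g (coord_hrect False x0 \<alpha> s' t) \<le> K * mass g (Q t)"
        using K by (metis distrib_left mult_left_mono)
      with 1 2 show "\<Phi> t - \<Phi> s' \<le> e * (t - s')" by (simp add: \<Phi>_def)
    qed (rule d'(1))
  qed
  moreover have "Q s1 = {}" by (auto simp: Q_def)
  ultimately show ?thesis by (simp add: \<Phi>_def Q_def mass_def set_lebesgue_integral_def)
qed

text \<open>Splitting at the level \<open>s\<close>, with \<open>s\<close> tuned to the scale, replaces the inequality of Hoelder.\<close>
lemma le_add_powr:
  fixes x :: real
  assumes "0 \<le> x" "0 < s" "1 \<le> p"
  shows "x \<le> s + s powr (1 - p) * x powr p"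
proof (cases "x \<le> s")
  case False
  then have "x = x powr (1 - p) * x powr p" using assms by (simp flip: powr_add)
  also have "\<dots> \<le> s powr (1 - p) * x powr p"
    using False assms by (intro mult_right_mono powr_mono2') auto
  finally show ?thesis using assms by simp
qed (use assms in \<open>simp add: add_increasing2\<close>)

section \<open>Masses of p-integrable functions on small sets\<close>

lemma Lp_on_set_integrable:
  assumes "Lp_on p U g" "1 \<le> p" "U \<in> lmeasurable"
  shows "set_integrable lebesgue U g"
  unfolding set_integrable_def
proof (rule Bochner_Integration.integrable_bound)
  have "integrable lebesgue (\<lambda>z. indicator U z *\<^sub>R (1::real) + indicator U z *\<^sub>R (cmod (g z) powr p))"
    using assms fmeasurableD2[OF assms(3)]
    by (intro Bochner_Integration.integrable_add) (auto simp: Lp_on_def set_integrable_def top.not_eq_extremum)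
  then show "integrable lebesgue (\<lambda>z. indicator U z *\<^sub>R (1 + cmod (g z) powr p))"
    by (simp only: scaleR_add_right)
  show "(\<lambda>x. indicat_real U x *\<^sub>R g x) \<in> borel_measurable lebesgue"
    using assms(1) by (simp add: Lp_on_def set_borel_measurable_def)
  have "cmod (g z) \<le> 1 + cmod (g z) powr p" for z
    using le_add_powr[of "cmod (g z)" 1 p] assms by simp
  then show "AE x in lebesgue. norm (indicat_real U x *\<^sub>R g x) \<le> norm (indicat_real U x *\<^sub>R (1 + cmod (g x) powr p))"
    by (auto simp: indicator_def)
qed

text \<open>With \<open>s\<close> balanced against the measure of \<open>Q\<close> this has the
  strength of the bound by a multiple of |Q| to the power 1 - 1/p. The level is left free and is
  chosen once the size of \<open>Q\<close> is known.\<close>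

lemma mass_le_powr:
  assumes g: "Lp_on p U g" and p: "1 \<le> p" and U: "U \<in> lmeasurable"
    and Q: "Q \<in> sets lebesgue" "Q \<subseteq> U" and s: "0 < s"
  shows "mass g Q \<le> s * measure lebesgue Q + s powr (1 - p) * (LINT z:U|lebesgue. cmod (g z) powr p)"
proof -
  have Qf: "emeasure lebesgue Q < \<infinity>"
    using fmeasurableD2[OF fmeasurableI2[OF U Q(2,1)]] by (simp add: top.not_eq_extremum)
  have i: "integrable lebesgue (\<lambda>z. s * indicator Q z + s powr (1 - p) * (indicator U z *\<^sub>R (cmod (g z) powr p)))"
    using g Qf Q(1)
    by (intro Bochner_Integration.integrable_add integrable_mult_right) (auto simp: Lp_on_def set_integrable_def)
  have "mass g Q \<le> (LINT z|lebesgue. s * indicator Q z + s powr (1 - p) * (indicator U z *\<^sub>R (cmod (g z) powr p)))"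
    unfolding mass_def set_lebesgue_integral_def
  proof (rule integral_mono'[OF i])
    fix z
    show "indicat_real Q z *\<^sub>R cmod (g z) \<le> s * indicator Q z + s powr (1 - p) * (indicator U z *\<^sub>R (cmod (g z) powr p))"
      using le_add_powr[of "cmod (g z)" s p] p s Q(2) by (auto simp: indicator_def)
    show "0 \<le> s * indicator Q z + s powr (1 - p) * (indicator U z *\<^sub>R (cmod (g z) powr p))"
      using s by (auto simp: indicator_def)
  qed
  also have "\<dots> = s * measure lebesgue Q + s powr (1 - p) * (LINT z:U|lebesgue. cmod (g z) powr p)"
    unfolding set_lebesgue_integral_def
    using g Qf Q(1) by (subst Bochner_Integration.integral_add) (auto simp: Lp_on_def set_integrable_def)
  finally show ?thesis .
qed

text \<open>For \<open>x\<close> in an interval of length \<open>r\<close> and \<open>y\<close> in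
  one of length \<open>r / 8\<close>, the path runs from the circle at height \<open>y\<close> left
  to abscissa \<open>x\<close>, up by \<open>2 * r\<close>, and right to the circle again; along it
  \<open>v\<close> changes from \<open>cA\<close> to \<open>cB\<close>. Averaged over
  \<open>y\<close>, a horizontal side costs at most \<open>K * mass g1 Q\<close> for every
  \<open>x\<close>, whence the coefficient \<open>2 * r\<close>; averaged over \<open>x\<close>, the
  vertical side costs at most \<open>K * mass g2 Q\<close> for every \<open>y\<close>, whence
  \<open>r / 8\<close>.\<close>

lemma strip_bound:
  fixes v :: "complex \<Rightarrow> real"
  assumes f: "continuous_on (ball 0 1) f"
    and g1: "set_integrable lebesgue (ball 0 1) g1" "weak_partial False (ball 0 1) f g1"
    and g2: "set_integrable lebesgue (ball 0 1) g2" "weak_partial True (ball 0 1) f g2"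
    and K: "0 \<le> K" and lip: "rel_lip K (ball 0 1) f v" and v: "continuous_on (ball 0 1) v"
    and r: "0 < r" "r \<le> 1 / 10"
    and vb: "continuous_on (cball 0 1 \<inter> {z. r / 8 \<le> Im z}) v"
    and cA: "\<And>y. y \<in> {r/8..r/4} \<Longrightarrow> v (Complex (sqrt (1 - y\<^sup>2)) y) = cA"
    and cB: "\<And>y. y \<in> {r/8 + 2*r..r/4 + 2*r} \<Longrightarrow> v (Complex (sqrt (1 - y\<^sup>2)) y) = cB"
  defines "Q \<equiv> {z. 1 - 4 * r \<le> Re z \<and> 0 \<le> Im z \<and> Im z \<le> 3 * r} \<inter> ball 0 1"
  shows "r * (r / 8 * \<bar>cA - cB\<bar>) \<le> 2 * r * (K * mass g1 Q) + r / 8 * (K * mass g2 Q)"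
proof -
  have Qm: "Q \<in> sets lebesgue" unfolding Q_def by (rule lebesgue_borelI) measurable
  have Qi: "set_integrable lebesgue Q g1" "set_integrable lebesgue Q g2"
    by (rule set_integrable_subset[OF g1(1) Qm] set_integrable_subset[OF g2(1) Qm]; simp add: Q_def)+
  have mm: "K * mass g S \<le> K * mass g Q"
    if "S \<subseteq> Q" "S \<in> sets lebesgue" "set_integrable lebesgue Q g" for S g
    using mass_mono[OF that(3,1,2)] K by (rule mult_left_mono)
  define U where "U = {1 - 4 * r..1 - 3 * r}"
  define S where "S = {r/8..r/4}"
  \<comment> \<open>The worst corner is \<open>(1 - 3 * r, 3 * r)\<close>, whose squared modulus is
    \<open>1 - 6 * r * (1 - 3 * r)\<close>. This is why the vertical sides stand at distance at
    least \<open>3 * r\<close> from the line through 1.\<close>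
  have inb: "Complex x y \<in> ball 0 1" if "x \<in> U" "y \<in> {r/8..3*r}" for x y
  proof -
    have "x\<^sup>2 \<le> (1 - 3 * r)\<^sup>2"
      using that r by (intro power_mono) (auto simp: U_def)
    moreover have "y\<^sup>2 \<le> (3 * r)\<^sup>2"
      using that r by (intro power_mono) auto
    moreover have "(1 - 3 * r)\<^sup>2 + (3 * r)\<^sup>2 = 1 - 6 * r * (1 - 3 * r)" by (simp add: power2_eq_square algebra_simps)
    moreover have "0 < 6 * r * (1 - 3 * r)" using r by simp
    ultimately show ?thesis by (simp add: cmod_Complex_less_1)
  qed
  have sq9: "(1 - 3 * r)\<^sup>2 + (3 * r)\<^sup>2 < 1"
    using inb[of "1 - 3 * r" "3 * r"] r by (simp add: U_def cmod_Complex_less_1)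
  have v2: "continuous_on (U \<times> S) (\<lambda>(x, y). v (Complex x (y + c)))" if "c \<in> {0..2*r}" for c
    unfolding case_prod_unfold
    by (rule continuous_on_compose2[OF v])
       (use that r in \<open>auto simp: S_def intro!: continuous_intros inb\<close>)
  have vy: "continuous_on S (\<lambda>y. v (Complex x (y + c)))" if "x \<in> U" "c \<in> {0..2*r}" for x c
    by (rule continuous_on_compose2[OF v]) (use that r in \<open>auto simp: S_def intro!: continuous_intros inb\<close>)
  \<comment> \<open>The summand 0 makes both terms instances of \<open>v2\<close> and
    \<open>vy\<close>.\<close>
  define J where "J x y = \<bar>v (Complex x (y + 2 * r)) - v (Complex x (y + 0))\<bar>" for x y
  have Jc: "continuous_on (U \<times> S) (\<lambda>(x, y). J x y)"
  proof -
    have "continuous_on (U \<times> S) (\<lambda>q. \<bar>(case q of (x, y) \<Rightarrow> v (Complex x (y + 2 * r)))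
        - (case q of (x, y) \<Rightarrow> v (Complex x (y + 0)))\<bar>)"
      by (intro continuous_on_rabs continuous_on_diff v2) (use r in auto)
    then show ?thesis by (simp add: J_def case_prod_unfold)
  qed
  have Jx: "continuous_on S (J x)" if "x \<in> U" for x
    unfolding J_def using that r by (intro continuous_intros vy) auto
  have hor: "integral {s1..s2} (\<lambda>y. \<bar>c - v (Complex x y)\<bar>) \<le> K * mass g1 Q"
    if "r / 8 \<le> s1" "s1 \<le> s2" "s2 \<le> 3 * r" "x \<in> U"
      and c: "\<And>y. y \<in> {s1..s2} \<Longrightarrow> v (Complex (sqrt (1 - y\<^sup>2)) y) = c" for s1 s2 c x
  proof -
    have "integral {s1..s2} (\<lambda>y. \<bar>c - v (Complex x y)\<bar>)
      \<le> K * mass g1 ({z. x < Re z \<and> s1 < Im z \<and> Im z \<le> s2} \<inter> ball 0 1)"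
    proof (rule boundary_integral_bound[OF f g1 K lip v _ that(2) _ _ _ c])
      show "continuous_on (cball 0 1 \<inter> {z. s1 \<le> Im z}) v"
        using vb by (rule continuous_on_subset) (use that in auto)
      have "x\<^sup>2 \<le> (1 - 3 * r)\<^sup>2"
        using that r by (intro power_mono) (auto simp: U_def)
      moreover have "s2\<^sup>2 \<le> (3 * r)\<^sup>2"
        using that r by (intro power_mono) auto
      ultimately show "x\<^sup>2 + s2\<^sup>2 < 1" using sq9 by linarith
    qed (use that r in \<open>auto simp: U_def\<close>)
    also have "\<dots> \<le> K * mass g1 Q"
    proof (rule mm[OF _ _ Qi(1)])
      show "{z. x < Re z \<and> s1 < Im z \<and> Im z \<le> s2} \<inter> ball 0 1 \<in> sets lebesgue"
        by (rule lebesgue_borelI) measurable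
    qed (use that r in \<open>auto simp: Q_def U_def\<close>)
    finally show ?thesis .
  qed
  have A: "r / 8 * \<bar>cA - cB\<bar> - 2 * (K * mass g1 Q) \<le> integral S (J x)" if x: "x \<in> U" for x
  proof -
    have 1: "integral S (\<lambda>y. \<bar>cA - v (Complex x (y + 0))\<bar>) \<le> K * mass g1 Q"
      unfolding S_def add_0_right using r by (intro hor x cA) auto
    have "integral S (\<lambda>y. \<bar>cB - v (Complex x (y + 2 * r))\<bar>)
        = integral {r/8 + 2*r..r/4 + 2*r} (\<lambda>y. \<bar>cB - v (Complex x y)\<bar>)"
      unfolding S_def integral_shift_Icc_real[symmetric] by (simp add: o_def add.commute)
    also have "\<dots> \<le> K * mass g1 Q" using r by (intro hor x cB) auto
    finally have 2: "integral S (\<lambda>y. \<bar>cB - v (Complex x (y + 2 * r))\<bar>) \<le> K * mass g1 Q" .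
    have i: "(\<lambda>y. \<bar>c - v (Complex x (y + t))\<bar>) integrable_on S" if "t \<in> {0..2*r}" for c t
      unfolding S_def
      by (intro integrable_continuous_real continuous_intros vy[unfolded S_def] x that)
    have i01: "(\<lambda>y. \<bar>cA - v (Complex x (y + 0))\<bar>) integrable_on S"
      "(\<lambda>y. \<bar>cB - v (Complex x (y + 2 * r))\<bar>) integrable_on S"
      by (rule i; use r in simp)+
    have iJ: "J x integrable_on S" unfolding S_def
      by (intro integrable_continuous_real Jx[unfolded S_def] x)
    have "r / 8 * \<bar>cA - cB\<bar> = integral S (\<lambda>y. \<bar>cA - cB\<bar>)" using r by (simp add: S_def)
    also have "\<dots> \<le> integral S (\<lambda>y. \<bar>cA - v (Complex x (y + 0))\<bar> + J x y + \<bar>cB - v (Complex x (y + 2 * r))\<bar>)"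
    proof (rule integral_le)
      show "(\<lambda>y. \<bar>cA - cB\<bar>) integrable_on S" by (simp add: S_def integrable_const_ivl)
      show "(\<lambda>y. \<bar>cA - v (Complex x (y + 0))\<bar> + J x y + \<bar>cB - v (Complex x (y + 2 * r))\<bar>) integrable_on S"
        by (intro integrable_add i01 iJ)
      show "\<bar>cA - cB\<bar> \<le> \<bar>cA - v (Complex x (y + 0))\<bar> + J x y + \<bar>cB - v (Complex x (y + 2 * r))\<bar>" for y
        unfolding J_def by linarith
    qed
    also have "\<dots> = integral S (\<lambda>y. \<bar>cA - v (Complex x (y + 0))\<bar>) + integral S (J x)
        + integral S (\<lambda>y. \<bar>cB - v (Complex x (y + 2 * r))\<bar>)"
      by (simp only: integral_add[OF integrable_add[OF i01(1) iJ] i01(2)] integral_add[OF i01(1) iJ])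
    finally show ?thesis using 1 2 by linarith
  qed
  have B: "integral U (\<lambda>x. J x y) \<le> K * mass g2 Q" if y: "y \<in> S" for y
  proof -
    have sub: "coord_rect True y (y + 2 * r) (1 - 4 * r) (1 - 3 * r) \<subseteq> ball 0 1"
    proof
      fix z assume "z \<in> coord_rect True y (y + 2 * r) (1 - 4 * r) (1 - 3 * r)"
      then show "z \<in> ball 0 1" using inb[of "Re z" "Im z"] y r by (auto simp: coord_rect_def coord_def U_def S_def)
    qed
    have "integral {1 - 4 * r..1 - 3 * r} (\<lambda>x. \<bar>v (of_coords True (y + 2 * r) x) - v (of_coords True y x)\<bar>)
        \<le> K * mass g2 (coord_hrect True y (y + 2 * r) (1 - 4 * r) (1 - 3 * r))"
      by (rule rel_lip_integral_bound[OF f g2(1) open_ball g2(2) K lip v sub]) (use r in auto)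
    also have "\<dots> \<le> K * mass g2 Q"
    proof (rule mm[OF _ _ Qi(2)])
      have "coord_hrect True y (y + 2 * r) (1 - 4 * r) (1 - 3 * r) \<subseteq> ball 0 1"
        using sub coord_hrect_subset by blast
      then show "coord_hrect True y (y + 2 * r) (1 - 4 * r) (1 - 3 * r) \<subseteq> Q"
        unfolding Q_def using y r by (intro Int_greatest) (force simp: coord_hrect_def coord_def S_def)
    qed simp
    finally show ?thesis by (simp add: U_def J_def of_coords_def)
  qed
  have JcU: "continuous_on (cbox (1 - 4 * r, r / 8) (1 - 3 * r, r / 4)) (\<lambda>(x, y). J x y)"
    using Jc unfolding U_def S_def cbox_Pair_eq by (simp only: cbox_interval)
  \<comment> \<open>The lower bound \<open>A\<close> holds for each fixed \<open>x\<close> and the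
    upper bound \<open>B\<close> for each fixed \<open>y\<close>; exchanging the integrals brings
    them together.\<close>
  have swap: "integral U (\<lambda>x. integral S (J x)) = integral S (\<lambda>y. integral U (\<lambda>x. J x y))"
    using integral_swap_continuous[OF JcU] by (simp add: U_def S_def)
  have i1: "(\<lambda>x. integral S (J x)) integrable_on U"
    using integral_integrable_2dim[OF JcU] by (simp add: U_def S_def)
  have i2: "(\<lambda>y. integral U (\<lambda>x. J x y)) integrable_on S"
  proof -
    have "continuous_on (cbox (r / 8, 1 - 4 * r) (r / 4, 1 - 3 * r)) (\<lambda>(y, x). J x y)"
    proof -
      have "continuous_on (cbox (r / 8, 1 - 4 * r) (r / 4, 1 - 3 * r))
          (\<lambda>q. case (snd q, fst q) of (x, y) \<Rightarrow> J x y)"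
        by (rule continuous_on_compose2[OF JcU]) (intro continuous_intros, auto simp: cbox_Pair_eq)
      then show ?thesis by (simp add: case_prod_unfold)
    qed
    from integral_integrable_2dim[OF this] show ?thesis by (simp add: U_def S_def)
  qed
  have "r * (r / 8 * \<bar>cA - cB\<bar> - 2 * (K * mass g1 Q)) = integral U (\<lambda>x. r / 8 * \<bar>cA - cB\<bar> - 2 * (K * mass g1 Q))"
    using r by (simp add: U_def)
  also have "\<dots> \<le> integral U (\<lambda>x. integral S (J x))"
    by (intro integral_le A i1) (simp add: U_def integrable_const_ivl)
  also have "\<dots> \<le> integral S (\<lambda>y. K * mass g2 Q)"
    unfolding swap by (intro integral_le B i2) (simp_all add: S_def integrable_const_ivl)
  also have "\<dots> = r / 8 * (K * mass g2 Q)" using r by (simp add: S_def)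
  finally show ?thesis by (simp add: algebra_simps)
qed

section \<open>The spiral map\<close>

text \<open>Up to pi/3 the cosine is at least 1/2 and the mean value theorem applies; beyond,
  \<open>x / 2\<close> is at most 4/5, which is below the sine of pi/3.\<close>

lemma sin_ge_half:
  fixes x :: real
  assumes "0 \<le> x" "x \<le> pi / 2"
  shows "x / 2 \<le> sin x"
proof (cases "x \<le> pi / 3")
  case True
  show ?thesis
  proof (cases "x = 0")
    case False
    then have x: "0 < x" using assms by simp
    obtain z where z: "0 < z" "z < x" "sin x - sin 0 = (x - 0) * cos z"
      using MVT2[OF x, of sin cos] by (auto intro: derivative_eq_intros)
    have "cos (pi / 3) \<le> cos z" using z True by (intro cos_monotone_0_pi_le) auto
    then have "x * (1 / 2) \<le> x * cos z" using x by (intro mult_left_mono) (auto simp: cos_60)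
    then show ?thesis using z by simp
  qed simp
next
  case False
  have "x / 2 \<le> 4 / 5" using assms pi_less_4 pi_approx by simp
  also have "4 / 5 \<le> sqrt 3 / 2" by (rule order_trans[OF _ divide_right_mono[OF real_le_rsqrt[of "8/5"]]]) (auto simp: power2_eq_square)
  also have "\<dots> = sin (pi / 3)" by (simp add: sin_60)
  also have "\<dots> \<le> sin x" using False assms by (intro sin_monotone_2pi_le) auto
  finally show ?thesis .
qed

lemma abs_sin_ge_half:
  fixes x :: real
  assumes "\<bar>x\<bar> \<le> pi / 2"
  shows "\<bar>x\<bar> / 2 \<le> \<bar>sin x\<bar>"
  using sin_ge_half[of "\<bar>x\<bar>"] assms by (auto simp: abs_if split: if_splits)

lemma cmod_cis_diff: "cmod (cis x - cis y) = 2 * \<bar>sin ((x - y) / 2)\<bar>"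
proof -
  have "cis x - cis y = cis y * (exp (\<i> * of_real (x - y)) - 1)"
    by (simp add: cis_conv_exp algebra_simps flip: exp_add)
  then show ?thesis by (simp only: norm_mult norm_cis dist_exp_i_1)
qed

lemma cmod_cis_diff_le: "cmod (cis x - cis y) \<le> \<bar>x - y\<bar>"
  using abs_sin_x_le_abs_x[of "(x - y) / 2"] by (simp add: cmod_cis_diff)

text \<open>The derivative at the intermediate point involves a power that is monotone, increasing
  or decreasing with the sign of \<open>a - 1\<close>; bounding it at both ends covers both cases at
  once.\<close>

lemma powr_diff_bound:
  fixes x y a M :: real
  assumes "0 < x" "x \<le> y" "x powr (a - 1) \<le> M" "y powr (a - 1) \<le> M"
  shows "\<bar>y powr a - x powr a\<bar> \<le> \<bar>a\<bar> * M * (y - x)"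
proof (cases "x = y")
  case False
  then have xy: "x < y" using assms by simp
  have "\<exists>z>x. z < y \<and> y powr a - x powr a = (y - x) * (a * z powr (a - 1))"
    using assms(1) by (intro MVT2 xy has_real_derivative_powr) auto
  then obtain z where z: "x < z" "z < y" "y powr a - x powr a = (y - x) * (a * z powr (a - 1))"
    by blast
  have "z powr (a - 1) \<le> M"
  proof (cases "0 \<le> a - 1")
    case True
    then have "z powr (a - 1) \<le> y powr (a - 1)" using z assms(1) by (intro powr_mono2) auto
    then show ?thesis using assms by simp
  next
    case False
    then have "z powr (a - 1) \<le> x powr (a - 1)" using z assms(1) by (intro powr_mono2') auto
    then show ?thesis using assms by simp
  qed
  then have "(y - x) * (\<bar>a\<bar> * z powr (a - 1)) \<le> (y - x) * (\<bar>a\<bar> * M)"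
    using xy by (intro mult_left_mono) auto
  then show ?thesis unfolding z(3) abs_mult using xy by (simp add: mult_ac)
qed simp

lemma cmod_sgn_diff:
  assumes "z \<noteq> 0" "w \<noteq> 0"
  shows "cmod (sgn z - sgn w) \<le> 2 * cmod (z - w) / cmod z"
proof -
  have "sgn z - sgn w = (z - w) / of_real (cmod z) + w * of_real ((cmod w - cmod z) / (cmod z * cmod w))"
    using assms by (simp add: sgn_eq field_simps)
  also have "cmod \<dots> \<le> cmod (z - w) / cmod z + cmod w * (\<bar>cmod w - cmod z\<bar> / (cmod z * cmod w))"
    by (rule order_trans[OF norm_triangle_ineq]) (simp add: norm_divide norm_mult flip: of_real_diff)
  also have "cmod w * (\<bar>cmod w - cmod z\<bar> / (cmod z * cmod w)) = \<bar>cmod w - cmod z\<bar> / cmod z"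
    using assms by simp
  also have "\<dots> \<le> cmod (z - w) / cmod z"
    using norm_triangle_ineq3[of z w] by (intro divide_right_mono) auto
  finally show ?thesis by simp
qed

section \<open>The modulus of continuity of the spiral map\<close>

definition twist :: "real \<Rightarrow> real \<Rightarrow> complex \<Rightarrow> complex" where
  "twist \<beta> \<gamma> z = of_real (cmod z powr \<beta>) * sgn z * cis (cmod z powr (- \<gamma>))"

lemma twist_0 [simp]: "twist \<beta> \<gamma> 0 = 0"
  by (simp add: twist_def)

lemma cmod_twist: "cmod (twist \<beta> \<gamma> z) = cmod z powr \<beta>"
  by (cases "z = 0") (auto simp: twist_def norm_mult norm_sgn)

lemma inj_twist:
  assumes "0 < \<beta>"
  shows "inj (twist \<beta> \<gamma>)"
proof (rule injI)
  fix z w assume eq: "twist \<beta> \<gamma> z = twist \<beta> \<gamma> w"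
  then have "cmod z powr \<beta> = cmod w powr \<beta>" by (metis cmod_twist)
  then have c: "cmod z = cmod w"
    using assms powr_less_mono2[of \<beta> "cmod z" "cmod w"] powr_less_mono2[of \<beta> "cmod w" "cmod z"]
    by (smt (verit) norm_ge_zero)
  show "z = w"
  proof (cases "z = 0")
    case True
    then show ?thesis using c by simp
  next
    case False
    then have "sgn z = sgn w"
      using eq c by (auto simp: twist_def)
    then show ?thesis using c by (metis sgn_eq mult.commute norm_eq_zero of_real_eq_0_iff nonzero_eq_divide_eq False sgn_zero_iff)
  qed
qed

text \<open>Radius, direction and spiral phase are changed one at a time. The phase dominates: its
  derivative is of order \<open>\<rho> powr (- \<gamma> - 1)\<close> and it is multiplied by
  \<open>\<rho> powr \<beta>\<close>. The other two terms carry
  \<open>\<rho> powr (\<beta> - 1)\<close> and are brought to the same power by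
  \<open>\<rho> \<le> 2\<close>. That \<open>w\<close> has at least half the modulus of
  \<open>z\<close> keeps negative powers comparable.\<close>

lemma twist_lipschitz:
  assumes b: "1 \<le> \<beta>" and g: "0 < \<gamma>"
    and z: "z \<noteq> 0" "cmod z \<le> 2" and w: "cmod z / 2 \<le> cmod w" "cmod w \<le> cmod z"
  shows "cmod (twist \<beta> \<gamma> z - twist \<beta> \<gamma> w)
    \<le> ((\<beta> + 2) * 2 powr \<gamma> + \<gamma> * 2 powr (\<gamma> + 1)) * cmod z powr (\<beta> - \<gamma> - 1) * cmod (z - w)"
proof -
  define \<rho> \<rho>' d where "\<rho> = cmod z" and "\<rho>' = cmod w" and "d = cmod (z - w)"
  have \<rho>: "0 < \<rho>" "\<rho> \<le> 2" "\<rho> / 2 \<le> \<rho>'" "\<rho>' \<le> \<rho>" using z w by (auto simp: \<rho>_def \<rho>'_def)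
  then have \<rho>': "0 < \<rho>'" "w \<noteq> 0" by (auto simp: \<rho>'_def)
  have dd: "\<rho> - \<rho>' \<le> d" unfolding \<rho>_def \<rho>'_def d_def by (rule norm_triangle_ineq2)
  have d0: "0 \<le> d" by (simp add: d_def)
  have "\<rho> powr (\<beta> - 1) = \<rho> powr (\<beta> - \<gamma> - 1) * \<rho> powr \<gamma>" by (simp flip: powr_add)
  also have "\<dots> \<le> \<rho> powr (\<beta> - \<gamma> - 1) * 2 powr \<gamma>"
    using \<rho> g by (intro mult_left_mono powr_mono2) auto
  finally have p1: "\<rho> powr (\<beta> - 1) \<le> 2 powr \<gamma> * \<rho> powr (\<beta> - \<gamma> - 1)" by (simp add: mult.commute)
  have t1: "\<bar>\<rho> powr \<beta> - \<rho>' powr \<beta>\<bar> \<le> \<beta> * 2 powr \<gamma> * \<rho> powr (\<beta> - \<gamma> - 1) * d"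
  proof -
    have "\<rho>' powr (\<beta> - 1) \<le> \<rho> powr (\<beta> - 1)" using \<rho> \<rho>' b by (intro powr_mono2) auto
    then have "\<bar>\<rho> powr \<beta> - \<rho>' powr \<beta>\<bar> \<le> \<bar>\<beta>\<bar> * \<rho> powr (\<beta> - 1) * (\<rho> - \<rho>')"
      using \<rho> \<rho>' by (intro powr_diff_bound) auto
    also have "\<dots> \<le> \<beta> * (2 powr \<gamma> * \<rho> powr (\<beta> - \<gamma> - 1)) * d"
      using \<rho> dd d0 b p1 by (intro mult_mono) auto
    finally show ?thesis by (simp add: mult_ac)
  qed
  have t2: "\<rho>' powr \<beta> * cmod (sgn z - sgn w) \<le> 2 * 2 powr \<gamma> * \<rho> powr (\<beta> - \<gamma> - 1) * d"
  proof -
    have "\<rho>' powr \<beta> * cmod (sgn z - sgn w) \<le> \<rho> powr \<beta> * (2 * d / \<rho>)"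
      using cmod_sgn_diff[OF z(1) \<rho>'(2)] \<rho> \<rho>' b by (intro mult_mono powr_mono2) (auto simp: \<rho>_def d_def)
    also have "\<dots> = 2 * (\<rho> powr (\<beta> - 1)) * d" using \<rho> by (simp add: powr_diff)
    also have "\<dots> \<le> 2 * (2 powr \<gamma> * \<rho> powr (\<beta> - \<gamma> - 1)) * d"
      using p1 d0 by (intro mult_left_mono mult_right_mono) auto
    finally show ?thesis by (simp add: mult_ac)
  qed
  have t3: "\<rho>' powr \<beta> * \<bar>\<rho> powr (- \<gamma>) - \<rho>' powr (- \<gamma>)\<bar> \<le> \<gamma> * 2 powr (\<gamma> + 1) * \<rho> powr (\<beta> - \<gamma> - 1) * d"
  proof -
    have e: "(\<rho> / 2) powr (- \<gamma> - 1) = 2 powr (\<gamma> + 1) * \<rho> powr (- \<gamma> - 1)"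
      using \<rho> by (simp add: powr_divide powr_minus[of 2 "\<gamma> + 1", simplified] field_simps flip: powr_add)
    have "\<bar>\<rho> powr (- \<gamma>) - \<rho>' powr (- \<gamma>)\<bar> \<le> \<bar>- \<gamma>\<bar> * (\<rho> / 2) powr (- \<gamma> - 1) * (\<rho> - \<rho>')"
      using \<rho> \<rho>' g by (intro powr_diff_bound powr_mono2') auto
    also have "\<dots> \<le> \<gamma> * (\<rho> / 2) powr (- \<gamma> - 1) * d"
      using g dd \<rho> by (intro mult_mono) auto
    finally have "\<rho>' powr \<beta> * \<bar>\<rho> powr (- \<gamma>) - \<rho>' powr (- \<gamma>)\<bar> \<le> \<rho> powr \<beta> * (\<gamma> * (\<rho> / 2) powr (- \<gamma> - 1) * d)"
      using \<rho> \<rho>' b by (intro mult_mono powr_mono2) auto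
    also have "\<dots> = \<gamma> * 2 powr (\<gamma> + 1) * (\<rho> powr \<beta> * \<rho> powr (- \<gamma> - 1)) * d" unfolding e by simp
    also have "\<rho> powr \<beta> * \<rho> powr (- \<gamma> - 1) = \<rho> powr (\<beta> - \<gamma> - 1)"
      by (simp add: algebra_simps flip: powr_add)
    finally show ?thesis .
  qed
  have "twist \<beta> \<gamma> z - twist \<beta> \<gamma> w = of_real (\<rho> powr \<beta> - \<rho>' powr \<beta>) * sgn z * cis (\<rho> powr (- \<gamma>))
    + of_real (\<rho>' powr \<beta>) * (sgn z - sgn w) * cis (\<rho> powr (- \<gamma>))
    + of_real (\<rho>' powr \<beta>) * sgn w * (cis (\<rho> powr (- \<gamma>)) - cis (\<rho>' powr (- \<gamma>)))"
    by (simp add: twist_def \<rho>_def \<rho>'_def algebra_simps)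
  also have "cmod \<dots> \<le> \<bar>\<rho> powr \<beta> - \<rho>' powr \<beta>\<bar> + \<rho>' powr \<beta> * cmod (sgn z - sgn w)
    + \<rho>' powr \<beta> * cmod (cis (\<rho> powr (- \<gamma>)) - cis (\<rho>' powr (- \<gamma>)))"
    using z(1) \<rho>'(2)
    by (intro norm_triangle_le add_mono) (auto simp: norm_mult norm_sgn simp flip: of_real_diff)
  also have "\<dots> \<le> \<beta> * 2 powr \<gamma> * \<rho> powr (\<beta> - \<gamma> - 1) * d + 2 * 2 powr \<gamma> * \<rho> powr (\<beta> - \<gamma> - 1) * d
    + \<gamma> * 2 powr (\<gamma> + 1) * \<rho> powr (\<beta> - \<gamma> - 1) * d"
    by (intro add_mono t1 t2 order_trans[OF mult_left_mono[OF cmod_cis_diff_le] t3]) auto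
  finally show ?thesis by (simp add: \<rho>_def d_def algebra_simps)
qed

text \<open>The trivial bound of order \<open>\<rho> powr \<beta>\<close> and the local Lipschitz
  bound balance when the distance is of order \<open>\<rho> powr (1 + \<gamma>)\<close>, and that is
  where the exponent \<open>\<beta> / (1 + \<gamma>)\<close> comes from. Each bound is used on its
  own side of this threshold.\<close>

lemma twist_hoelder:
  assumes b: "1 \<le> \<beta>" and g: "0 < \<gamma>" and bg: "\<beta> \<le> \<gamma> + 1"
  obtains C where "0 < C" "\<And>z w. cmod z \<le> 2 \<Longrightarrow> cmod w \<le> 2 \<Longrightarrow>
    cmod (twist \<beta> \<gamma> z - twist \<beta> \<gamma> w) \<le> C * cmod (z - w) powr (\<beta> / (1 + \<gamma>))"
proof -
  define \<sigma> where "\<sigma> = \<beta> / (1 + \<gamma>)"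
  \<comment> \<open>Chosen so that \<open>c * 2 powr \<gamma> = 1 / 2\<close>: below the threshold
    the distance is then less than half of \<rho>, as \<open>twist_lipschitz\<close>
    requires.\<close>
  define c where "c = (2::real) powr (- \<gamma> - 1)"
  define C1 where "C1 = (\<beta> + 2) * 2 powr \<gamma> + \<gamma> * 2 powr (\<gamma> + 1)"
  define C2 where "C2 = 2 * (1 / c) powr \<sigma>"
  have \<sigma>: "0 < \<sigma>" "\<sigma> \<le> 1" "(1 + \<gamma>) * \<sigma> = \<beta>"
    using b g bg by (auto simp: \<sigma>_def field_simps)
  have c: "0 < c" "c \<le> 1"
    using powr_mono[of "- \<gamma> - 1" 0 "2::real"] g by (auto simp: c_def)
  have C1: "0 < C1" using b g by (auto simp: C1_def intro!: add_pos_pos)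
  have C2: "0 < C2" using c by (auto simp: C2_def)
  have main: "cmod (twist \<beta> \<gamma> z - twist \<beta> \<gamma> w) \<le> (C1 + C2) * cmod (z - w) powr \<sigma>"
    if zw: "cmod w \<le> cmod z" "cmod z \<le> 2" for z w
  proof (cases "z = w")
    case False
    define \<rho> d where "\<rho> = cmod z" and "d = cmod (z - w)"
    have d: "0 < d" using False by (simp add: d_def)
    have z0: "z \<noteq> 0" using zw False by auto
    then have \<rho>: "0 < \<rho>" "\<rho> \<le> 2" using zw by (auto simp: \<rho>_def)
    show ?thesis
    proof (cases "c * \<rho> powr (1 + \<gamma>) \<le> d")
      case True
      have "cmod (twist \<beta> \<gamma> z - twist \<beta> \<gamma> w) \<le> cmod z powr \<beta> + cmod w powr \<beta>"
        by (rule order_trans[OF norm_triangle_ineq4]) (simp add: cmod_twist)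
      also have "\<dots> \<le> 2 * \<rho> powr \<beta>"
        using zw b powr_mono2[of \<beta> "cmod w" "cmod z"] by (simp add: \<rho>_def)
      also have "\<rho> powr \<beta> = (\<rho> powr (1 + \<gamma>)) powr \<sigma>" by (simp add: powr_powr \<sigma>)
      also have "2 * \<dots> \<le> 2 * (d / c) powr \<sigma>"
        using True \<sigma> c by (intro mult_left_mono powr_mono2) (auto simp: field_simps)
      also have "\<dots> = C2 * d powr \<sigma>"
        using c d by (simp add: C2_def powr_divide)
      also have "\<dots> \<le> (C1 + C2) * d powr \<sigma>" using C1 by (intro mult_right_mono) auto
      finally show ?thesis by (simp add: d_def)
    next
      case False
      then have dlt: "d < c * \<rho> powr (1 + \<gamma>)" by simp
      also have "c * \<rho> powr (1 + \<gamma>) = \<rho> * (c * \<rho> powr \<gamma>)" using \<rho> by (simp add: powr_add)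
      also have "c * \<rho> powr \<gamma> \<le> c * 2 powr \<gamma>" using \<rho> g c by (intro mult_left_mono powr_mono2) auto
      also have "c * 2 powr \<gamma> = 1 / 2" by (simp add: c_def flip: powr_add)
      finally have "d < \<rho> / 2" using \<rho> by simp
      then have w: "cmod z / 2 \<le> cmod w"
        using norm_triangle_ineq2[of z w] by (simp add: d_def \<rho>_def)
      have "cmod (twist \<beta> \<gamma> z - twist \<beta> \<gamma> w) \<le> C1 * \<rho> powr (\<beta> - \<gamma> - 1) * d"
        unfolding C1_def \<rho>_def d_def by (rule twist_lipschitz[OF b g z0 zw(2) w zw(1)])
      \<comment> \<open>The factor \<open>d powr (1 - \<sigma>)\<close> is at most
        \<open>\<rho> powr (1 + \<gamma> - \<beta>)\<close> and cancels the negative power of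
        \<rho>.\<close>
      also have "d = d powr (1 - \<sigma>) * d powr \<sigma>" using d by (simp flip: powr_add)
      also have "C1 * \<rho> powr (\<beta> - \<gamma> - 1) * \<dots> = C1 * (\<rho> powr (\<beta> - \<gamma> - 1) * d powr (1 - \<sigma>)) * d powr \<sigma>"
        by simp
      also have "\<dots> \<le> C1 * 1 * d powr \<sigma>"
      proof -
        have "d powr (1 - \<sigma>) \<le> (\<rho> powr (1 + \<gamma>)) powr (1 - \<sigma>)"
        proof (rule powr_mono2)
          have "c * \<rho> powr (1 + \<gamma>) \<le> 1 * \<rho> powr (1 + \<gamma>)" using c by (intro mult_right_mono) auto
          then show "d \<le> \<rho> powr (1 + \<gamma>)" using dlt by simp
        qed (use \<sigma> d in auto)
        also have "\<dots> = \<rho> powr (1 + \<gamma> - \<beta>)" using \<sigma> by (simp add: powr_powr right_diff_distrib)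
        finally have "\<rho> powr (\<beta> - \<gamma> - 1) * d powr (1 - \<sigma>) \<le> \<rho> powr (\<beta> - \<gamma> - 1) * \<rho> powr (1 + \<gamma> - \<beta>)"
          by (intro mult_left_mono) auto
        also have "\<dots> = 1" using \<rho> by (simp flip: powr_add)
        finally show ?thesis using C1 by (intro mult_right_mono mult_left_mono) auto
      qed
      also have "\<dots> \<le> (C1 + C2) * d powr \<sigma>" using C2 by (intro mult_right_mono) auto
      finally show ?thesis by (simp add: d_def)
    qed
  qed simp
  show thesis
  proof (rule that[of "C1 + C2"])
    show "0 < C1 + C2" using C1 C2 by simp
    fix z w assume "cmod z \<le> 2" "cmod w \<le> 2"
    then show "cmod (twist \<beta> \<gamma> z - twist \<beta> \<gamma> w) \<le> (C1 + C2) * cmod (z - w) powr (\<beta> / (1 + \<gamma>))"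
      using main[of w z] main[of z w] unfolding \<sigma>_def
      by (cases "cmod w \<le> cmod z") (auto simp: norm_minus_commute)
  qed
qed

lemma continuous_on_twist:
  assumes "1 \<le> \<beta>" "0 < \<gamma>" "\<beta> \<le> \<gamma> + 1"
  shows "continuous_on (cball 0 2) (twist \<beta> \<gamma>)"
proof -
  obtain C where C: "0 < C" "\<And>z w. cmod z \<le> 2 \<Longrightarrow> cmod w \<le> 2 \<Longrightarrow>
    cmod (twist \<beta> \<gamma> z - twist \<beta> \<gamma> w) \<le> C * cmod (z - w) powr (\<beta> / (1 + \<gamma>))"
    using twist_hoelder[OF assms] by blast
  show ?thesis
    unfolding continuous_on_def
  proof
    fix w :: complex assume w: "w \<in> cball 0 2"
    have "((\<lambda>z. C * cmod (z - w) powr (\<beta> / (1 + \<gamma>))) \<longlongrightarrow> C * cmod (w - w) powr (\<beta> / (1 + \<gamma>))) (at w within cball 0 2)"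
      using assms by (intro tendsto_intros) auto
    then have "((\<lambda>z. C * cmod (z - w) powr (\<beta> / (1 + \<gamma>))) \<longlongrightarrow> 0) (at w within cball 0 2)" by simp
    then have "((\<lambda>z. twist \<beta> \<gamma> z - twist \<beta> \<gamma> w) \<longlongrightarrow> 0) (at w within cball 0 2)"
      by (rule Lim_null_comparison[rotated]) (use C(2) w in \<open>auto simp: eventually_at_filter\<close>)
    then show "(twist \<beta> \<gamma> \<longlongrightarrow> twist \<beta> \<gamma> w) (at w within cball 0 2)"
      by (simp add: LIM_zero_iff)
  qed
qed

section \<open>The double integral\<close>

lemma nn_integral_powr_finite:
  fixes a c :: real
  assumes "a < 1" "0 \<le> c"
  shows "(\<integral>\<^sup>+x. ennreal (x powr (- a)) * indicator {0..c} x \<partial>lborel) < \<infinity>"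
proof -
  have "(\<lambda>x. x powr (- a)) integrable_on {0..c}"
    using assms by (intro integrable_on_powr_from_0) auto
  then obtain I where I: "((\<lambda>x. x powr (- a)) has_integral I) {0..c}" by blast
  show ?thesis by (subst nn_integral_has_integral_lebesgue'[OF _ I]) auto
qed

text \<open>The kernel is singular at -2 pi, 0 and 2 pi. By \<open>sin_ge_half\<close> it is
  dominated by four reflected or translated copies of a one-sided power \<kappa>, two for the
  singularity at 0 and one for each end; each has the same finite integral.\<close>

lemma nn_integral_sin_kernel_finite:
  fixes a :: real
  assumes a: "0 < a" "a < 1"
  shows "(\<integral>\<^sup>+u. ennreal ((2 * \<bar>sin (u / 2)\<bar>) powr (- a)) * indicator {-2*pi..2*pi} u \<partial>lborel) < \<infinity>"
proof -
  define k where "k u = ennreal ((2 * \<bar>sin (u / 2)\<bar>) powr (- a))" for u :: real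
  define \<kappa> where "\<kappa> u = ennreal (2 powr a) * (ennreal (u powr (- a)) * indicator {0..2*pi} u)" for u :: real
  have [measurable]: "k \<in> borel_measurable borel" "\<kappa> \<in> borel_measurable borel"
    unfolding k_def \<kappa>_def by measurable
  have \<kappa>: "(\<integral>\<^sup>+u. \<kappa> u \<partial>lborel) < \<infinity>"
    unfolding \<kappa>_def using nn_integral_powr_finite[of a "2 * pi"] a
    by (subst nn_integral_cmult) (auto simp: ennreal_mult_less_top)
  have 1: "k u \<le> \<kappa> u + \<kappa> (2 * pi - u)" if u: "u \<in> {0..2*pi}" for u
  proof (cases "u = 0 \<or> u = 2 * pi")
    \<comment> \<open>At the singular points themselves the sine vanishes, and \<open>powr\<close>
      with base 0 has value 0.\<close>
    case True
    then show ?thesis by (auto simp: k_def)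
  next
    case False
    then have u': "0 < u" "u < 2 * pi" using u by auto
    define m where "m = min u (2 * pi - u)"
    have m: "0 < m" using u' by (simp add: m_def)
    have "m / 2 \<le> 2 * \<bar>sin (u / 2)\<bar>"
    proof (cases "u \<le> pi")
      case True
      then show ?thesis using sin_ge_half[of "u / 2"] u' by (simp add: m_def)
    next
      case False
      have "sin (pi - u / 2) = sin (u / 2)" by simp
      then show ?thesis using sin_ge_half[of "pi - u / 2"] u' False by (simp add: m_def)
    qed
    then have "(2 * \<bar>sin (u / 2)\<bar>) powr (- a) \<le> (m / 2) powr (- a)"
      using a m by (intro powr_mono2') auto
    also have "\<dots> = 2 powr a * m powr (- a)"
      using m by (simp add: powr_divide powr_minus field_simps)
    also have "m powr (- a) \<le> u powr (- a) + (2 * pi - u) powr (- a)"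
      by (auto simp: m_def min_def)
    finally have "(2 * \<bar>sin (u / 2)\<bar>) powr (- a) \<le> 2 powr a * (u powr (- a) + (2 * pi - u) powr (- a))"
      by (simp add: mult_left_mono)
    then show ?thesis
      using u u' unfolding k_def \<kappa>_def
      by (simp add: ennreal_leI flip: ennreal_mult ennreal_plus distrib_left)
  qed
  have "k u * indicator {-2*pi..2*pi} u
      \<le> (\<kappa> u + \<kappa> (2 * pi + (-1) * u)) + (\<kappa> (0 + (-1) * u) + \<kappa> (2 * pi + 1 * u))" for u
  proof (cases "0 \<le> u")
    case True
    then show ?thesis using 1[of u] by (auto simp: indicator_def intro: add_increasing2)
  next
    case False
    have "k (- u) = k u" by (simp add: k_def)
    then show ?thesis using 1[of "- u"] False by (auto simp: indicator_def intro: add_increasing)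
  qed
  then have "(\<integral>\<^sup>+u. k u * indicator {-2*pi..2*pi} u \<partial>lborel)
    \<le> (\<integral>\<^sup>+u. (\<kappa> u + \<kappa> (2 * pi + (-1) * u)) + (\<kappa> (0 + (-1) * u) + \<kappa> (2 * pi + 1 * u)) \<partial>lborel)"
    by (intro nn_integral_mono)
  also have "\<dots> = ((\<integral>\<^sup>+u. \<kappa> u \<partial>lborel) + (\<integral>\<^sup>+u. \<kappa> (2 * pi + (-1) * u) \<partial>lborel))
      + ((\<integral>\<^sup>+u. \<kappa> (0 + (-1) * u) \<partial>lborel) + (\<integral>\<^sup>+u. \<kappa> (2 * pi + 1 * u) \<partial>lborel))"
    by (simp add: nn_integral_add)
  also have "\<dots> = ((\<integral>\<^sup>+u. \<kappa> u \<partial>lborel) + (\<integral>\<^sup>+u. \<kappa> u \<partial>lborel)) + ((\<integral>\<^sup>+u. \<kappa> u \<partial>lborel) + (\<integral>\<^sup>+u. \<kappa> u \<partial>lborel))"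
    using nn_integral_real_affine[of \<kappa> "-1" "2 * pi"] nn_integral_real_affine[of \<kappa> "-1" 0]
      nn_integral_real_affine[of \<kappa> 1 "2 * pi"] by simp
  also have "\<dots> < \<infinity>" using \<kappa> by simp
  finally show ?thesis unfolding k_def .
qed

text \<open>The Hoelder bound leaves a kernel in the chord length to the power -(1 - \<sigma>) p,
  which depends on \<open>s - t\<close> only and is integrable as the exponent stays above -1.
  Extending the inner integral to the whole line makes it the same constant for every
  \<open>s\<close>.\<close>

lemma hoelder_double_integral_finite:
  fixes \<phi> :: "complex \<Rightarrow> complex"
  assumes p: "0 < p" and C: "0 < C"
    and h: "\<And>z w. z \<in> sphere 0 1 \<Longrightarrow> w \<in> sphere 0 1 \<Longrightarrow> cmod (\<phi> z - \<phi> w) \<le> C * cmod (z - w) powr \<sigma>"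
    and \<sigma>: "\<sigma> < 1" "(1 - \<sigma>) * p < 1"
  shows "(\<integral>\<^sup>+ s \<in> {0..2*pi}. (\<integral>\<^sup>+ t \<in> {0..2*pi}.
        ennreal ((cmod (\<phi> (cis s) - \<phi> (cis t)) / cmod (cis s - cis t)) powr p) \<partial>lborel) \<partial>lborel) < \<infinity>"
proof -
  define a where "a = (1 - \<sigma>) * p"
  have a: "0 < a" "a < 1" using \<sigma> p by (auto simp: a_def)
  define k where "k u = ennreal ((2 * \<bar>sin (u / 2)\<bar>) powr (- a)) * indicator {-2*pi..2*pi} u" for u :: real
  have km [measurable]: "k \<in> borel_measurable borel" unfolding k_def by measurable
  define I where "I = (\<integral>\<^sup>+u. k u \<partial>lborel)"
  have I: "I < \<infinity>" unfolding I_def k_def by (rule nn_integral_sin_kernel_finite[OF a])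
  have pointwise: "ennreal ((cmod (\<phi> (cis s) - \<phi> (cis t)) / cmod (cis s - cis t)) powr p) * indicator {0..2*pi} t
      \<le> ennreal (C powr p) * k (s + (-1) * t)" if s: "s \<in> {0..2*pi}" for s t
  proof (cases "t \<in> {0..2*pi}")
    case True
    define d where "d = cmod (cis s - cis t)"
    have "(cmod (\<phi> (cis s) - \<phi> (cis t)) / d) powr p \<le> C powr p * d powr (- a)"
    \<comment> \<open>On the diagonal the quotient is 0 by division by zero.\<close>
    proof (cases "d = 0")
      case False
      then have d: "0 < d" by (simp add: d_def)
      have "cmod (\<phi> (cis s) - \<phi> (cis t)) / d \<le> C * d powr \<sigma> / d"
        using h[of "cis s" "cis t"] d by (intro divide_right_mono) (auto simp: d_def)
      also have "\<dots> = C * d powr (\<sigma> - 1)" using d by (simp add: powr_diff)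
      finally have "(cmod (\<phi> (cis s) - \<phi> (cis t)) / d) powr p \<le> (C * d powr (\<sigma> - 1)) powr p"
        using p d by (intro powr_mono2) auto
      also have "\<dots> = C powr p * d powr (- a)"
        using C d by (simp add: powr_mult powr_powr a_def algebra_simps)
      finally show ?thesis .
    qed simp
    moreover have "d = 2 * \<bar>sin ((s - t) / 2)\<bar>" by (simp add: d_def cmod_cis_diff)
    moreover have "s - t \<in> {-2*pi..2*pi}" using s True by auto
    ultimately show ?thesis
      using True C by (simp add: k_def d_def ennreal_leI flip: ennreal_mult)
  qed simp
  have inner: "(\<integral>\<^sup>+ t \<in> {0..2*pi}. ennreal ((cmod (\<phi> (cis s) - \<phi> (cis t)) / cmod (cis s - cis t)) powr p) \<partial>lborel)
      \<le> ennreal (C powr p) * I" if s: "s \<in> {0..2*pi}" for s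
  proof -
    have "(\<integral>\<^sup>+ t \<in> {0..2*pi}. ennreal ((cmod (\<phi> (cis s) - \<phi> (cis t)) / cmod (cis s - cis t)) powr p) \<partial>lborel)
      \<le> (\<integral>\<^sup>+ t. ennreal (C powr p) * k (s + (-1) * t) \<partial>lborel)"
      by (intro nn_integral_mono pointwise s)
    also have "\<dots> = ennreal (C powr p) * (\<integral>\<^sup>+ t. k (s + (-1) * t) \<partial>lborel)"
      by (intro nn_integral_cmult) measurable
    also have "(\<integral>\<^sup>+ t. k (s + (-1) * t) \<partial>lborel) = I"
      unfolding I_def using nn_integral_real_affine[OF km, of "-1" s] by simp
    finally show ?thesis .
  qed
  have "(\<integral>\<^sup>+ s \<in> {0..2*pi}. (\<integral>\<^sup>+ t \<in> {0..2*pi}.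
        ennreal ((cmod (\<phi> (cis s) - \<phi> (cis t)) / cmod (cis s - cis t)) powr p) \<partial>lborel) \<partial>lborel)
    \<le> (\<integral>\<^sup>+ s. ennreal (C powr p) * I * indicator {0..2*pi} s \<partial>lborel)"
  proof (rule nn_integral_mono)
    fix s
    show "(\<integral>\<^sup>+ t \<in> {0..2*pi}. ennreal ((cmod (\<phi> (cis s) - \<phi> (cis t)) / cmod (cis s - cis t)) powr p) \<partial>lborel)
        * indicator {0..2*pi} s \<le> ennreal (C powr p) * I * indicator {0..2*pi} s"
      using inner[of s] by (cases "s \<in> {0..2*pi}") simp_all
  qed
  also have "\<dots> = ennreal (C powr p) * I * ennreal (2 * pi)"
    by (subst nn_integral_cmult_indicator) auto
  also have "\<dots> < \<infinity>" using I by (simp add: ennreal_mult_less_top)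
  finally show ?thesis .
qed

section \<open>The boundary curve\<close>

lemma simple_path_unit_circle: "simple_path (\<lambda>t. cis (2 * pi * t))"
  unfolding simple_path_def loop_free_def
proof (intro conjI ballI impI)
  show "path (\<lambda>t. cis (2 * pi * t))"
    unfolding path_def by (intro continuous_intros)
  fix x y :: real assume xy: "x \<in> {0..1}" "y \<in> {0..1}" "cis (2 * pi * x) = cis (2 * pi * y)"
  then have "sin ((2 * pi * x - 2 * pi * y) / 2) = 0"
    using cmod_cis_diff[of "2 * pi * x" "2 * pi * y"] by simp
  then obtain i :: int where "(2 * pi * x - 2 * pi * y) / 2 = of_int i * pi"
    unfolding sin_zero_iff_int2 by blast
  then have "pi * (x - y) = pi * of_int i" by (simp add: algebra_simps)
  then have i: "x - y = of_int i" by simp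
  moreover have "- 1 \<le> x - y" "x - y \<le> 1" using xy by auto
  ultimately have "- 1 \<le> i" "i \<le> 1" by linarith+
  then have "i = -1 \<or> i = 0 \<or> i = 1" by linarith
  then show "x = y \<or> x = 0 \<and> y = 1 \<or> x = 1 \<and> y = 0" using i xy by auto
qed

lemma path_image_unit_circle: "path_image (\<lambda>t. cis (2 * pi * t)) = sphere 0 1"
proof
  show "sphere 0 1 \<subseteq> path_image (\<lambda>t. cis (2 * pi * t))"
  proof
    fix z :: complex assume "z \<in> sphere 0 1"
    then have "z = cis (2 * pi * (Arg2pi z / (2 * pi)))"
      using Arg2pi_eq[of z] by (simp add: cis_conv_exp)
    moreover have "Arg2pi z / (2 * pi) \<in> {0..1}"
      using Arg2pi_ge_0[of z] Arg2pi_lt_2pi[of z] by (simp add: field_simps)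
    ultimately show "z \<in> path_image (\<lambda>t. cis (2 * pi * t))"
      unfolding path_image_def by blast
  qed
qed (auto simp: path_image_def)

text \<open>The image \<open>B\<close> of the open disk is open by invariance of domain, connected
  and disjoint from the curve, so it lies in one of the two Jordan components. It fills that
  component because \<open>B\<close> together with the curve is compact, and the component is
  bounded, so it is the inside.\<close>

lemma inside_jordan_image:
  fixes f :: "complex \<Rightarrow> complex"
  assumes r: "0 < r" and f: "continuous_on (cball a r) f" "inj_on f (cball a r)"
    and g: "simple_path g" "pathfinish g = pathstart g" "path_image g = f ` sphere a r"
  shows "inside (path_image g) = f ` ball a r"
proof -
  let ?C = "path_image g" and ?B = "f ` ball a r"
  note J = Jordan_inside_outside[OF g(1,2)]
  have oB: "open ?B" by (rule invariance_of_domain_ball[OF f(1) r f(2)])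
  have cB: "connected ?B"
    by (intro connected_continuous_image continuous_on_subset[OF f(1)]) auto
  have disj: "?B \<inter> ?C = {}"
  proof -
    have "?B \<inter> ?C = f ` (ball a r \<inter> sphere a r)"
      unfolding g(3) using inj_on_image_Int[OF f(2)] by auto
    also have "ball a r \<inter> sphere a r = {}" by auto
    finally show ?thesis by simp
  qed
  have comp: "compact (f ` cball a r)"
    by (intro compact_continuous_image f) simp
  have Un: "f ` cball a r = ?B \<union> ?C"
  proof -
    have "cball a r = ball a r \<union> sphere a r" by auto
    then show ?thesis unfolding g(3) by (simp only: image_Un)
  qed
  have bB: "bounded ?B" using compact_imp_bounded[OF comp] by (rule bounded_subset) (auto simp: Un)
  have ne: "?B \<noteq> {}" using r by auto
  \<comment> \<open>Off the curve, \<open>B\<close> and the complement of the closed disk's image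
    are two disjoint open sets; a connected \<open>X\<close> that meets the first cannot meet the
    second.\<close>
  have eq: "X = ?B" if X: "connected X" "X \<inter> ?C = {}" "?B \<subseteq> X" for X
  proof (rule ccontr)
    assume "X \<noteq> ?B"
    have "X \<subseteq> ?B \<union> - (f ` cball a r)" using X by (auto simp: Un)
    moreover have "open (- (f ` cball a r))" using comp by (simp add: compact_imp_closed open_Compl)
    moreover have "?B \<inter> - (f ` cball a r) \<inter> X = {}" by (auto simp: Un)
    moreover have "?B \<inter> X \<noteq> {}" using ne X(3) by blast
    moreover have "- (f ` cball a r) \<inter> X \<noteq> {}" using \<open>X \<noteq> ?B\<close> X(2,3) unfolding Un by blast
    ultimately show False using connectedD[OF X(1) oB] by blast
  qed
  have sub: "?B \<subseteq> inside ?C \<union> outside ?C"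
    using disj by (simp add: inside_Un_outside disjoint_eq_subset_Compl)
  have "inside ?C \<inter> ?B = {} \<or> outside ?C \<inter> ?B = {}"
    using J by (intro connectedD[OF cB _ _ _ sub]) auto
  then have "?B \<subseteq> inside ?C \<or> ?B \<subseteq> outside ?C"
    using sub by blast
  then show ?thesis
  proof
    assume "?B \<subseteq> inside ?C"
    with J show ?thesis by (intro eq) (simp_all add: inside_no_overlap)
  next
    assume "?B \<subseteq> outside ?C"
    with J have "outside ?C = ?B" by (intro eq) (simp_all add: outside_no_overlap)
    then show ?thesis using J bB by simp
  qed
qed

lemma one_minus_cis: "1 - cis (2 * x) = of_real (2 * sin x) * (- \<i> * cis x)"
proof -
  have "1 - cos (2 * x) = 2 * (sin x * sin x)" using cos_double_sin[of x] by (simp add: power2_eq_square)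
  then show ?thesis by (simp add: complex_eq_iff sin_double)
qed

text \<open>The point \<open>1 - cis (2 * pi * t)\<close> has modulus
  \<open>2 * sin (pi * t)\<close> and argument \<open>pi * t - pi / 2\<close>. This polar form can
  be differentiated on the open parameter interval.\<close>

lemma twist_circle:
  assumes "0 \<le> t" "t \<le> 1"
  shows "twist \<beta> \<gamma> (1 - cis (2 * pi * t)) =
    - \<i> * (of_real ((2 * sin (pi * t)) powr \<beta>) * cis (pi * t + (2 * sin (pi * t)) powr (- \<gamma>)))"
proof -
  define \<rho> where "\<rho> = 2 * sin (pi * t)"
  have "0 \<le> \<rho>" unfolding \<rho>_def using assms sin_ge_zero[of "pi * t"] by (simp add: mult_left_le)
  have z: "1 - cis (2 * pi * t) = of_real \<rho> * (- \<i> * cis (pi * t))"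
    using one_minus_cis[of "pi * t"] by (simp add: \<rho>_def mult.assoc)
  show ?thesis
  proof (cases "\<rho> = 0")
    case True
    then show ?thesis by (simp add: z flip: \<rho>_def)
  next
    case False
    then have "0 < \<rho>" using \<open>0 \<le> \<rho>\<close> by simp
    then have "cmod (1 - cis (2 * pi * t)) = \<rho>" "sgn (1 - cis (2 * pi * t)) = - \<i> * cis (pi * t)"
      unfolding z by (simp_all add: norm_mult sgn_eq)
    then show ?thesis by (simp add: twist_def cis_mult flip: \<rho>_def)
  qed
qed

text \<open>At both ends of the parameter interval the speed may blow up, but no worse than the
  distance to the end to the power \<delta> - 1, which is integrable. The mean value inequality
  needs derivatives only in the interior and continuity at the ends, so the increments of the curve
  are bounded by those of \<open>H\<close>, and these telescope.\<close>

lemma rectifiable_twist_circle: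
  assumes b: "1 \<le> \<beta>" and g: "0 < \<gamma>" and bg: "\<gamma> < \<beta>" "\<beta> < \<gamma> + 1"
  shows "rectifiable_path (\<lambda>t. twist \<beta> \<gamma> (1 - cis (2 * pi * t)))"
proof -
  define G where "G t = twist \<beta> \<gamma> (1 - cis (2 * pi * t))" for t
  define \<delta> where "\<delta> = \<beta> - \<gamma>"
  have \<delta>: "0 < \<delta>" "\<delta> < 1" using bg by (auto simp: \<delta>_def)
  define \<rho> where "\<rho> t = 2 * sin (pi * t)" for t
  \<comment> \<open>The three summands bound the contributions of the changing radius, of the angle
    \<open>pi * t\<close> and of the spiral phase, in this order.\<close>
  define C where "C = 2 * pi * \<beta> * 2 powr \<gamma> + (pi * 2 powr (\<gamma> + 1) + 2 * pi * \<gamma>)"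
  \<comment> \<open>an increasing function whose derivative dominates the speed of the curve\<close>
  define H where "H t = C / \<delta> * (t powr \<delta> - (1 - t) powr \<delta>)" for t
  have C: "0 < C" using b g by (auto simp: C_def intro!: add_pos_pos)
  have Gc: "continuous_on {0..1} G"
    unfolding G_def
  proof (rule continuous_on_compose2[OF continuous_on_twist[of \<beta> \<gamma>]])
    show "(\<lambda>t. 1 - cis (2 * pi * t)) ` {0..1} \<subseteq> cball 0 2"
      using norm_triangle_ineq4[of 1 "cis _"] by (fastforce simp: dist_norm norm_minus_commute)
  qed (use b g bg in \<open>auto intro!: continuous_intros\<close>)
  have Hc: "continuous_on {0..1} H"
    unfolding H_def using \<delta> by (intro continuous_on_mult continuous_on_diff continuous_on_powr' continuous_on_const continuous_on_id) auto
  define G' where "G' t = - \<i> * (of_real ((\<rho> t) powr \<beta>) * (of_real (pi + (- \<gamma> * \<rho> t powr (- \<gamma> - 1)) * (2 * (pi * cos (pi * t)))) *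
      (\<i> * cis (pi * t + \<rho> t powr (- \<gamma>)))) + of_real (\<beta> * \<rho> t powr (\<beta> - 1) * (2 * (pi * cos (pi * t)))) * cis (pi * t + \<rho> t powr (- \<gamma>)))" for t
  have \<rho>: "t \<le> \<rho> t \<or> 1 - t \<le> \<rho> t" "0 < \<rho> t" "\<rho> t \<le> 2" if t: "0 < t" "t < 1" for t
  proof -
    show 0: "0 < \<rho> t" unfolding \<rho>_def using t sin_gt_zero[of "pi * t"] by simp
    show "\<rho> t \<le> 2" by (simp add: \<rho>_def)
    show "t \<le> \<rho> t \<or> 1 - t \<le> \<rho> t"
    proof (cases "t \<le> 1 / 2")
      case True
      have "pi * t / 2 \<le> sin (pi * t)" using True t by (intro sin_ge_half) auto
      moreover have "1 * t \<le> pi * t" using t pi_gt3 by (intro mult_right_mono) auto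
      ultimately show ?thesis by (simp add: \<rho>_def)
    next
      case False
      have "pi * (1 - t) / 2 \<le> sin (pi * (1 - t))" using False t by (intro sin_ge_half) auto
      moreover have "1 * (1 - t) \<le> pi * (1 - t)" using t pi_gt3 by (intro mult_right_mono) auto
      moreover have "sin (pi * (1 - t)) = sin (pi * t)" by (simp add: right_diff_distrib)
      ultimately show ?thesis by (simp add: \<rho>_def)
    qed
  qed
  have dG: "(G has_vector_derivative G' t) (at t)" if t: "0 < t" "t < 1" for t
  proof -
    have d\<rho>: "(\<rho> has_real_derivative 2 * (pi * cos (pi * t))) (at t)"
      unfolding \<rho>_def by (auto intro!: derivative_eq_intros)
    have dp: "((\<lambda>t. \<rho> t powr e) has_real_derivative e * \<rho> t powr (e - 1) * (2 * (pi * cos (pi * t)))) (at t)" for e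
      using DERIV_chain2[OF has_real_derivative_powr[OF \<rho>(2)[OF t], of e] d\<rho>] .
    have "((\<lambda>t. pi * t + \<rho> t powr (- \<gamma>)) has_real_derivative
        pi + (- \<gamma> * \<rho> t powr (- \<gamma> - 1)) * (2 * (pi * cos (pi * t)))) (at t)"
      by (intro DERIV_add dp) (auto intro!: derivative_eq_intros)
    then have "((\<lambda>t. \<i> * of_real (pi * t + \<rho> t powr (- \<gamma>))) has_vector_derivative
        \<i> * of_real (pi + (- \<gamma> * \<rho> t powr (- \<gamma> - 1)) * (2 * (pi * cos (pi * t))))) (at t)"
      by (intro has_vector_derivative_mult_right has_vector_derivative_of_real)
         (simp add: has_real_derivative_iff_has_vector_derivative)
    from field_vector_diff_chain_at[OF this DERIV_exp]
    have dcis: "((\<lambda>t. cis (pi * t + \<rho> t powr (- \<gamma>))) has_vector_derivative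
        of_real (pi + (- \<gamma> * \<rho> t powr (- \<gamma> - 1)) * (2 * (pi * cos (pi * t)))) * (\<i> * cis (pi * t + \<rho> t powr (- \<gamma>)))) (at t)"
      by (simp add: o_def cis_conv_exp mult_ac)
    have "((\<lambda>t. complex_of_real (\<rho> t powr \<beta>)) has_vector_derivative
        of_real (\<beta> * \<rho> t powr (\<beta> - 1) * (2 * (pi * cos (pi * t))))) (at t)"
      using dp[of \<beta>] by (intro has_vector_derivative_of_real)
         (simp add: has_real_derivative_iff_has_vector_derivative)
    then have "((\<lambda>t. - \<i> * (of_real (\<rho> t powr \<beta>) * cis (pi * t + \<rho> t powr (- \<gamma>)))) has_vector_derivative G' t) (at t)"
      unfolding G'_def by (intro has_vector_derivative_mult_right has_vector_derivative_mult dcis)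
    then show ?thesis
    proof (rule has_vector_derivative_transform_within_open[of _ _ _ "{0<..<1}"])
      show "- \<i> * (of_real (\<rho> t powr \<beta>) * cis (pi * t + \<rho> t powr (- \<gamma>))) = G t" if "t \<in> {0<..<1}" for t
        using that twist_circle[of t \<beta> \<gamma>] by (simp add: G_def \<rho>_def)
    qed (use t in auto)
  qed
  have dH: "(H has_vector_derivative C * (t powr (\<delta> - 1) + (1 - t) powr (\<delta> - 1))) (at t)"
    if t: "0 < t" "t < 1" for t
  proof -
    have "(H has_real_derivative C / \<delta> * (\<delta> * t powr (\<delta> - 1) - \<delta> * (1 - t) powr (\<delta> - 1) * (0 - 1))) (at t)"
      unfolding H_def using t
      by (intro DERIV_cmult DERIV_diff has_real_derivative_powr DERIV_chain2[OF has_real_derivative_powr] DERIV_const DERIV_ident) auto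
    also have "C / \<delta> * (\<delta> * t powr (\<delta> - 1) - \<delta> * (1 - t) powr (\<delta> - 1) * (0 - 1))
        = C * (t powr (\<delta> - 1) + (1 - t) powr (\<delta> - 1))"
      using \<delta> by (simp add: divide_simps) (simp add: algebra_simps)
    finally show ?thesis by (simp only: has_real_derivative_iff_has_vector_derivative)
  qed
  have G'b: "cmod (G' t) \<le> C * (t powr (\<delta> - 1) + (1 - t) powr (\<delta> - 1))" if t: "0 < t" "t < 1" for t
  proof -
    define r where "r = \<rho> t"
    have r: "0 < r" "r \<le> 2" "t \<le> r \<or> 1 - t \<le> r" using \<rho>[OF t] by (auto simp: r_def)
    have c: "\<bar>2 * (pi * cos (pi * t))\<bar> \<le> 2 * pi" by (simp add: abs_mult)
    have p1: "r powr (\<beta> - 1) \<le> 2 powr \<gamma> * r powr (\<delta> - 1)"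
    proof -
      have "r powr (\<beta> - 1) = r powr \<gamma> * r powr (\<delta> - 1)" by (simp add: \<delta>_def flip: powr_add)
      also have "\<dots> \<le> 2 powr \<gamma> * r powr (\<delta> - 1)" using r g by (intro mult_right_mono powr_mono2) auto
      finally show ?thesis .
    qed
    have p2: "r powr \<beta> \<le> 2 powr (\<gamma> + 1) * r powr (\<delta> - 1)"
    proof -
      have "r powr \<beta> = r powr (\<gamma> + 1) * r powr (\<delta> - 1)" by (simp add: \<delta>_def flip: powr_add)
      also have "\<dots> \<le> 2 powr (\<gamma> + 1) * r powr (\<delta> - 1)" using r g by (intro mult_right_mono powr_mono2) auto
      finally show ?thesis .
    qed
    have p3: "r powr \<beta> * r powr (- \<gamma> - 1) = r powr (\<delta> - 1)"
      by (simp add: \<delta>_def algebra_simps flip: powr_add)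
    have "cmod (G' t) \<le> r powr \<beta> * \<bar>pi + (- \<gamma> * r powr (- \<gamma> - 1)) * (2 * (pi * cos (pi * t)))\<bar>
        + \<bar>\<beta> * r powr (\<beta> - 1) * (2 * (pi * cos (pi * t)))\<bar>"
      unfolding G'_def norm_mult r_def[symmetric]
      by (simp only: norm_minus_cancel norm_ii mult_1) 
         (rule norm_triangle_le, simp only: norm_mult norm_of_real norm_cis norm_ii, simp)
    also have "\<dots> \<le> r powr \<beta> * (pi + \<gamma> * r powr (- \<gamma> - 1) * (2 * pi)) + \<beta> * r powr (\<beta> - 1) * (2 * pi)"
    proof (intro add_mono mult_left_mono)
      have "\<bar>(- \<gamma> * r powr (- \<gamma> - 1)) * (2 * (pi * cos (pi * t)))\<bar> \<le> \<gamma> * r powr (- \<gamma> - 1) * (2 * pi)"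
        unfolding abs_mult[of "- \<gamma> * _"] using c g by (intro mult_mono) (auto simp: abs_mult)
      then show "\<bar>pi + (- \<gamma> * r powr (- \<gamma> - 1)) * (2 * (pi * cos (pi * t)))\<bar> \<le> pi + \<gamma> * r powr (- \<gamma> - 1) * (2 * pi)"
        using pi_gt_zero by linarith
      show "\<bar>\<beta> * r powr (\<beta> - 1) * (2 * (pi * cos (pi * t)))\<bar> \<le> \<beta> * r powr (\<beta> - 1) * (2 * pi)"
        unfolding abs_mult[of "\<beta> * _"] using c b by (intro mult_mono) (auto simp: abs_mult)
    qed simp
    also have "\<dots> = pi * r powr \<beta> + 2 * pi * \<gamma> * (r powr \<beta> * r powr (- \<gamma> - 1)) + 2 * pi * \<beta> * r powr (\<beta> - 1)"
      by (simp add: algebra_simps)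
    also have "\<dots> \<le> pi * (2 powr (\<gamma> + 1) * r powr (\<delta> - 1)) + 2 * pi * \<gamma> * r powr (\<delta> - 1) + 2 * pi * \<beta> * (2 powr \<gamma> * r powr (\<delta> - 1))"
      unfolding p3 using p1 p2 b g by (intro add_mono mult_left_mono) auto
    also have "\<dots> = C * r powr (\<delta> - 1)" by (simp add: C_def algebra_simps)
    also have "r powr (\<delta> - 1) \<le> t powr (\<delta> - 1) + (1 - t) powr (\<delta> - 1)"
      using r(3)
    proof
      assume "t \<le> r"
      then have "r powr (\<delta> - 1) \<le> t powr (\<delta> - 1)" using t \<delta> by (intro powr_mono2') auto
      then show ?thesis by (simp add: add_increasing2)
    next
      assume "1 - t \<le> r"
      then have "r powr (\<delta> - 1) \<le> (1 - t) powr (\<delta> - 1)" using t \<delta> by (intro powr_mono2') auto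
      then show ?thesis by (simp add: add_increasing)
    qed
    finally show ?thesis using C by (simp add: mult_left_mono)
  qed
  have step: "cmod (G t - G s) \<le> H t - H s" if "0 \<le> s" "s \<le> t" "t \<le> 1" for s t
  proof (cases "s = t")
    case False
    show ?thesis
    proof (rule differentiable_bound_general[where f' = G' and \<phi>' = "\<lambda>t. C * (t powr (\<delta> - 1) + (1 - t) powr (\<delta> - 1))"])
      show "s < t" using that False by simp
      show "continuous_on {s..t} G" using Gc by (rule continuous_on_subset) (use that in auto)
      show "continuous_on {s..t} H" using Hc by (rule continuous_on_subset) (use that in auto)
    qed (use that in \<open>auto intro!: dG dH G'b\<close>)
  qed simp
  show ?thesis
    unfolding rectifiable_path_def G_def[symmetric]
  proof (intro conjI exI[of _ "H 1 - H 0"] allI impI)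
    show "path G" using Gc by (simp add: path_def)
    fix n :: nat and t :: "nat \<Rightarrow> real"
    assume t: "t 0 = 0 \<and> t n = 1 \<and> (\<forall>i<n. t i \<le> t (Suc i))"
    have lo: "i \<le> n \<Longrightarrow> 0 \<le> t i" for i
    proof (induction i)
      case (Suc i)
      then show ?case using t by (meson Suc_leD Suc_le_eq order_trans)
    qed (use t in simp)
    have hi: "i \<le> n \<Longrightarrow> t i \<le> 1" for i
    proof (induction rule: inc_induct)
      case (step i)
      then show ?case using t by (meson order_trans)
    qed (use t in simp)
    have "(\<Sum>i<n. cmod (G (t (Suc i)) - G (t i))) \<le> (\<Sum>i<n. H (t (Suc i)) - H (t i))"
      using t lo hi by (intro sum_mono step) auto
    also have "\<dots> = H 1 - H 0" using t by (subst sum_lessThan_telescope) simp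
    finally show "(\<Sum>i<n. cmod (G (t (Suc i)) - G (t i))) \<le> H 1 - H 0" .
  qed
qed

section \<open>Nonexistence of a Sobolev extension\<close>

text \<open>Rotating by \<open>- y\<close> makes the second vector real, so the imaginary part sees
  only the first. The other radius \<open>B\<close> drops out of the bound.\<close>

lemma polar_diff_ge:
  assumes "0 \<le> A"
  shows "A * \<bar>sin (x - y)\<bar> \<le> cmod (of_real A * cis x - of_real B * cis y)"
proof -
  have "A * \<bar>sin (x - y)\<bar> = \<bar>Im ((of_real A * cis x - of_real B * cis y) * cis (- y))\<bar>"
    using assms by (simp add: left_diff_distrib mult.assoc cis_mult abs_mult)
  also have "\<dots> \<le> cmod ((of_real A * cis x - of_real B * cis y) * cis (- y))"
    by (rule abs_Im_le_cmod)
  finally show ?thesis by (simp add: norm_mult)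
qed

text \<open>On this arc, height and distance from 1 are comparable, so heights in the strip estimate
  translate into radii in the spiral.\<close>

lemma one_minus_circle_point:
  assumes "0 \<le> y" "y \<le> 1"
  defines "\<zeta> \<equiv> Complex (sqrt (1 - y\<^sup>2)) y"
  shows "\<zeta> \<in> sphere 0 1" "y \<le> cmod (1 - \<zeta>)" "cmod (1 - \<zeta>) \<le> 2 * y"
proof -
  have y2: "y\<^sup>2 \<le> y" "y\<^sup>2 \<le> 1" using assms(1,2) by (auto simp: power2_eq_square mult_left_le mult_le_one)
  show "\<zeta> \<in> sphere 0 1" using y2 by (simp add: \<zeta>_def cmod_def)
  show "y \<le> cmod (1 - \<zeta>)" using abs_Im_le_cmod[of "1 - \<zeta>"] by (simp add: \<zeta>_def)
  have "(1 - y\<^sup>2)\<^sup>2 \<le> (1 - y\<^sup>2) * 1" unfolding power2_eq_square[of "1 - _"]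
    using y2 by (intro mult_left_mono) auto
  then have "1 - y\<^sup>2 \<le> sqrt (1 - y\<^sup>2)" by (intro real_le_rsqrt) simp
  moreover have "sqrt (1 - y\<^sup>2) \<le> 1" by simp
  ultimately have "\<bar>1 - sqrt (1 - y\<^sup>2)\<bar> \<le> y" using y2 by linarith
  then show "cmod (1 - \<zeta>) \<le> 2 * y" using cmod_le[of "1 - \<zeta>"] assms(1) by (simp add: \<zeta>_def)
qed

text \<open>Between boundary arcs at distance about \<open>r\<close> from 1 the angle changes by at
  least \<open>r powr (- p)\<close>, while the angle is Lipschitz in \<open>h\<close> with a
  constant of order \<open>r powr (- \<beta>)\<close> and the weak derivatives have mass of order
  \<open>r powr (2 - 2 / p)\<close> on the square. Inserted into \<open>strip_bound\<close>, this
  leaves \<open>1 \<le> C * r powr \<delta>\<close> for all small \<open>r\<close>.\<close>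

lemma no_sobolev_extension:
  fixes p :: real
  assumes p: "2 < p"
  defines "\<delta> \<equiv> (p - 2) / (2 * p)"
  defines "T \<equiv> twist (p + \<delta>) p"
  assumes hc: "continuous_on (cball 0 1) h" and hi: "inj_on h (cball 0 1)"
    and him: "h ` cball 0 1 \<subseteq> T ` cball 1 1"
    and hb: "\<And>z. z \<in> sphere 0 1 \<Longrightarrow> h z = T (1 - z)"
  shows "\<not> sobolev_W1p p (ball 0 1) h"
proof
  assume S: "sobolev_W1p p (ball 0 1) h"
  define \<beta> where "\<beta> = p + \<delta>"
  have \<delta>: "0 < \<delta>" "\<delta> < 1" "1 - 2 / p = 2 * \<delta>"
    using p by (auto simp: \<delta>_def field_simps)
  have cb: "cball 1 1 \<subseteq> cball (0::complex) 2"
    by (simp add: cball_subset_cball_iff)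
  have Tc: "continuous_on (cball 1 1) T"
    unfolding T_def by (rule continuous_on_subset[OF continuous_on_twist cb]) (use p \<delta> in auto)
  have Ti: "inj T" unfolding T_def by (rule inj_twist) (use p \<delta> in auto)
  \<comment> \<open>\<open>T\<close> is injective and continuous on a compact disk, so its inverse
    is continuous; \<open>Z\<close> straightens \<open>h\<close> back to a disk, where the spiral
    has been unwound and a logarithm is available.\<close>
  obtain R where R: "homeomorphism (cball 1 1) (T ` cball 1 1) T R"
    using homeomorphism_compact[OF compact_cball Tc refl inj_on_subset[OF Ti subset_UNIV]] by blast
  define Z where "Z \<zeta> = R (h \<zeta>)" for \<zeta>
  have Zc: "continuous_on (cball 0 1) Z"
    unfolding Z_def using R him by (intro continuous_on_compose2[OF homeomorphism_cont2[OF R] hc]) auto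
  have ZT: "T (Z \<zeta>) = h \<zeta>" "Z \<zeta> \<in> cball 1 1" if "\<zeta> \<in> cball 0 1" for \<zeta>
  proof -
    have "h \<zeta> \<in> T ` cball 1 1" using him that by blast
    then show "T (Z \<zeta>) = h \<zeta>" "Z \<zeta> \<in> cball 1 1"
      unfolding Z_def using homeomorphism_apply2[OF R] homeomorphism_image2[OF R] by blast+
  qed
  have Zb: "Z \<zeta> = 1 - \<zeta>" if "\<zeta> \<in> sphere 0 1" for \<zeta>
  proof -
    have "T (Z \<zeta>) = T (1 - \<zeta>)" using ZT(1)[of \<zeta>] hb[OF that] that by simp
    then show ?thesis using Ti by (simp add: inj_eq)
  qed
  \<comment> \<open>Injectivity of \<open>h\<close> enters here: the tip is already taken by the
    boundary point 1.\<close>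
  have Z0: "Z \<zeta> \<noteq> 0" if "\<zeta> \<in> cball 0 1 - {1}" for \<zeta>
  proof
    assume "Z \<zeta> = 0"
    then have "h \<zeta> = h 1" using ZT(1)[of \<zeta>] that hb[of 1] by (simp add: T_def)
    then show False using hi that unfolding inj_on_def by auto
  qed
  \<comment> \<open>The closed disk of radius 1 about 1 meets the imaginary axis only at 0.\<close>
  have ZRe: "0 < Re (Z \<zeta>)" if "\<zeta> \<in> cball 0 1 - {1}" for \<zeta>
  proof -
    have "cmod (1 - Z \<zeta>) \<le> 1" using ZT(2)[of \<zeta>] that by (simp add: dist_norm)
    then have "(1 - Re (Z \<zeta>))\<^sup>2 + (Im (Z \<zeta>))\<^sup>2 \<le> 1" by (simp add: cmod_def)
    then have "(Re (Z \<zeta>))\<^sup>2 + (Im (Z \<zeta>))\<^sup>2 \<le> 2 * Re (Z \<zeta>)" by (simp add: power2_eq_square algebra_simps)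
    moreover have "0 < (Re (Z \<zeta>))\<^sup>2 + (Im (Z \<zeta>))\<^sup>2"
      using Z0[OF that] by (simp add: complex_eq_iff sum_power2_gt_zero_iff)
    ultimately show ?thesis by linarith
  qed
  \<comment> \<open>a continuous winding angle of \<open>h\<close> around the tip \<open>0\<close>\<close>
  define \<Omega> where "\<Omega> \<zeta> = Im (Ln (Z \<zeta>)) + cmod (Z \<zeta>) powr (- p)" for \<zeta>
  have \<Omega>c: "continuous_on (cball 0 1 - {1}) \<Omega>"
  proof -
    have c: "continuous_on (cball 0 1 - {1}) Z" using Zc by (rule continuous_on_subset) auto
    show ?thesis unfolding \<Omega>_def
    proof (intro continuous_intros c)
      show "Z \<zeta> \<notin> \<real>\<^sub>\<le>\<^sub>0" if "\<zeta> \<in> cball 0 1 - {1}" for \<zeta>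
        using ZRe[OF that] by (auto simp: complex_nonpos_Reals_iff)
      show "\<forall>\<zeta>\<in>cball 0 1 - {1}. cmod (Z \<zeta>) \<noteq> 0" using Z0 by auto
    qed
  qed
  \<comment> \<open>The argument of a point in the right half plane is below pi/2, hence below 2, in
    absolute value.\<close>
  have \<Omega>b: "\<bar>\<Omega> \<zeta> - cmod (Z \<zeta>) powr (- p)\<bar> \<le> 2" if "\<zeta> \<in> cball 0 1 - {1}" for \<zeta>
    using Re_Ln_pos_lt_imp[OF ZRe[OF that]] pi_less_4 by (simp add: \<Omega>_def)
  have hpol: "h \<zeta> = of_real (cmod (Z \<zeta>) powr \<beta>) * cis (\<Omega> \<zeta>)" if "\<zeta> \<in> cball 0 1 - {1}" for \<zeta>
  proof -
    have "sgn (Z \<zeta>) = cis (Im (Ln (Z \<zeta>)))"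
      using Z0[OF that] by (simp add: cis_Arg flip: Arg_eq_Im_Ln)
    then show ?thesis
      using ZT(1)[of \<zeta>] that by (simp add: T_def twist_def \<beta>_def \<Omega>_def mult.assoc cis_mult)
  qed
  have ex: "\<exists>g. Lp_on p (ball 0 1) g \<and> weak_partial b (ball 0 1) h g" for b
    using S unfolding sobolev_W1p_def weak_partial_def by meson
  obtain g1 where g1: "Lp_on p (ball 0 1) g1" "weak_partial False (ball 0 1) h g1"
    using ex[of False] by blast
  obtain g2 where g2: "Lp_on p (ball 0 1) g2" "weak_partial True (ball 0 1) h g2"
    using ex[of True] by blast
  have U: "ball 0 1 \<in> lmeasurable" by simp
  have p1: "1 \<le> p" using p by simp
  note i1 = Lp_on_set_integrable[OF g1(1) p1 U] and i2 = Lp_on_set_integrable[OF g2(1) p1 U]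
  define A where "A g = (LINT z:ball 0 1|lebesgue. cmod (g z) powr p)" for g :: "complex \<Rightarrow> complex"
  have A0: "0 \<le> A g" for g
    unfolding A_def set_lebesgue_integral_def by (rule Bochner_Integration.integral_nonneg) simp
  \<comment> \<open>The 12 is the area of a box with sides \<open>4 * r\<close> and
    \<open>3 * r\<close>, divided by \<open>r\<^sup>2\<close>.\<close>
  define M where "M = 12 + A g1 + A g2"
  have M: "0 < M" using A0[of g1] A0[of g2] by (simp add: M_def)
  \<comment> \<open>48 is 24 times the 2 in \<open>K\<close> below; \<open>strip_bound\<close>
    produces the factor 17, which is rounded up to 24.\<close>
  define C where "C = 48 * 4 powr \<beta> * M"
  have C: "0 < C" using M by (simp add: C_def)
  have key: "1 \<le> C * r powr \<delta>" if r: "0 < r" "r \<le> 1 / 10" for r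
  proof -
    define N where "N = r powr (- p)"
    have N: "10 \<le> N"
    proof -
      have "(10::real) = 10 powr 1" by simp
      also have "\<dots> \<le> 10 powr p" using p by (intro powr_mono) auto
      also have "10 powr p = (1 / 10) powr (- p)" by (simp add: powr_divide powr_minus field_simps)
      also have "\<dots> \<le> N" unfolding N_def using r p by (intro powr_mono2') auto
      finally show ?thesis .
    qed
    \<comment> \<open>Halving the distance to the tip multiplies
      \<open>cmod (Z \<zeta>) powr (- p)\<close> by at least 4, so the angle at the inner arc
      reaches \<open>4 * N - 2\<close>, against \<open>N + 2\<close> at the outer one.\<close>
    have four: "4 \<le> (2::real) powr p" 
      using powr_mono[of 2 p "2::real"] p by simp
    \<comment> \<open>The angle exceeds \<open>b\<close> on the boundary arc \<open>|1 - \<zeta>| \<le> r / 2\<close> and stays below \<open>a\<close> where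
      \<open>r \<le> |1 - \<zeta>|\<close>; clamping it to \<open>[a, b]\<close> confines the Lipschitz estimate to
      \<open>r / 4 \<le> |Z|\<close>.\<close>
    define a b where "a = N + 2" and "b = 4 * N - 2"
    have ab: "a \<le> b" "N \<le> b - a" using N by (auto simp: a_def b_def)
    define v where "v \<zeta> = max a (min b (\<Omega> \<zeta>))" for \<zeta>
    \<comment> \<open>The radius of \<open>h\<close> is at least \<open>(r / 4) powr \<beta>\<close>
      where the clamp is inactive from above; the 2 comes from
      \<open>abs_sin_ge_half\<close>.\<close>
    define K where "K = 2 * (r / 4) powr (- \<beta>)"
    have K0: "0 < K" using r by (simp add: K_def)
    have vc: "continuous_on (cball 0 1 - {1}) v"
      unfolding v_def by (intro continuous_on_max continuous_on_min continuous_on_const \<Omega>c)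
    have hlow: "(r / 4) powr \<beta> \<le> cmod (Z \<zeta>) powr \<beta>" if \<zeta>: "\<zeta> \<in> cball 0 1 - {1}" "\<Omega> \<zeta> \<le> b" for \<zeta>
    proof (rule powr_mono2)
      show "r / 4 \<le> cmod (Z \<zeta>)"
      proof (rule ccontr)
        assume "\<not> r / 4 \<le> cmod (Z \<zeta>)"
        then have "(r / 4) powr (- p) < cmod (Z \<zeta>) powr (- p)"
          using Z0[OF \<zeta>(1)] p by (intro powr_less_mono2_neg) auto
        moreover have "(r / 4) powr (- p) = 4 powr p * N"
          using r by (simp add: N_def powr_divide powr_minus field_simps)
        moreover have "4 * N \<le> 4 powr p * N"
          using N powr_mono[of 1 p "4::real"] p by (intro mult_right_mono) auto
        ultimately have "4 * N < cmod (Z \<zeta>) powr (- p)" by linarith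
        then show False using \<Omega>b[OF \<zeta>(1)] \<zeta>(2) by (simp add: b_def)
      qed
    qed (use r p \<delta> in \<open>auto simp: \<beta>_def\<close>)
    \<comment> \<open>The restriction to angles at most 1 apart excludes neighbouring turns of the
      spiral, where values of \<open>h\<close> can be close although the angles differ by about 2
      pi.\<close>
    have liph: "\<bar>\<Omega> z - \<Omega> w\<bar> \<le> K * cmod (h z - h w)"
      if zw: "z \<in> cball 0 1 - {1}" "w \<in> cball 0 1 - {1}" "\<bar>\<Omega> z - \<Omega> w\<bar> \<le> 1" "\<Omega> z \<le> b" for z w
    proof -
      have "\<bar>\<Omega> z - \<Omega> w\<bar> / 2 \<le> \<bar>sin (\<Omega> z - \<Omega> w)\<bar>"
        using zw(3) pi_gt3 by (intro abs_sin_ge_half) linarith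
      then have "(r / 4) powr \<beta> * (\<bar>\<Omega> z - \<Omega> w\<bar> / 2) \<le> cmod (Z z) powr \<beta> * \<bar>sin (\<Omega> z - \<Omega> w)\<bar>"
        by (intro mult_mono hlow zw) auto
      also have "\<dots> \<le> cmod (h z - h w)"
        unfolding hpol[OF zw(1)] hpol[OF zw(2)] by (rule polar_diff_ge) simp
      finally show ?thesis using r by (simp add: K_def powr_minus field_simps)
    qed
    have lip: "rel_lip K (ball 0 1) h v"
      unfolding rel_lip_def
    proof (intro allI impI)
      fix D :: "complex set" assume D: "compact D" "D \<subseteq> ball 0 1"
      have D': "D \<subseteq> cball 0 1 - {1}" using D(2) by (auto simp: subset_iff)
      have "uniformly_continuous_on D \<Omega>"
        by (intro compact_uniformly_continuous continuous_on_subset[OF \<Omega>c D'] D(1))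
      then obtain d where d: "0 < d" "\<And>z w. z \<in> D \<Longrightarrow> w \<in> D \<Longrightarrow> dist w z < d \<Longrightarrow> dist (\<Omega> w) (\<Omega> z) < 1"
        unfolding uniformly_continuous_on_def by (metis zero_less_one)
      show "\<exists>d>0. \<forall>z\<in>D. \<forall>w\<in>D. dist z w < d \<longrightarrow> \<bar>v z - v w\<bar> \<le> K * cmod (h z - h w)"
      proof (intro exI[of _ d] conjI d(1) ballI impI)
        fix z w assume zw: "z \<in> D" "w \<in> D" "dist z w < d"
        have "\<bar>\<Omega> z - \<Omega> w\<bar> \<le> 1" using d(2)[OF zw(2,1,3)] by (simp add: dist_real_def)
        have l: "\<bar>v z - v w\<bar> \<le> \<bar>\<Omega> z - \<Omega> w\<bar>" unfolding v_def by (auto simp: max_def min_def)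
        \<comment> \<open>\<open>polar_diff_ge\<close> uses the radius of one point only, so it is
          enough that one of the two angles is at most \<open>b\<close>; if neither is, both are
          clamped to the same value.\<close>
        consider "\<Omega> z \<le> b" | "\<Omega> w \<le> b" | "b < \<Omega> z" "b < \<Omega> w" by linarith
        then show "\<bar>v z - v w\<bar> \<le> K * cmod (h z - h w)"
        proof cases
          case 1
          then show ?thesis using l liph[of z w] zw D' \<open>\<bar>\<Omega> z - \<Omega> w\<bar> \<le> 1\<close> by (auto simp: subset_iff)
        next
          case 2
          then have "\<bar>\<Omega> w - \<Omega> z\<bar> \<le> K * cmod (h w - h z)"
            using zw D' \<open>\<bar>\<Omega> z - \<Omega> w\<bar> \<le> 1\<close> by (intro liph) (auto simp: subset_iff)
          then show ?thesis using l by (simp add: norm_minus_commute)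
        next
          case 3
          then have "v z = v w" by (simp add: v_def)
          then show ?thesis using K0 by simp
        qed
      qed
    qed
    have bd: "Complex (sqrt (1 - y\<^sup>2)) y \<in> cball 0 1 - {1}"
      "Z (Complex (sqrt (1 - y\<^sup>2)) y) = 1 - Complex (sqrt (1 - y\<^sup>2)) y" if "0 < y" "y \<le> 1" for y
      using one_minus_circle_point(1)[of y] that by (auto simp: Zb complex_eq_iff)
    have vA: "v (Complex (sqrt (1 - y\<^sup>2)) y) = b" if y: "y \<in> {r/8..r/4}" for y
    proof -
      define \<zeta> where "\<zeta> = Complex (sqrt (1 - y\<^sup>2)) y"
      have y': "0 < y" "y \<le> 1" using y r by auto
      have "cmod (Z \<zeta>) \<le> r / 2"
        using one_minus_circle_point(3)[of y] bd(2)[OF y'] y y' by (simp add: \<zeta>_def)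
      moreover have "0 < cmod (Z \<zeta>)" using Z0 bd(1)[OF y'] by (simp add: \<zeta>_def)
      ultimately have "(r / 2) powr (- p) \<le> cmod (Z \<zeta>) powr (- p)" using p by (intro powr_mono2') auto
      moreover have "(r / 2) powr (- p) = 2 powr p * N"
        using r by (simp add: N_def powr_divide powr_minus field_simps)
      moreover have "4 * N \<le> 2 powr p * N" using N four by (intro mult_right_mono) auto
      ultimately have "b \<le> \<Omega> \<zeta>" using \<Omega>b[OF bd(1)[OF y']] by (simp add: b_def \<zeta>_def)
      then show ?thesis using ab by (simp add: v_def \<zeta>_def)
    qed
    have vB: "v (Complex (sqrt (1 - y\<^sup>2)) y) = a" if y: "y \<in> {r/8 + 2*r..r/4 + 2*r}" for y
    proof -
      define \<zeta> where "\<zeta> = Complex (sqrt (1 - y\<^sup>2)) y"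
      have y': "0 < y" "y \<le> 1" "r \<le> y" using y r by auto
      have "r \<le> cmod (Z \<zeta>)"
        using one_minus_circle_point(2)[of y] bd(2)[OF y'(1,2)] y' by (simp add: \<zeta>_def)
      then have "cmod (Z \<zeta>) powr (- p) \<le> N" unfolding N_def using p r by (intro powr_mono2') auto
      then have "\<Omega> \<zeta> \<le> a" using \<Omega>b[OF bd(1)[OF y'(1,2)]] by (simp add: a_def \<zeta>_def)
      then show ?thesis using ab by (simp add: v_def \<zeta>_def)
    qed
    define Q where "Q = {z. 1 - 4 * r \<le> Re z \<and> 0 \<le> Im z \<and> Im z \<le> 3 * r} \<inter> ball 0 1"
    have "r * (r / 8 * \<bar>b - a\<bar>) \<le> 2 * r * (K * mass g1 Q) + r / 8 * (K * mass g2 Q)"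
      unfolding Q_def
    proof (rule strip_bound[OF _ i1 g1(2) i2 g2(2) _ lip _ r _ vA vB])
      show "continuous_on (ball 0 1) h" using hc by (rule continuous_on_subset) auto
      show "continuous_on (ball 0 1) v" using vc by (rule continuous_on_subset) auto
      show "continuous_on (cball 0 1 \<inter> {z. r / 8 \<le> Im z}) v"
        using vc by (rule continuous_on_subset) (use r in auto)
    qed (use K0 in auto)
    moreover have mQ: "mass g Q \<le> M * r powr (2 - 2 / p)" if g: "Lp_on p (ball 0 1) g" "A g \<le> M - 12" for g
    proof -
      \<comment> \<open>This level balances \<open>s * r\<^sup>2\<close> with
        \<open>s powr (1 - p)\<close>: both become \<open>r powr (2 - 2 / p)\<close>.\<close>
      define s where "s = r powr (- 2 / p)"
      have Qm: "Q \<in> sets lebesgue" unfolding Q_def by (rule lebesgue_borelI) measurable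
      have Qsub: "Q \<subseteq> cbox (Complex (1 - 4 * r) 0) (Complex 1 (3 * r))"
      proof
        fix z assume "z \<in> Q"
        moreover have "Re z \<le> cmod z" by (rule complex_Re_le_cmod)
        ultimately show "z \<in> cbox (Complex (1 - 4 * r) 0) (Complex 1 (3 * r))"
          by (auto simp: Q_def cbox_def Basis_complex_def)
      qed
      have "measure lebesgue Q \<le> measure lebesgue (cbox (Complex (1 - 4 * r) 0) (Complex 1 (3 * r)))"
        by (rule measure_mono_fmeasurable[OF Qsub Qm]) simp
      also have "\<dots> = 12 * r\<^sup>2"
        using r by (subst measure_completion) (auto simp: measure_lborel_cbox_eq Basis_complex_def power2_eq_square)
      finally have Q12: "measure lebesgue Q \<le> 12 * r\<^sup>2" .
      have s0: "0 < s" using r by (simp add: s_def)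
      have "mass g Q \<le> s * measure lebesgue Q + s powr (1 - p) * A g"
        unfolding A_def by (rule mass_le_powr[OF g(1) p1 U Qm _ s0]) (auto simp: Q_def)
      also have "\<dots> \<le> s * (12 * r\<^sup>2) + s powr (1 - p) * (M - 12)"
        using s0 Q12 g(2) by (intro add_mono mult_left_mono) auto
      also have "s * (12 * r\<^sup>2) = 12 * r powr (2 - 2 / p)"
      proof -
        have "r\<^sup>2 = r powr 2" using r by simp
        then show ?thesis by (simp add: s_def flip: powr_add)
      qed
      also have "s powr (1 - p) = r powr (2 - 2 / p)"
      proof -
        have "- 2 / p * (1 - p) = 2 - 2 / p" using p by (simp add: field_simps)
        then show ?thesis by (simp only: s_def powr_powr)
      qed
      finally show ?thesis by (simp add: algebra_simps)
    qed
    have "mass g1 Q \<le> M * r powr (2 - 2 / p)" "mass g2 Q \<le> M * r powr (2 - 2 / p)"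
      using A0[of g1] A0[of g2] mQ[OF g1(1)] mQ[OF g2(1)] by (simp_all add: M_def)
    then have "2 * r * (K * mass g1 Q) + r / 8 * (K * mass g2 Q)
        \<le> 2 * r * (K * (M * r powr (2 - 2 / p))) + r / 8 * (K * (M * r powr (2 - 2 / p)))"
      using r K0 by (intro add_mono mult_left_mono) auto
    ultimately have "r * (r / 8 * \<bar>b - a\<bar>) \<le> r * (17 / 8 * (K * (M * r powr (2 - 2 / p))))"
      by (simp add: algebra_simps)
    then have "r / 8 * \<bar>b - a\<bar> \<le> 17 / 8 * (K * (M * r powr (2 - 2 / p)))"
      using r by simp
    moreover have "r / 8 * N \<le> r / 8 * \<bar>b - a\<bar>" using ab r by (intro mult_left_mono) auto
    ultimately have "r * N \<le> 17 * (K * (M * r powr (2 - 2 / p)))" by linarith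
    also have "\<dots> \<le> 24 * (K * (M * r powr (2 - 2 / p)))" using K0 M by (intro mult_right_mono) auto
    also have "\<dots> = C * (r powr (- \<beta>) * r powr (2 - 2 / p))"
      using r by (simp add: K_def C_def powr_divide powr_minus field_simps)
    also have "r powr (- \<beta>) * r powr (2 - 2 / p) = r powr (1 - p) * r powr \<delta>"
    proof -
      have "- \<beta> + (2 - 2 / p) = 1 - p + \<delta>" using \<delta>(3) unfolding \<beta>_def by linarith
      then show ?thesis by (simp only: flip: powr_add)
    qed
    also have "r * N = r powr (1 - p)" using r by (simp add: N_def powr_diff powr_minus field_simps)
    finally have "r powr (1 - p) * 1 \<le> r powr (1 - p) * (C * r powr \<delta>)" by (simp add: mult_ac)
    then show ?thesis using r by (subst (asm) mult_le_cancel_left_pos) auto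
  qed
  \<comment> \<open>Small enough for \<open>C * r powr \<delta>\<close> to be at most 1/2.\<close>
  define r where "r = min (1 / 10) ((1 / (2 * C)) powr (1 / \<delta>))"
  have r: "0 < r" "r \<le> 1 / 10" "r \<le> (1 / (2 * C)) powr (1 / \<delta>)" using C by (auto simp: r_def)
  have "r powr \<delta> \<le> ((1 / (2 * C)) powr (1 / \<delta>)) powr \<delta>" using r \<delta> by (intro powr_mono2) auto
  also have "\<dots> = 1 / (2 * C)" using \<delta> C by (simp add: powr_powr)
  finally have "C * r powr \<delta> \<le> C * (1 / (2 * C))" using C by (intro mult_left_mono) auto
  then show False using key[OF r(1,2)] C by simp
qed

theorem theorem1p4:
  fixes p :: real
  assumes "2 < p"
  shows "\<exists>(Y::complex set) (\<phi>::complex \<Rightarrow> complex).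
    jordan_domain_rectifiable_boundary Y \<and>
    (\<exists>\<phi>'. homeomorphism (sphere 0 1) (frontier Y) \<phi> \<phi>') \<and>
    (\<integral>\<^sup>+ s \<in> {0..2*pi}. (\<integral>\<^sup>+ t \<in> {0..2*pi}.
        ennreal ((cmod (\<phi> (cis s) - \<phi> (cis t)) / cmod (cis s - cis t)) powr p) \<partial>lborel) \<partial>lborel)
      < \<infinity> \<and>
    \<not> (\<exists>h h'. homeomorphism (cball 0 1) (closure Y) h h' \<and>
              (\<forall>z\<in>sphere 0 1. h z = \<phi> z) \<and> sobolev_W1p p (ball 0 1) h)"
proof -
  define \<delta> where "\<delta> = (p - 2) / (2 * p)"
  define \<beta> where "\<beta> = p + \<delta>"
  define T where "T = twist \<beta> p"
  define \<phi> where "\<phi> z = T (1 - z)" for z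
  define c where "c t = cis (2 * pi * t)" for t
  define G where "G = \<phi> \<circ> c"
  define Y where "Y = inside (path_image G)"
  have \<delta>: "0 < \<delta>" "\<delta> < 1" using assms by (auto simp: \<delta>_def field_simps)
  have \<beta>: "1 \<le> \<beta>" "0 < p" "p < \<beta>" "\<beta> < p + 1" using assms \<delta> by (auto simp: \<beta>_def)
  have le2: "cmod (1 - z) \<le> 2" if "z \<in> cball 0 1" for z :: complex
    using norm_triangle_ineq4[of 1 z] that by simp
  have \<phi>c: "continuous_on (cball 0 1) \<phi>"
    unfolding \<phi>_def T_def
    by (rule continuous_on_compose2[OF continuous_on_twist]) (use \<beta> le2 in \<open>auto intro!: continuous_intros\<close>)
  have \<phi>i: "inj_on \<phi> (cball 0 1)"
    using inj_twist[of \<beta> p] \<beta> by (auto simp: \<phi>_def T_def inj_eq intro: inj_onI)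
  have cs: "simple_path c" "path_image c = sphere 0 1"
    unfolding c_def[abs_def] by (rule simple_path_unit_circle path_image_unit_circle)+
  have G: "simple_path G" "pathfinish G = pathstart G" "path_image G = \<phi> ` sphere 0 1"
  proof -
    show "simple_path G"
      unfolding G_def
      by (rule simple_path_continuous_image[OF cs(1)])
         (auto simp: cs(2) intro: continuous_on_subset[OF \<phi>c] inj_on_subset[OF \<phi>i])
    show "pathfinish G = pathstart G" by (simp add: G_def c_def pathfinish_def pathstart_def)
    show "path_image G = \<phi> ` sphere 0 1" by (simp add: G_def path_image_compose cs(2))
  qed
  \<comment> \<open>This encloses \<open>closure Y\<close> in the compact image of the closed disk,
    on which \<open>T\<close> can be inverted.\<close>
  have YB: "Y = \<phi> ` ball 0 1"
    unfolding Y_def by (rule inside_jordan_image[OF zero_less_one \<phi>c \<phi>i G])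
  have rectifiable: "rectifiable_path G"
    using rectifiable_twist_circle[of \<beta> p] \<beta> by (simp add: G_def c_def \<phi>_def T_def o_def)
  have fr: "frontier Y = \<phi> ` sphere 0 1"
    using Jordan_inside_outside[OF G(1,2)] by (simp add: Y_def G(3))
  have homeo: "\<exists>\<phi>'. homeomorphism (sphere 0 1) (frontier Y) \<phi> \<phi>'"
    unfolding fr
    by (rule homeomorphism_compact)
       (auto intro: continuous_on_subset[OF \<phi>c] inj_on_subset[OF \<phi>i])
  obtain C where C: "0 < C" "\<And>z w. cmod z \<le> 2 \<Longrightarrow> cmod w \<le> 2 \<Longrightarrow>
      cmod (twist \<beta> p z - twist \<beta> p w) \<le> C * cmod (z - w) powr (\<beta> / (1 + p))"
    using twist_hoelder[of \<beta> p] \<beta> by (metis add.commute less_imp_le)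
  have fin: "(\<integral>\<^sup>+ s \<in> {0..2*pi}. (\<integral>\<^sup>+ t \<in> {0..2*pi}.
        ennreal ((cmod (\<phi> (cis s) - \<phi> (cis t)) / cmod (cis s - cis t)) powr p) \<partial>lborel) \<partial>lborel) < \<infinity>"
  proof (rule hoelder_double_integral_finite[OF \<beta>(2) C(1)])
    fix z w :: complex assume "z \<in> sphere 0 1" "w \<in> sphere 0 1"
    then show "cmod (\<phi> z - \<phi> w) \<le> C * cmod (z - w) powr (\<beta> / (1 + p))"
      using C(2)[of "1 - z" "1 - w"] le2[of z] le2[of w] by (simp add: \<phi>_def T_def norm_minus_commute)
  next
    show "\<beta> / (1 + p) < 1" using \<beta> by simp
    have "(1 - \<beta> / (1 + p)) * p = p * (1 - \<delta>) / (1 + p)" using \<beta> by (simp add: \<beta>_def field_simps)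
    also have "\<dots> < 1" using \<delta> \<beta> by (simp add: field_simps add_pos_pos)
    finally show "(1 - \<beta> / (1 + p)) * p < 1" .
  qed
  have no: "\<not> (\<exists>h h'. homeomorphism (cball 0 1) (closure Y) h h' \<and>
              (\<forall>z\<in>sphere 0 1. h z = \<phi> z) \<and> sobolev_W1p p (ball 0 1) h)"
  proof clarify
    fix h h' assume h: "homeomorphism (cball 0 1) (closure Y) h h'" "\<forall>z\<in>sphere 0 1. h z = \<phi> z"
      "sobolev_W1p p (ball 0 1) h"
    have "closure Y \<subseteq> \<phi> ` cball 0 1"
      unfolding YB by (intro closure_minimal image_mono compact_imp_closed compact_continuous_image \<phi>c) auto
    also have "\<dots> \<subseteq> T ` cball 1 1" by (auto simp: \<phi>_def dist_norm)
    finally have "h ` cball 0 1 \<subseteq> T ` cball 1 1" using h(1) by (simp add: homeomorphism_def)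
    moreover have "inj_on h (cball 0 1)" using h(1) by (metis homeomorphism_def inj_on_inverseI)
    ultimately have "\<not> sobolev_W1p p (ball 0 1) h"
      using h(1,2) assms homeomorphism_cont1[OF h(1)] unfolding T_def \<beta>_def \<delta>_def
      by (intro no_sobolev_extension) (auto simp: \<phi>_def T_def \<beta>_def \<delta>_def)
    then show False using h(3) by simp
  qed
  have "jordan_domain_rectifiable_boundary Y"
    unfolding jordan_domain_rectifiable_boundary_def using G rectifiable Y_def by blast
  with homeo fin no show ?thesis by blast
qed

end
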